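(* Let $\Omega\subset\mathbb H$ be an axially symmetric s-domain and $f\in\mathcal{SR}(\Omega)$. If $$\frac{\mathbf x}{\|\mathbf x\|^2}\sum_{k=0}^3[\mathrm{Grad}f_k,\mathbf x]\,\mathbf e_k\in L^2(\Omega,\mathbb H),$$ then $$f-\mathcal T\Big[\frac{\mathbf x}{\|\mathbf x\|^2}\sum_{k=0}^3[\mathrm{Grad}f_k,\mathbf x]\,\mathbf e_k\Big]$$ is an $\mathbb H$-valued harmonic function on $\{x\in\Omega\mid\mathbf x\neq0\}$, i.e. its real components are harmonic functions on $\{x\in\Omega\mid\mathbf x\neq0\}$.
   Context: $\mathbb H\cong\mathbb R^4$ is the skew field of real quaternions $x=x_0+x_1\mathbf e_1+x_2\mathbf e_2+x_3\mathbf e_3$, with $\mathbf e_k^2=-1$ and $\mathbf e_1\mathbf e_2\mathbf e_3=-1$; $\mathbf e_0=1$. The vector part of $x$ is $\mathbf x=x_1\mathbf e_1+x_2\mathbf e_2+x_3\mathbf e_3$, identified with $(x_1,x_2,x_3)\in\mathbb R^3$. Write $f=\sum_{k=0}^3f_k\mathbf e_k$ with $f_k$ real valued and $\partial_k=\partial/\partial x_k$. $\mathrm{Grad}\,u=\sum_{k=1}^3\mathbf e_k\partial_ku$ for real valued $u$; $[\mathbf a,\mathbf b]=\frac12(\mathbf a\mathbf b-\mathbf b\mathbf a)$ is the vector (cross) product of $\mathbb R^3$; $[\mathrm{Grad}f_k,\mathbf x]\mathbf e_k$ is a quaternionic product. Let $\mathbb S^2$ be the unit sphere of vectors $\mathbf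 i\in\mathbb R^3\subset\mathbb H$ (so $\mathbf i^2=-1$) and $\mathbb C(\mathbf i)=\{x+\mathbf iy\mid x,y\in\mathbb R\}$. A domain $\Omega\subset\mathbb H$ is axially symmetric if $\Omega\cap\mathbb R\ne\emptyset$ and $x+\mathbf iy\in\Omega$ ($x,y\in\mathbb R$, $\mathbf i\in\mathbb S^2$) implies $x+\mathbf jy\in\Omega$ for all $\mathbf j\in\mathbb S^2$; it is an s-domain if $\Omega_{\mathbf i}=\Omega\cap\mathbb C(\mathbf i)$ is a domain in $\mathbb C(\mathbf i)$ for every $\mathbf i\in\mathbb S^2$. A real differentiable $f:\Omega\to\mathbb H$ is slice regular, $f\in\mathcal{SR}(\Omega)$, if $\frac12\big(\frac{\partial}{\partial x}+\mathbf i\frac{\partial}{\partial y}\big)f|_{\Omega_{\mathbf i}}=0$ on $\Omega_{\mathbf i}$ for every $\mathbf i\in\mathbb S^2$. For $y\in\mathbb H\setminus\{0\}$ let $K(y)=\frac1{2\pi^2}\frac{\overline y}{|y|^4}$ (with $\overline y$ the quaternionic conjugate), and for $g\in L^2(\Omega,\mathbb H)$ let $\mathcal T[g](x)=\int_\Omega K(x-y)\,g(y)\,dy$, with $dy$ Lebesgue measure on $\mathbb R^4$. With this normalization $\mathcal T$ is a right inverse of the Fueter operator $\mathcal D=\sum_{k=0}^3\mathbf e_k\partial_k$, i.e. $\mathcal D\circ\mathcal T[g]=g$. *)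

theory Defs
  imports "HOL-Analysis.Analysis"
begin

text \<open>
  Quaternions are vectors in \<open>\<real>\<^sup>4\<close>, indexed by the elements \<open>0, 1, 2, 3\<close> of the type \<open>4\<close>,
  so that \<open>x $ k\<close> is the coefficient of \<open>qe k\<close>.  The instances of \<open>(*)\<close> and \<open>1\<close> on
  vectors are componentwise and hence not the quaternionic ones; these are
  \<open>\<otimes>\<close> and \<open>qe 0\<close> below.
\<close>

type_synonym quat = "real ^ 4"

definition qe :: "4 \<Rightarrow> quat" where
  "qe k = axis k 1"

definition qmult :: "quat \<Rightarrow> quat \<Rightarrow> quat"  (infixl \<open>\<otimes>\<close> 70) where
  "p \<otimes> q =
     (p $ 0 * q $ 0 - p $ 1 * q $ 1 - p $ 2 * q $ 2 - p $ 3 * q $ 3) *\<^sub>R qe 0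
   + (p $ 0 * q $ 1 + p $ 1 * q $ 0 + p $ 2 * q $ 3 - p $ 3 * q $ 2) *\<^sub>R qe 1
   + (p $ 0 * q $ 2 - p $ 1 * q $ 3 + p $ 2 * q $ 0 + p $ 3 * q $ 1) *\<^sub>R qe 2
   + (p $ 0 * q $ 3 + p $ 1 * q $ 2 - p $ 2 * q $ 1 + p $ 3 * q $ 0) *\<^sub>R qe 3"

definition qvec :: "quat \<Rightarrow> quat" where
  "qvec x = x - (x $ 0) *\<^sub>R qe 0"

definition qcnj :: "quat \<Rightarrow> quat" where
  "qcnj x = (x $ 0) *\<^sub>R qe 0 - qvec x"

definition qbracket :: "quat \<Rightarrow> quat \<Rightarrow> quat" where
  "qbracket a b = (1/2) *\<^sub>R (a \<otimes> b - b \<otimes> a)"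

lemma UNIV_4': "(UNIV :: 4 set) = {0, 1, 2, 3}"
  using UNIV_4 by auto

lemma qe_nth: "qe k $ j = (if j = k then 1 else 0)"
  by (auto simp: qe_def axis_def)

lemma qmult_nth:
  "(p \<otimes> q) $ 0 = p $ 0 * q $ 0 - p $ 1 * q $ 1 - p $ 2 * q $ 2 - p $ 3 * q $ 3"
  "(p \<otimes> q) $ 1 = p $ 0 * q $ 1 + p $ 1 * q $ 0 + p $ 2 * q $ 3 - p $ 3 * q $ 2"
  "(p \<otimes> q) $ 2 = p $ 0 * q $ 2 - p $ 1 * q $ 3 + p $ 2 * q $ 0 + p $ 3 * q $ 1"
  "(p \<otimes> q) $ 3 = p $ 0 * q $ 3 + p $ 1 * q $ 2 - p $ 2 * q $ 1 + p $ 3 * q $ 0"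
  by (simp_all add: qmult_def qe_nth)

lemma quat_eq_iff:
  "p = q \<longleftrightarrow> p $ 0 = q $ 0 \<and> p $ 1 = q $ 1 \<and> p $ 2 = q $ 2 \<and> p $ 3 = (q :: quat) $ 3"
proof -
  have "(\<forall>i. p $ i = q $ i) \<longleftrightarrow> (\<forall>i\<in>{0, 1, 2, 3}. p $ i = q $ i)"
    by (simp flip: UNIV_4')
  then show ?thesis by (simp add: vec_eq_iff)
qed

lemma qmult_assoc: "(p \<otimes> q) \<otimes> r = p \<otimes> (q \<otimes> r)"
  by (simp add: quat_eq_iff qmult_nth algebra_simps)

lemma qmult_one: "qe 0 \<otimes> p = p" "p \<otimes> qe 0 = p"
  by (simp_all add: quat_eq_iff qmult_nth qe_nth)

lemma qe_relations:
  "qe 1 \<otimes> qe 1 = - qe 0" "qe 2 \<otimes> qe 2 = - qe 0" "qe 3 \<otimes> qe 3 = - qe 0"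
  "qe 1 \<otimes> qe 2 \<otimes> qe 3 = - qe 0"
  by (simp_all add: quat_eq_iff qmult_nth qe_nth)


definition imag_sphere :: "quat set" where
  "imag_sphere = {i. i $ 0 = 0 \<and> norm i = 1}"

definition slice_point :: "quat \<Rightarrow> real \<Rightarrow> real \<Rightarrow> quat" where
  "slice_point i x y = x *\<^sub>R qe 0 + y *\<^sub>R i"

definition slice_plane :: "quat \<Rightarrow> quat set" where
  "slice_plane i = {slice_point i x y | x y. True}"

definition real_axis :: "quat set" where
  "real_axis = {x *\<^sub>R qe 0 | x. True}"

definition domain_in :: "quat set \<Rightarrow> quat set \<Rightarrow> bool" where
  "domain_in X U \<longleftrightarrow> openin (top_of_set X) U \<and> connected U \<and> U \<noteq> {}"

definition axially_symmetric :: "quat set \<Rightarrow> bool" where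
  "axially_symmetric \<Omega> \<longleftrightarrow> \<Omega> \<inter> real_axis \<noteq> {} \<and>
     (\<forall>x y. \<forall>i\<in>imag_sphere. slice_point i x y \<in> \<Omega> \<longrightarrow>
        (\<forall>j\<in>imag_sphere. slice_point j x y \<in> \<Omega>))"

definition s_domain :: "quat set \<Rightarrow> bool" where
  "s_domain \<Omega> \<longleftrightarrow> domain_in UNIV \<Omega> \<and>
     (\<forall>i\<in>imag_sphere. domain_in (slice_plane i) (\<Omega> \<inter> slice_plane i))"

definition slice_regular :: "quat set \<Rightarrow> (quat \<Rightarrow> quat) \<Rightarrow> bool" where
  "slice_regular \<Omega> f \<longleftrightarrow> (\<forall>x\<in>\<Omega>. f differentiable (at x)) \<and>
     (\<forall>i\<in>imag_sphere. \<forall>x y. slice_point i x y \<in> \<Omega> \<longrightarrow>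
        (1/2) *\<^sub>R (vector_derivative (\<lambda>t. f (slice_point i t y)) (at x)
                 + i \<otimes> vector_derivative (\<lambda>t. f (slice_point i x t)) (at y)) = 0)"


definition partial_deriv :: "4 \<Rightarrow> (quat \<Rightarrow> real) \<Rightarrow> quat \<Rightarrow> real" where
  "partial_deriv k u x = deriv (\<lambda>t. u (x + t *\<^sub>R qe k)) 0"

definition Grad :: "(quat \<Rightarrow> real) \<Rightarrow> quat \<Rightarrow> quat" where
  "Grad u x = (\<Sum>k\<in>{1, 2, 3}. partial_deriv k u x *\<^sub>R qe k)"

text \<open>The value at real \<open>x\<close> is the junk value \<open>0\<close>; the real axis is a null set.\<close>

definition bracket_sum :: "(quat \<Rightarrow> quat) \<Rightarrow> quat \<Rightarrow> quat" where
  "bracket_sum f x = ((1 / (norm (qvec x))\<^sup>2) *\<^sub>R qvec x) \<otimes>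
     (\<Sum>k\<in>UNIV. qbracket (Grad (\<lambda>y. f y $ k) x) (qvec x) \<otimes> qe k)"

definition L2_on :: "quat set \<Rightarrow> (quat \<Rightarrow> quat) \<Rightarrow> bool" where
  "L2_on \<Omega> g \<longleftrightarrow> set_borel_measurable lebesgue \<Omega> g \<and>
     set_integrable lebesgue \<Omega> (\<lambda>y. (norm (g y))\<^sup>2)"

definition fueter_kernel :: "quat \<Rightarrow> quat" where
  "fueter_kernel y = (1 / (2 * pi\<^sup>2)) *\<^sub>R ((1 / norm y ^ 4) *\<^sub>R qcnj y)"

definition teodorescu :: "quat set \<Rightarrow> (quat \<Rightarrow> quat) \<Rightarrow> quat \<Rightarrow> quat" where
  "teodorescu \<Omega> g x = set_lebesgue_integral lebesgue \<Omega> (\<lambda>y. fueter_kernel (x - y) \<otimes> g y)"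


definition C1_on :: "quat set \<Rightarrow> (quat \<Rightarrow> real) \<Rightarrow> bool" where
  "C1_on U u \<longleftrightarrow> (\<forall>x\<in>U. u differentiable (at x)) \<and> (\<forall>k. continuous_on U (partial_deriv k u))"

definition C2_on :: "quat set \<Rightarrow> (quat \<Rightarrow> real) \<Rightarrow> bool" where
  "C2_on U u \<longleftrightarrow> C1_on U u \<and> (\<forall>k. C1_on U (partial_deriv k u))"

definition harmonic_on :: "quat set \<Rightarrow> (quat \<Rightarrow> real) \<Rightarrow> bool" where
  "harmonic_on U u \<longleftrightarrow> open U \<and> C2_on U u \<and>
     (\<forall>x\<in>U. (\<Sum>k\<in>UNIV. partial_deriv k (partial_deriv k u) x) = 0)"

end

theory Submission
  imports Defs "HOL-Complex_Analysis.Conformal_Mappings"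
begin

text \<open>
  Write \<open>U\<close> for the part of \<open>\<Omega>\<close> off the real axis and \<open>D = \<Sum>k. e\<^sub>k \<partial>\<^sub>k\<close> for the Fueter
  operator.  On \<open>U\<close> the bracket sum \<open>g\<close> of \<open>f\<close> is simply \<open>D f\<close>: multiplying the vector part of
  \<open>D\<close> by the direction \<open>J\<close> of the vector part of \<open>x\<close> splits it into the derivative along \<open>J\<close>,
  which cancels \<open>\<partial>\<^sub>0 f\<close> by slice regularity, and the tangential derivative, which is the bracket
  sum (\<open>fueter_slice_regular\<close>).  So \<open>f\<close> and \<open>\<T>[g]\<close> have the same image under \<open>D\<close>, their
  difference is annihilated by \<open>D\<close>, hence also by the Laplacian, which factors through \<open>D\<close>.

  Slice regularity assumes only that \<open>f\<close> is differentiable, so two analytic points need care.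
  First, \<open>f\<close> is continuously differentiable on \<open>U\<close> (\<open>slice_regular_C1\<close>): by the identity theorem
  on each slice, \<open>f\<close> is a combination of two functions holomorphic in one complex variable, with
  the direction of the vector part as coefficient (\<open>representation_formula\<close>).

  Second, the kernel of \<open>\<T>\<close> is too singular to differentiate \<open>\<T>[g]\<close> twice under the integral
  sign, so the difference is computed locally.  Near a point of \<open>U\<close> replace \<open>f\<close> by a compactly supported \<open>C\<^sup>1\<close> function \<open>F\<close>
  agreeing with \<open>f\<close> on a ball.  The Cauchy--Pompeiu formula \<open>F = \<T>[D F]\<close> (\<open>cauchy_pompeiu\<close>) gives
  \<open>f - \<T>[g] = \<T>[D F - g]\<close> on the ball, where the density \<open>D F - g\<close> is square integrable and
  vanishes.  Differentiation under the integral sign is then harmless, and the potential inherits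
  harmonicity from the components of the kernel (\<open>kernel_potential_harmonic\<close>).

  The Cauchy--Pompeiu formula is obtained by truncating the kernel at radius \<open>\<epsilon>\<close> to
  \<open>qcnj z / max(\<epsilon>, |z|)\<^sup>4\<close>.  This is Lipschitz, and applying \<open>D\<close> to it gives the constant
  \<open>4/\<epsilon>\<^sup>4\<close> on the ball of radius \<open>\<epsilon>\<close> and zero outside, so that partial integration turns
  \<open>\<T>[D F]\<close> into mean values of \<open>F\<close> over shrinking balls; the volume \<open>\<pi>\<^sup>2/2\<close> of the unit ball
  accounts for the factor \<open>1/(2\<pi>\<^sup>2)\<close> in the kernel.
\<close>

section \<open>First-order calculus and quaternion algebra\<close>

lemma sum_UNIV_quat: "(\<Sum>k\<in>UNIV. a k) = a 0 + a 1 + a 2 + a (3::4)"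
  for a :: "4 \<Rightarrow> 'a::comm_monoid_add"
proof -
  have "(4::4) = 0" by simp
  then show ?thesis using sum_4[of a] by (simp only: add.assoc add.commute add.left_commute)
qed

lemma all_quat_index: "(\<forall>k::4. P k) \<longleftrightarrow> P 0 \<and> P 1 \<and> P 2 \<and> P 3"
proof -
  have "(4::4) = 0" by simp
  then show ?thesis using forall_4[of P] by metis
qed

lemma quat_expand: "v = (\<Sum>k\<in>UNIV. (v $ k) *\<^sub>R qe k)" for v :: quat
  by (simp add: sum_UNIV_quat quat_eq_iff qe_nth)

lemma norm_quat_squared: "(norm x)\<^sup>2 = (x$0)\<^sup>2 + (x$1)\<^sup>2 + (x$2)\<^sup>2 + (x$3)\<^sup>2" for x :: quat
  by (simp only: power2_norm_eq_inner inner_vec_def sum_UNIV_quat) (simp add: power2_eq_square)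

lemma norm_qe [simp]: "norm (qe k) = 1"
  by (simp add: qe_def norm_axis_1)

lemma partial_deriv_eq:
  assumes "(u has_derivative u') (at x)"
  shows "partial_deriv k u x = u' (qe k)"
proof -
  have "((\<lambda>t. u (x + t *\<^sub>R qe k)) has_derivative (\<lambda>t. u' (t *\<^sub>R qe k))) (at 0)"
  proof (rule has_derivative_compose[where g=u])
    show "((\<lambda>t. x + t *\<^sub>R qe k) has_derivative (\<lambda>t. t *\<^sub>R qe k)) (at 0)"
      using has_derivative_add[OF has_derivative_const[of x]
          has_derivative_scaleR_left[OF has_derivative_ident, of "qe k"]] by simp
    show "(u has_derivative u') (at (x + 0 *\<^sub>R qe k))" using assms by simp
  qed
  moreover have "(\<lambda>t. u' (t *\<^sub>R qe k)) = (*) (u' (qe k))"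
    using has_derivative_linear[OF assms] by (auto simp: linear_scale)
  ultimately have "((\<lambda>t. u (x + t *\<^sub>R qe k)) has_field_derivative u' (qe k)) (at 0)"
    by (simp add: has_field_derivative_def)
  then show ?thesis unfolding partial_deriv_def by (rule DERIV_imp_deriv)
qed

lemma has_derivative_eq_sum_partials:
  assumes "(u has_derivative u') (at x)"
  shows "u' v = (\<Sum>k\<in>UNIV. partial_deriv k u x * v $ k)"
proof -
  have lin: "linear u'" using has_derivative_linear[OF assms] .
  have "u' v = u' (\<Sum>k\<in>UNIV. (v $ k) *\<^sub>R qe k)" by (subst quat_expand[of v]) simp
  also have "\<dots> = (\<Sum>k\<in>UNIV. v $ k * u' (qe k))"
    using lin by (simp add: linear_sum linear_scale)
  finally show ?thesis by (simp add: partial_deriv_eq[OF assms] mult.commute)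
qed

lemma differentiable_has_derivative_partials:
  assumes "u differentiable (at x)"
  shows "(u has_derivative (\<lambda>v. \<Sum>k\<in>UNIV. partial_deriv k u x * v $ k)) (at x)"
proof -
  obtain u' where u': "(u has_derivative u') (at x)" using assms unfolding differentiable_def by blast
  have "u' = (\<lambda>v. \<Sum>k\<in>UNIV. partial_deriv k u x * v $ k)"
    using has_derivative_eq_sum_partials[OF u'] by blast
  then show ?thesis using u' by simp
qed

lemma partial_deriv_cong_open:
  assumes "open U" "x \<in> U" "\<And>y. y \<in> U \<Longrightarrow> u y = w y"
  shows "partial_deriv k u x = partial_deriv k w x"
proof -
  have "((\<lambda>t. x + t *\<^sub>R qe k) \<longlongrightarrow> x + 0 *\<^sub>R qe k) (nhds 0)"
    by (intro tendsto_intros filterlim_ident)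
  then have "eventually (\<lambda>t. x + t *\<^sub>R qe k \<in> U) (nhds (0::real))"
    using assms(1,2) topological_tendstoD by fastforce
  then have "eventually (\<lambda>t. u (x + t *\<^sub>R qe k) = w (x + t *\<^sub>R qe k)) (nhds (0::real))"
    by eventually_elim (use assms(3) in auto)
  then show ?thesis unfolding partial_deriv_def by (intro deriv_cong_ev) auto
qed

lemma differentiable_cong_open:
  assumes "open U" "x \<in> U" "\<And>y. y \<in> U \<Longrightarrow> u y = w y" "w differentiable (at x)"
  shows "u differentiable (at x)"
proof -
  obtain w' where "(w has_derivative w') (at x)" using assms(4) unfolding differentiable_def by blast
  then have "(u has_derivative w') (at x)"
    by (rule has_derivative_transform_within_open[OF _ assms(1,2)]) (use assms(3) in auto)
  then show ?thesis by (auto simp: differentiable_def)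
qed

text \<open>
  Membership in \<open>C1_on\<close> is checked on Frechet derivatives, for which the usual rules are available;
  its partial derivatives are the values of the Frechet derivative at the basis vectors.
\<close>

lemma C1_onI:
  assumes "\<And>x. x \<in> U \<Longrightarrow> (u has_derivative (u' x)) (at x)"
    and "\<And>k. continuous_on U (\<lambda>x. u' x (qe k))"
  shows "C1_on U u"
  unfolding C1_on_def
proof (intro conjI ballI allI)
  fix x assume "x \<in> U" then show "u differentiable (at x)"
    using assms(1) by (auto simp: differentiable_def)
next
  fix k show "continuous_on U (partial_deriv k u)"
    using assms(2)[of k] by (rule continuous_on_eq) (simp add: partial_deriv_eq[OF assms(1)])
qed

lemma C1_on_has_derivative:
  assumes "C1_on U u" "x \<in> U"
  shows "(u has_derivative (\<lambda>v. \<Sum>k\<in>UNIV. partial_deriv k u x * v $ k)) (at x)"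
  using assms differentiable_has_derivative_partials by (auto simp: C1_on_def)

lemma C1_on_continuous: "C1_on U u \<Longrightarrow> continuous_on U u"
  by (auto simp: C1_on_def intro!: continuous_at_imp_continuous_on differentiable_imp_continuous_within)

lemma C1_on_subset: "C1_on U u \<Longrightarrow> V \<subseteq> U \<Longrightarrow> C1_on V u"
  by (auto simp: C1_on_def intro: continuous_on_subset)

lemma C1_on_cong_open:
  assumes "open U" "\<And>y. y \<in> U \<Longrightarrow> u y = w y" "C1_on U w"
  shows "C1_on U u"
  unfolding C1_on_def
proof (intro conjI ballI allI)
  fix x assume "x \<in> U" then show "u differentiable (at x)"
    using assms differentiable_cong_open[of U x u w] by (auto simp: C1_on_def)
next
  fix k
  have "continuous_on U (partial_deriv k w)" using assms(3) by (simp add: C1_on_def)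
  then show "continuous_on U (partial_deriv k u)"
    by (rule continuous_on_eq) (use partial_deriv_cong_open[OF assms(1) _ assms(2)] in auto)
qed

lemma C1_on_local:
  assumes "\<And>x. x \<in> U \<Longrightarrow> \<exists>V. open V \<and> x \<in> V \<and> C1_on V u"
  shows "C1_on U u"
  unfolding C1_on_def
proof (intro conjI ballI allI)
  fix x assume "x \<in> U" then show "u differentiable (at x)" using assms by (meson C1_on_def)
next
  fix k
  show "continuous_on U (partial_deriv k u)"
  proof (rule continuous_at_imp_continuous_on, rule ballI)
    fix x assume "x \<in> U"
    then obtain V where "open V" "x \<in> V" "C1_on V u" using assms by blast
    then show "isCont (partial_deriv k u) x"
      by (simp add: C1_on_def continuous_on_eq_continuous_at)
  qed
qed

lemma C1_on_const: "C1_on U (\<lambda>x. c)"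
  by (rule C1_onI[where u'="\<lambda>x v. 0"]) auto

lemma C1_on_coord: "C1_on U (\<lambda>x. x $ k)"
  by (rule C1_onI[where u'="\<lambda>x v. v $ k"])
     (auto intro: bounded_linear_imp_has_derivative bounded_linear_vec_nth)

lemma C1_on_add:
  assumes "C1_on U u" "C1_on U w"
  shows "C1_on U (\<lambda>x. u x + w x)"
  by (rule C1_onI, rule has_derivative_add[OF C1_on_has_derivative[OF assms(1)] C1_on_has_derivative[OF assms(2)]])
     (use assms in \<open>auto simp: C1_on_def qe_nth intro!: continuous_intros\<close>)

lemma C1_on_mult:
  assumes "C1_on U u" "C1_on U w"
  shows "C1_on U (\<lambda>x. u x * w x)"
  by (rule C1_onI, rule has_derivative_mult[OF C1_on_has_derivative[OF assms(1)] C1_on_has_derivative[OF assms(2)]])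
     (use assms in \<open>auto simp: C1_on_def qe_nth intro!: continuous_intros C1_on_continuous[OF assms(1)] C1_on_continuous[OF assms(2)]\<close>)

lemma C1_on_cmult: "C1_on U u \<Longrightarrow> C1_on U (\<lambda>x. c * u x)"
  by (rule C1_on_mult[OF C1_on_const])

lemma C1_on_minus: "C1_on U u \<Longrightarrow> C1_on U (\<lambda>x. - u x)"
  using C1_on_cmult[of U u "-1"] by simp

lemma C1_on_diff: "C1_on U u \<Longrightarrow> C1_on U w \<Longrightarrow> C1_on U (\<lambda>x. u x - w x)"
  using C1_on_add[OF _ C1_on_minus, of U u w] by simp

lemma C1_on_compose_real:
  assumes "C1_on U u" and "\<And>x. x \<in> U \<Longrightarrow> (h has_field_derivative h' (u x)) (at (u x))"
    and "continuous_on (u ` U) h'"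
  shows "C1_on U (\<lambda>x. h (u x))"
proof (rule C1_onI)
  fix x assume "x \<in> U"
  show "((\<lambda>x. h (u x)) has_derivative (\<lambda>v. h' (u x) * (\<Sum>k\<in>UNIV. partial_deriv k u x * v $ k))) (at x)"
    by (rule has_derivative_compose[OF C1_on_has_derivative[OF assms(1) \<open>x \<in> U\<close>], where g=h, unfolded o_def])
       (use assms(2)[OF \<open>x\<in>U\<close>] in \<open>simp add: has_field_derivative_def\<close>)
next
  fix k
  have "continuous_on U (\<lambda>x. h' (u x))"
    by (rule continuous_on_compose2[OF assms(3) C1_on_continuous[OF assms(1)]]) auto
  then show "continuous_on U (\<lambda>x. h' (u x) * (\<Sum>j\<in>UNIV. partial_deriv j u x * qe k $ j))"
    using assms(1) by (auto intro!: continuous_intros simp: C1_on_def)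
qed

lemma C1_on_qmult:
  assumes "\<And>k. C1_on U (\<lambda>x. P x $ k)" "\<And>k. C1_on U (\<lambda>x. Q x $ k)"
  shows "C1_on U (\<lambda>x. (P x \<otimes> Q x) $ k)"
proof -
  have "\<forall>k. C1_on U (\<lambda>x. (P x \<otimes> Q x) $ k)"
    unfolding all_quat_index qmult_nth
    by (intro conjI C1_on_add C1_on_diff C1_on_mult assms)
  then show ?thesis by blast
qed

lemma qvec_nth: "qvec x $ k = (if k = 0 then 0 else x $ k)"
  by (simp add: qvec_def qe_nth)

lemma qmult_scaleR: "(c *\<^sub>R p) \<otimes> q = c *\<^sub>R (p \<otimes> q)" "p \<otimes> (c *\<^sub>R q) = c *\<^sub>R (p \<otimes> q)"
  by (simp_all add: quat_eq_iff qmult_nth algebra_simps)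

lemma qmult_add: "(p + p') \<otimes> q = p \<otimes> q + p' \<otimes> q" "p \<otimes> (q + q') = p \<otimes> q + p \<otimes> q'"
  by (simp_all add: quat_eq_iff qmult_nth algebra_simps)

lemma qmult_diff: "(p - p') \<otimes> q = p \<otimes> q - p' \<otimes> q" "p \<otimes> (q - q') = p \<otimes> q - p \<otimes> q'"
  by (simp_all add: quat_eq_iff qmult_nth algebra_simps)

lemma qmult_minus: "(- p) \<otimes> q = - (p \<otimes> q)" "p \<otimes> (- q) = - (p \<otimes> q)"
  by (simp_all add: quat_eq_iff qmult_nth algebra_simps)

lemma qmult_zero [simp]: "0 \<otimes> q = 0" "p \<otimes> 0 = 0"
  by (simp_all add: quat_eq_iff qmult_nth)

lemma imag_sphere_square:
  assumes "J \<in> imag_sphere"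
  shows "J \<otimes> J = - qe 0"
proof -
  have "(J$0)=0" "(J$0)\<^sup>2 + (J$1)\<^sup>2 + (J$2)\<^sup>2 + (J$3)\<^sup>2 = 1"
    using assms norm_quat_squared[of J] by (auto simp: imag_sphere_def)
  then show ?thesis by (simp add: quat_eq_iff qmult_nth qe_nth power2_eq_square)
qed

text \<open>
  Left multiplication by an imaginary unit is a complex structure on the quaternions; slice
  regularity is the Cauchy--Riemann equation for it.
\<close>

lemma imag_sphere_cancel:
  assumes "J \<in> imag_sphere"
  shows "J \<otimes> (J \<otimes> q) = - q"
  by (simp add: imag_sphere_square[OF assms] qmult_minus qmult_one flip: qmult_assoc)

lemma bounded_bilinear_qmult: "bounded_bilinear (\<otimes>)"
proof -
  have "bilinear (\<otimes>)" unfolding bilinear_def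
    by (intro conjI allI linearI) (simp_all add: qmult_add qmult_scaleR)
  then show ?thesis by (simp add: bilinear_conv_bounded_bilinear)
qed

definition fueter :: "(quat \<Rightarrow> quat) \<Rightarrow> quat \<Rightarrow> quat" where
  "fueter F x = (\<Sum>k\<in>UNIV. qe k \<otimes> (\<chi> j. partial_deriv k (\<lambda>y. F y $ j) x))"

lemma partial_deriv_component:
  assumes "(F has_derivative F') (at x)"
  shows "partial_deriv k (\<lambda>y. F y $ j) x = F' (qe k) $ j"
proof (rule partial_deriv_eq)
  show "((\<lambda>y. F y $ j) has_derivative (\<lambda>v. F' v $ j)) (at x)"
    by (rule bounded_linear.has_derivative[OF bounded_linear_vec_nth assms])
qed

lemma fueter_eq:
  assumes "(F has_derivative F') (at x)"
  shows "fueter F x = (\<Sum>k\<in>UNIV. qe k \<otimes> F' (qe k))"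
  unfolding fueter_def partial_deriv_component[OF assms] by simp

section \<open>The Fueter operator on slice regular functions\<close>

lemma slice_vector_derivatives:
  assumes "(f has_derivative f') (at (slice_point i x y))"
  shows "vector_derivative (\<lambda>t. f (slice_point i t y)) (at x) = f' (qe 0)"
    and "vector_derivative (\<lambda>t. f (slice_point i x t)) (at y) = f' i"
proof -
  have lin: "linear f'" using has_derivative_linear[OF assms] .
  have 1: "((\<lambda>t. slice_point i t y) has_derivative (\<lambda>t. t *\<^sub>R qe 0)) (at x)"
    unfolding slice_point_def
    using has_derivative_add[OF has_derivative_scaleR_left[OF has_derivative_ident, of "qe 0"]
          has_derivative_const[of "y *\<^sub>R i"]] by simp
  have 2: "((\<lambda>t. slice_point i x t) has_derivative (\<lambda>t. t *\<^sub>R i)) (at y)"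
    unfolding slice_point_def
    using has_derivative_add[OF has_derivative_const[of "x *\<^sub>R qe 0"] has_derivative_scaleR_left[OF has_derivative_ident, of i]]
    by simp
  show "vector_derivative (\<lambda>t. f (slice_point i t y)) (at x) = f' (qe 0)"
    using has_derivative_compose[OF 1 assms] linear_scale[OF lin]
    by (intro vector_derivative_at) (simp add: has_vector_derivative_def)
  show "vector_derivative (\<lambda>t. f (slice_point i x t)) (at y) = f' i"
    using has_derivative_compose[OF 2 assms] linear_scale[OF lin]
    by (intro vector_derivative_at) (simp add: has_vector_derivative_def)
qed

lemma slice_regular_cauchy_riemann:
  assumes "slice_regular \<Omega> f" "i \<in> imag_sphere" "slice_point i x y \<in> \<Omega>"
    and "(f has_derivative f') (at (slice_point i x y))"
  shows "f' (qe 0) + i \<otimes> f' i = 0"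
  using assms slice_vector_derivatives[OF assms(4)] unfolding slice_regular_def by force

lemma vec_part_eq_norm_direction:
  assumes "qvec x \<noteq> 0"
  defines "r \<equiv> norm (qvec x)"
  defines "J \<equiv> (1 / r) *\<^sub>R qvec x"
  shows "J \<in> imag_sphere" "x = slice_point J (x $ 0) r" "qvec x = r *\<^sub>R J" "r > 0"
proof -
  show r: "r > 0" using assms by simp
  then show q: "qvec x = r *\<^sub>R J" by (simp add: J_def)
  show "J \<in> imag_sphere" using r by (simp add: imag_sphere_def J_def qvec_nth r_def)
  have "x = (x $ 0) *\<^sub>R qe 0 + qvec x" by (simp add: qvec_def)
  then show "x = slice_point J (x $ 0) r" by (simp add: slice_point_def q)
qed

lemma imaginary_linear_expansion:
  assumes "linear f'" "J $ 0 = 0"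
  shows "f' J = (J$1) *\<^sub>R f' (qe 1) + (J$2) *\<^sub>R f' (qe 2) + (J$3) *\<^sub>R f' (qe 3)"
proof -
  have "f' J = f' (\<Sum>k\<in>UNIV. (J $ k) *\<^sub>R qe k)" by (subst quat_expand[of J]) simp
  then show ?thesis using assms by (simp add: sum_UNIV_quat linear_add linear_scale)
qed

text \<open>
  Since \<open>J e\<^sub>m = - J\<^sub>m + J \<times> e\<^sub>m\<close>, multiplying \<open>\<Sum>m. e\<^sub>m d\<^sub>m\<close> by \<open>J\<close> separates the radial derivative
  \<open>\<Sum>m. J\<^sub>m d\<^sub>m\<close> from the rotational one, which is a cross product with the gradient of every
  component.
\<close>

lemma direction_times_imaginary_gradient:
  fixes d :: "4 \<Rightarrow> quat"
  assumes J: "J $ 0 = 0"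
  defines "G \<equiv> \<lambda>k. \<Sum>m\<in>{1,2,3}. (d m $ k) *\<^sub>R qe m"
  shows "J \<otimes> (qe 1 \<otimes> d 1 + qe 2 \<otimes> d 2 + qe 3 \<otimes> d 3) =
    - ((J$1) *\<^sub>R d 1 + (J$2) *\<^sub>R d 2 + (J$3) *\<^sub>R d 3) - (\<Sum>k\<in>UNIV. qbracket (G k) J \<otimes> qe k)"
  unfolding quat_eq_iff
  by (simp add: G_def J sum_UNIV_quat qbracket_def qmult_nth qe_nth algebra_simps)

text \<open>
  Multiply the vector part \<open>S\<close> of the Fueter operator by the unit direction \<open>J\<close>, use the identity
  above, and multiply by \<open>J\<close> once more to return to \<open>S\<close>.  The radial term becomes \<open>J (\<partial>\<^sub>J f)\<close>,
  which slice regularity identifies with \<open>- \<partial>\<^sub>0 f\<close>.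
\<close>

lemma fueter_slice_regular:
  assumes "slice_regular \<Omega> f" "x \<in> \<Omega>" "qvec x \<noteq> 0"
  shows "fueter f x = bracket_sum f x"
proof -
  define r where "r = norm (qvec x)"
  define J where "J = (1 / r) *\<^sub>R qvec x"
  note J = vec_part_eq_norm_direction[OF assms(3), folded r_def, folded J_def]
  have J0: "J $ 0 = 0" using J(1) by (simp add: imag_sphere_def)
  obtain f' where f': "(f has_derivative f') (at x)"
    using assms(1,2) unfolding slice_regular_def differentiable_def by blast
  have lin: "linear f'" using has_derivative_linear[OF f'] .
  define d where "d k = f' (qe k)" for k
  define S where "S = qe 1 \<otimes> d 1 + qe 2 \<otimes> d 2 + qe 3 \<otimes> d 3"
  have cr: "d 0 = - (J \<otimes> f' J)"
    using slice_regular_cauchy_riemann[OF assms(1) J(1), of "x$0" r f', folded J(2)] assms(2) f'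
    by (simp add: d_def eq_neg_iff_add_eq_0)
  define B where "B = (\<Sum>k\<in>UNIV. qbracket (\<Sum>m\<in>{1,2,3}. (d m $ k) *\<^sub>R qe m) J \<otimes> qe k)"
  have "J \<otimes> S = - f' J - B"
    using direction_times_imaginary_gradient[OF J0, of d] unfolding S_def B_def imaginary_linear_expansion[OF lin J0] d_def .
  then have "- S = J \<otimes> (- f' J - B)"
    using imag_sphere_cancel[OF J(1), of S] by simp
  then have "- S = - (J \<otimes> f' J + J \<otimes> B)" by (simp add: qmult_diff qmult_minus)
  then have S: "S = J \<otimes> f' J + J \<otimes> B" by (simp only: neg_equal_iff_equal)
  have "fueter f x = d 0 + S"
    unfolding fueter_eq[OF f'] S_def by (simp add: d_def sum_UNIV_quat qmult_one add.assoc)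
  then have 1: "fueter f x = J \<otimes> B" using cr S by simp
  have "Grad (\<lambda>y. f y $ k) x = (\<Sum>m\<in>{1,2,3}. (d m $ k) *\<^sub>R qe m)" for k
    unfolding Grad_def partial_deriv_component[OF f'] d_def ..
  moreover have "qbracket a (r *\<^sub>R J) = r *\<^sub>R qbracket a J" for a
    by (simp add: qbracket_def qmult_scaleR algebra_simps)
  ultimately have "bracket_sum f x = ((1 / r\<^sup>2) *\<^sub>R (r *\<^sub>R J)) \<otimes> (\<Sum>k\<in>UNIV. r *\<^sub>R (qbracket (\<Sum>m\<in>{1,2,3}. (d m $ k) *\<^sub>R qe m) J \<otimes> qe k))"
    using J(3) unfolding bracket_sum_def r_def[symmetric] by (simp add: qmult_scaleR)
  also have "\<dots> = J \<otimes> B"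
    using J(4) unfolding B_def scaleR_sum_right[symmetric] by (simp add: qmult_scaleR power2_eq_square)
  finally show ?thesis using 1 by simp
qed

lemma C1_on_Re_holomorphic:
  assumes "L holomorphic_on D" "open D" "C1_on U a" "C1_on U b"
    and D: "\<And>x. x \<in> U \<Longrightarrow> Complex (a x) (b x) \<in> D"
  shows "C1_on U (\<lambda>x. Re (L (Complex (a x) (b x))))"
proof (rule C1_onI)
  fix x assume x: "x \<in> U"
  define a' where "a' = (\<lambda>v. \<Sum>k\<in>UNIV. partial_deriv k a x * v $ k)"
  define b' where "b' = (\<lambda>v. \<Sum>k\<in>UNIV. partial_deriv k b x * v $ k)"
  have "((\<lambda>x. complex_of_real (a x) + \<i> * complex_of_real (b x)) has_derivative
      (\<lambda>v. complex_of_real (a' v) + \<i> * complex_of_real (b' v))) (at x)"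
    using C1_on_has_derivative[OF assms(3) x, folded a'_def] C1_on_has_derivative[OF assms(4) x, folded b'_def]
    by (intro has_derivative_add has_derivative_mult_right has_derivative_of_real)
  then have 1: "((\<lambda>x. Complex (a x) (b x)) has_derivative (\<lambda>v. Complex (a' v) (b' v))) (at x)"
    by (simp add: Complex_eq)
  have "(L has_field_derivative deriv L (Complex (a x) (b x))) (at (Complex (a x) (b x)))"
    using assms(1,2) D[OF x] holomorphic_derivI by blast
  then have "((\<lambda>x. L (Complex (a x) (b x))) has_derivative (\<lambda>v. deriv L (Complex (a x) (b x)) * Complex (a' v) (b' v))) (at x)"
    using has_derivative_compose[OF 1] by (simp add: has_field_derivative_def)
  from bounded_linear.has_derivative[OF bounded_linear_Re this]
  show "((\<lambda>x. Re (L (Complex (a x) (b x)))) has_derivative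
     (\<lambda>v. Re (deriv L (Complex (a x) (b x)) * Complex (\<Sum>k\<in>UNIV. partial_deriv k a x * v $ k) (\<Sum>k\<in>UNIV. partial_deriv k b x * v $ k)))) (at x)"
    by (simp add: a'_def b'_def)
next
  fix k
  have ab: "continuous_on U a" "continuous_on U b" using assms(3,4) by (auto intro: C1_on_continuous)
  have c: "continuous_on U (\<lambda>x. Complex (a x) (b x))"
    unfolding Complex_eq by (intro continuous_intros ab)
  have "continuous_on D (deriv L)"
    using assms(1,2) holomorphic_deriv holomorphic_on_imp_continuous_on by blast
  then have "continuous_on U (\<lambda>x. deriv L (Complex (a x) (b x)))"
    by (rule continuous_on_compose2[OF _ c]) (use D in auto)
  then show "continuous_on U (\<lambda>x. Re (deriv L (Complex (a x) (b x)) * Complex (\<Sum>j\<in>UNIV. partial_deriv j a x * qe k $ j) (\<Sum>j\<in>UNIV. partial_deriv j b x * qe k $ j)))"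
    using assms(3,4) unfolding Complex_eq C1_on_def by (intro continuous_intros) auto
qed

text \<open>
  The map \<open>q \<mapsto> q\<^sub>k - \<i> (J q)\<^sub>k\<close> is complex linear when \<open>J\<close> acts on quaternions as \<open>\<i>\<close>.  Composing a
  solution of the \<open>J\<close>-Cauchy--Riemann equation with it gives a holomorphic function whose real part
  is the \<open>k\<close>-th component, so no basis of the two-dimensional complex space has to be chosen.
\<close>

lemma slice_component_holomorphic:
  assumes J: "J \<in> imag_sphere" and "open D"
    and A: "\<And>z. z \<in> D \<Longrightarrow> (A has_derivative A' z) (at z)"
    and cr: "\<And>z. z \<in> D \<Longrightarrow> A' z 1 + J \<otimes> A' z \<i> = 0"
  shows "(\<lambda>z. Complex (A z $ k) (- (J \<otimes> A z) $ k)) holomorphic_on D"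
proof -
  have "((\<lambda>z. Complex (A z $ k) (- (J \<otimes> A z) $ k)) has_field_derivative
     Complex (A' z 1 $ k) (- (J \<otimes> A' z 1) $ k)) (at z)" if z: "z \<in> D" for z
  proof -
    have lin: "linear (A' z)" using has_derivative_linear[OF A[OF z]] .
    have Ai: "A' z \<i> = J \<otimes> A' z 1"
    proof -
      have "A' z 1 = - (J \<otimes> A' z \<i>)" using cr[OF z] by (simp add: eq_neg_iff_add_eq_0)
      then show ?thesis by (simp add: qmult_minus imag_sphere_cancel[OF J])
    qed
    have Ah: "A' z h = Re h *\<^sub>R A' z 1 + Im h *\<^sub>R (J \<otimes> A' z 1)" for h
    proof -
      have "h = Re h *\<^sub>R 1 + Im h *\<^sub>R \<i>" by (simp add: complex_eq_iff)
      then have "A' z h = A' z (Re h *\<^sub>R 1 + Im h *\<^sub>R \<i>)" by (rule arg_cong)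
      also have "\<dots> = Re h *\<^sub>R A' z 1 + Im h *\<^sub>R (J \<otimes> A' z 1)"
        by (simp only: linear_add[OF lin] linear_scale[OF lin] Ai)
      finally show ?thesis .
    qed
    have d1: "((\<lambda>z. A z $ k) has_derivative (\<lambda>h. A' z h $ k)) (at z)"
      by (rule bounded_linear.has_derivative[OF bounded_linear_vec_nth A[OF z]])
    have d2: "((\<lambda>z. (J \<otimes> A z) $ k) has_derivative (\<lambda>h. (J \<otimes> A' z h) $ k)) (at z)"
      by (intro bounded_linear.has_derivative[OF bounded_linear_vec_nth]
          bounded_linear.has_derivative[OF bounded_bilinear.bounded_linear_right[OF bounded_bilinear_qmult]] A[OF z])
    have "((\<lambda>z. complex_of_real (A z $ k) + \<i> * complex_of_real (- (J \<otimes> A z) $ k)) has_derivative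
       (\<lambda>h. complex_of_real (A' z h $ k) + \<i> * complex_of_real (- (J \<otimes> A' z h) $ k))) (at z)"
      using d1 d2 unfolding vector_uminus_component
      by (intro has_derivative_add has_derivative_mult_right has_derivative_of_real has_derivative_minus)
    then have "((\<lambda>z. Complex (A z $ k) (- (J \<otimes> A z) $ k)) has_derivative
        (\<lambda>h. Complex (A' z h $ k) (- (J \<otimes> A' z h) $ k))) (at z)"
      by (simp add: Complex_eq)
    moreover have "(\<lambda>h. Complex (A' z h $ k) (- (J \<otimes> A' z h) $ k)) = (*) (Complex (A' z 1 $ k) (- (J \<otimes> A' z 1) $ k))"
    proof
      fix h
      show "Complex (A' z h $ k) (- (J \<otimes> A' z h) $ k) = Complex (A' z 1 $ k) (- (J \<otimes> A' z 1) $ k) * h"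
        by (simp add: Ah[of h] complex_eq_iff qmult_add qmult_scaleR imag_sphere_cancel[OF J])
    qed
    ultimately show ?thesis by (simp add: has_field_derivative_def)
  qed
  then show ?thesis using \<open>open D\<close> holomorphic_on_open by blast
qed

section \<open>The representation formula and continuous differentiability\<close>

lemma qe1_imag_sphere: "qe 1 \<in> imag_sphere"
  by (simp add: imag_sphere_def qe_nth)

lemma axially_symmetric_swap:
  assumes "axially_symmetric \<Omega>" "i \<in> imag_sphere" "j \<in> imag_sphere" "slice_point i x y \<in> \<Omega>"
  shows "slice_point j x y \<in> \<Omega>"
  using assms unfolding axially_symmetric_def by blast

lemma slice_point_cnj:
  assumes "axially_symmetric \<Omega>" "i \<in> imag_sphere" "slice_point i x y \<in> \<Omega>"
  shows "slice_point i x (- y) \<in> \<Omega>"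
proof -
  have "- i \<in> imag_sphere" using assms(2) by (simp add: imag_sphere_def)
  then have "slice_point (- i) x y \<in> \<Omega>" using axially_symmetric_swap assms by blast
  then show ?thesis by (simp add: slice_point_def)
qed

text \<open>
  By axial symmetry all slices \<open>\<Omega> \<inter> \<complex>(\<i>)\<close> are copies of one plane domain; the slice of \<open>e\<^sub>1\<close> serves
  as model.
\<close>

definition slice_shadow :: "quat set \<Rightarrow> complex set" where
  "slice_shadow \<Omega> = {z. slice_point (qe 1) (Re z) (Im z) \<in> \<Omega>}"

lemma slice_shadow_point:
  assumes "axially_symmetric \<Omega>" "J \<in> imag_sphere"
  shows "slice_point J (Re z) (Im z) \<in> \<Omega> \<longleftrightarrow> z \<in> slice_shadow \<Omega>"
  using axially_symmetric_swap[OF assms(1)] assms(2) qe1_imag_sphere unfolding slice_shadow_def by blast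

lemma cnj_slice_shadow:
  assumes "axially_symmetric \<Omega>" "z \<in> slice_shadow \<Omega>"
  shows "cnj z \<in> slice_shadow \<Omega>"
  using slice_point_cnj[OF assms(1) qe1_imag_sphere] assms(2) by (simp add: slice_shadow_def)

lemma open_slice_shadow:
  assumes "open \<Omega>"
  shows "open (slice_shadow \<Omega>)"
proof -
  have "continuous_on UNIV (\<lambda>z. slice_point (qe 1) (Re z) (Im z))"
    unfolding slice_point_def by (intro continuous_intros)
  then have "open ((\<lambda>z. slice_point (qe 1) (Re z) (Im z)) -` \<Omega>)"
    using assms open_vimage by blast
  then show ?thesis by (simp add: slice_shadow_def vimage_def)
qed

lemma connected_slice_shadow:
  assumes "s_domain \<Omega>"
  shows "connected (slice_shadow \<Omega>)"
proof -
  have "connected (\<Omega> \<inter> slice_plane (qe 1))"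
    using assms qe1_imag_sphere unfolding s_domain_def domain_in_def by blast
  moreover have "continuous_on (\<Omega> \<inter> slice_plane (qe 1)) (\<lambda>q. complex_of_real (q $ 0) + \<i> * complex_of_real (q $ 1))"
    by (intro continuous_intros)
  ultimately have "connected ((\<lambda>q. complex_of_real (q $ 0) + \<i> * complex_of_real (q $ 1)) ` (\<Omega> \<inter> slice_plane (qe 1)))"
    by (rule connected_continuous_image[rotated])
  moreover have "(\<lambda>q. complex_of_real (q $ 0) + \<i> * complex_of_real (q $ 1)) ` (\<Omega> \<inter> slice_plane (qe 1)) = slice_shadow \<Omega>"
  proof (intro equalityI subsetI)
    fix z assume "z \<in> (\<lambda>q. complex_of_real (q $ 0) + \<i> * complex_of_real (q $ 1)) ` (\<Omega> \<inter> slice_plane (qe 1))"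
    then obtain x y where "slice_point (qe 1) x y \<in> \<Omega>"
      "z = complex_of_real (slice_point (qe 1) x y $ 0) + \<i> * complex_of_real (slice_point (qe 1) x y $ 1)"
      unfolding slice_plane_def by blast
    then show "z \<in> slice_shadow \<Omega>" by (simp add: slice_shadow_def slice_point_def qe_nth)
  next
    fix z assume z: "z \<in> slice_shadow \<Omega>"
    show "z \<in> (\<lambda>q. complex_of_real (q $ 0) + \<i> * complex_of_real (q $ 1)) ` (\<Omega> \<inter> slice_plane (qe 1))"
    proof (rule image_eqI)
      show "slice_point (qe 1) (Re z) (Im z) \<in> \<Omega> \<inter> slice_plane (qe 1)"
        using z unfolding slice_shadow_def slice_plane_def by blast
      show "z = complex_of_real (slice_point (qe 1) (Re z) (Im z) $ 0) + \<i> * complex_of_real (slice_point (qe 1) (Re z) (Im z) $ 1)"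
        by (simp add: slice_point_def qe_nth complex_eq_iff)
    qed
  qed
  ultimately show ?thesis by simp
qed

lemma slice_restriction_has_derivative:
  assumes "slice_regular \<Omega> f" "J \<in> imag_sphere" "slice_point J (Re z) (Im z) \<in> \<Omega>"
  obtains \<Phi>' where "((\<lambda>z. f (slice_point J (Re z) (Im z))) has_derivative \<Phi>') (at z)"
    and "\<Phi>' 1 + J \<otimes> \<Phi>' \<i> = 0"
proof -
  obtain f' where f': "(f has_derivative f') (at (slice_point J (Re z) (Im z)))"
    using assms(1,3) unfolding slice_regular_def differentiable_def by blast
  have "((\<lambda>z. slice_point J (Re z) (Im z)) has_derivative (\<lambda>h. slice_point J (Re h) (Im h))) (at z)"
    unfolding slice_point_def
    by (intro bounded_linear_imp_has_derivative bounded_linear_add bounded_linear_scaleR_const bounded_linear_Re bounded_linear_Im)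
  from has_derivative_compose[OF this f']
  have "((\<lambda>z. f (slice_point J (Re z) (Im z))) has_derivative (\<lambda>h. f' (slice_point J (Re h) (Im h)))) (at z)" .
  moreover have "f' (slice_point J (Re 1) (Im 1)) + J \<otimes> f' (slice_point J (Re \<i>) (Im \<i>)) = 0"
    using slice_regular_cauchy_riemann[OF assms f'] by (simp add: slice_point_def)
  ultimately show ?thesis using that by blast
qed

text \<open>
  Both sides, as functions of \<open>z\<close>, solve the \<open>J\<close>-Cauchy--Riemann equation, and they agree on the
  real axis, where \<open>z\<close> and its conjugate coincide.  The domain meets the real axis in an interval, so
  the identity theorem makes them equal everywhere.
\<close>

lemma representation_formula:
  assumes s: "s_domain \<Omega>" and ax: "axially_symmetric \<Omega>" and f: "slice_regular \<Omega> f"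
    and J: "J \<in> imag_sphere" and z0: "z0 \<in> slice_shadow \<Omega>"
  defines "\<Phi> \<equiv> \<lambda>z. f (slice_point (qe 1) (Re z) (Im z))"
  shows "f (slice_point J (Re z0) (Im z0)) =
    (1/2) *\<^sub>R (\<Phi> z0 + \<Phi> (cnj z0)) + (1/2) *\<^sub>R (J \<otimes> (qe 1 \<otimes> (\<Phi> (cnj z0) - \<Phi> z0)))"
proof -
  define D where "D = slice_shadow \<Omega>"
  have "open \<Omega>" using s by (simp add: s_domain_def domain_in_def)
  have "open D" and "connected D" using open_slice_shadow[OF \<open>open \<Omega>\<close>] connected_slice_shadow[OF s] by (simp_all add: D_def)
  have inD: "slice_point K (Re z) (Im z) \<in> \<Omega>" if "z \<in> D" "K \<in> imag_sphere" for z K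
    using slice_shadow_point[OF ax that(2)] that(1) by (simp add: D_def)
  define i :: quat where "i = qe 1"
  have i: "i \<in> imag_sphere" using qe1_imag_sphere by (simp add: i_def)
  define A where "A z = f (slice_point J (Re z) (Im z)) - ((1/2) *\<^sub>R (\<Phi> z + \<Phi> (cnj z)) + (1/2) *\<^sub>R (J \<otimes> (i \<otimes> (\<Phi> (cnj z) - \<Phi> z))))" for z
  have "\<exists>A'. (A has_derivative A') (at z) \<and> A' 1 + J \<otimes> A' \<i> = 0" if z: "z \<in> D" for z
  proof -
    obtain \<Psi> where \<Psi>: "((\<lambda>z. f (slice_point J (Re z) (Im z))) has_derivative \<Psi>) (at z)" "\<Psi> 1 + J \<otimes> \<Psi> \<i> = 0"
      using slice_restriction_has_derivative[OF f J inD[OF z J]] by blast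
    obtain P where P: "(\<Phi> has_derivative P) (at z)" "P 1 + i \<otimes> P \<i> = 0"
      using slice_restriction_has_derivative[OF f i inD[OF z i]] unfolding \<Phi>_def i_def by blast
    have cz: "cnj z \<in> D" using cnj_slice_shadow[OF ax] z by (simp add: D_def)
    obtain Q where Q: "(\<Phi> has_derivative Q) (at (cnj z))" "Q 1 + i \<otimes> Q \<i> = 0"
      using slice_restriction_has_derivative[OF f i inD[OF cz i]] unfolding \<Phi>_def i_def by blast
    have "linear Q" using has_derivative_linear[OF Q(1)] .
    have Qc: "((\<lambda>z. \<Phi> (cnj z)) has_derivative (\<lambda>h. Q (cnj h))) (at z)"
      by (rule has_derivative_compose[OF bounded_linear_imp_has_derivative[OF bounded_linear_cnj] Q(1)])
    define A' where "A' h = \<Psi> h - ((1/2) *\<^sub>R (P h + Q (cnj h)) + (1/2) *\<^sub>R (J \<otimes> (i \<otimes> (Q (cnj h) - P h))))" for h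
    have "(A has_derivative A') (at z)"
      unfolding A_def A'_def
      by (intro has_derivative_diff has_derivative_add has_derivative_scaleR_right \<Psi>(1) P(1) Qc
          bounded_linear.has_derivative[OF bounded_bilinear.bounded_linear_right[OF bounded_bilinear_qmult]])
    moreover have "A' 1 + J \<otimes> A' \<i> = 0"
    proof -
      have "P 1 = - (i \<otimes> P \<i>)" "Q 1 = - (i \<otimes> Q \<i>)" "\<Psi> 1 = - (J \<otimes> \<Psi> \<i>)"
        using P(2) Q(2) \<Psi>(2) by (simp_all add: eq_neg_iff_add_eq_0)
      moreover have "Q (cnj \<i>) = - Q \<i>" using linear_neg[OF \<open>linear Q\<close>] by simp
      ultimately show ?thesis unfolding A'_def
        by (simp add: qmult_add qmult_diff qmult_minus qmult_scaleR imag_sphere_cancel[OF i] imag_sphere_cancel[OF J] algebra_simps)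
    qed
    ultimately show ?thesis by blast
  qed
  then obtain A' where A': "\<And>z. z \<in> D \<Longrightarrow> (A has_derivative A' z) (at z)" "\<And>z. z \<in> D \<Longrightarrow> A' z 1 + J \<otimes> A' z \<i> = 0"
    by metis
  obtain x0 where x0: "x0 *\<^sub>R qe 0 \<in> \<Omega>" using ax unfolding axially_symmetric_def real_axis_def by blast
  have "of_real x0 \<in> D" using x0 by (simp add: D_def slice_shadow_def slice_point_def)
  then obtain e where e: "e > 0" "ball (of_real x0) e \<subseteq> D" using \<open>open D\<close> open_contains_ball by blast
  define R where "R = complex_of_real ` {x0<..<x0 + e}"
  have "R \<subseteq> D" using e(2) by (auto simp: R_def dist_of_real dist_real_def subset_iff)
  \<comment> \<open>Points slightly to the right of x0 suffice to make x0 a limit point of real zeros.\<close>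
  have lim: "of_real x0 islimpt R"
    unfolding islimpt_approachable
  proof (intro allI impI)
    fix d :: real assume "d > 0"
    define t where "t = x0 + min (d/2) (e/2)"
    have "x0 < t" "t < x0 + e" "\<bar>x0 - t\<bar> < d" using \<open>d > 0\<close> e(1) by (auto simp: t_def min_def)
    then show "\<exists>x'\<in>R. x' \<noteq> of_real x0 \<and> dist x' (of_real x0) < d"
      by (intro bexI[of _ "of_real t"]) (auto simp: R_def dist_of_real dist_real_def)
  qed
  have "A z0 $ k = 0" for k
  proof -
    define L where "L = (\<lambda>z. Complex (A z $ k) (- (J \<otimes> A z) $ k))"
    have "L holomorphic_on D" unfolding L_def
      by (rule slice_component_holomorphic[OF J \<open>open D\<close> A'])
    moreover have "L z = 0" if zR: "z \<in> R" for z
    proof -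
      have "A z = 0" using zR by (auto simp: A_def \<Phi>_def R_def slice_point_def simp flip: scaleR_2)
      then show ?thesis by (simp add: L_def zero_complex.code)
    qed
    ultimately have "L z0 = 0"
      using analytic_continuation[OF _ \<open>open D\<close> \<open>connected D\<close> \<open>R \<subseteq> D\<close> \<open>of_real x0 \<in> D\<close> lim, of L z0] z0
      by (simp add: D_def)
    then show ?thesis by (simp add: L_def complex_eq_iff)
  qed
  then have "A z0 = 0" by (simp add: vec_eq_iff)
  then show ?thesis by (simp add: A_def i_def)
qed

lemma C1_on_norm_qvec:
  assumes "\<And>x. x \<in> U \<Longrightarrow> qvec x \<noteq> 0"
  shows "C1_on U (\<lambda>x. norm (qvec x))"
proof -
  define s :: "quat \<Rightarrow> real" where "s = (\<lambda>x. x$1 * x$1 + x$2 * x$2 + x$3 * x$3)"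
  have s: "s x = (norm (qvec x))\<^sup>2" for x
    by (simp only: norm_quat_squared qvec_nth s_def) (simp add: power2_eq_square)
  have pos: "s x > 0" if "x \<in> U" for x using assms[OF that] by (simp add: s)
  have "C1_on U s" unfolding s_def by (intro C1_on_add C1_on_mult C1_on_coord)
  then have "C1_on U (\<lambda>x. sqrt (s x))"
  proof (rule C1_on_compose_real)
    show "(sqrt has_field_derivative inverse (sqrt (s x)) / 2) (at (s x))" if "x \<in> U" for x
      using DERIV_real_sqrt[OF pos[OF that]] .
    show "continuous_on (s ` U) (\<lambda>t. inverse (sqrt t) / 2)"
      by (intro continuous_intros) (auto dest: pos)
  qed
  then show ?thesis by (simp add: s)
qed

lemma open_off_real_axis:
  assumes "open \<Omega>"
  shows "open {x \<in> \<Omega>. qvec x \<noteq> 0}"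
proof -
  have "continuous_on \<Omega> qvec" unfolding qvec_def by (intro continuous_intros)
  then show ?thesis using assms continuous_open_preimage[of \<Omega> qvec "- {0}"]
    by (auto simp: vimage_def Int_def)
qed

text \<open>
  In the representation formula for the unit \<open>J\<close> pointing along the vector part of \<open>x\<close>, everything
  depends on \<open>x\<close> through holomorphic functions of \<open>x\<^sub>0 \<plusminus> \<i> r\<close> and through \<open>J\<close>, all of which are smooth
  where the distance \<open>r\<close> to the real axis is positive.
\<close>

lemma slice_regular_C1:
  assumes s: "s_domain \<Omega>" and ax: "axially_symmetric \<Omega>" and f: "slice_regular \<Omega> f"
  shows "C1_on {x \<in> \<Omega>. qvec x \<noteq> 0} (\<lambda>x. f x $ k)"
proof -
  define U where "U = {x \<in> \<Omega>. qvec x \<noteq> 0}"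
  define D where "D = slice_shadow \<Omega>"
  have "open \<Omega>" using s by (simp add: s_domain_def domain_in_def)
  then have "open D" using open_slice_shadow by (simp add: D_def)
  have "open U" unfolding U_def by (rule open_off_real_axis[OF \<open>open \<Omega>\<close>])
  define \<Phi> where "\<Phi> z = f (slice_point (qe 1) (Re z) (Im z))" for z
  define r where "r x = norm (qvec x)" for x
  have r: "C1_on U r" unfolding r_def by (rule C1_on_norm_qvec) (simp add: U_def)
  have mem: "Complex (x $ 0) (r x) \<in> D" if "x \<in> U" for x
  proof -
    from that have q: "qvec x \<noteq> 0" and "x \<in> \<Omega>" by (auto simp: U_def)
    then have "slice_point ((1 / r x) *\<^sub>R qvec x) (x $ 0) (r x) \<in> \<Omega>"
      using vec_part_eq_norm_direction(2)[OF q] by (simp add: r_def)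
    then show ?thesis unfolding D_def
      using slice_shadow_point[OF ax vec_part_eq_norm_direction(1)[OF q], of "Complex (x $ 0) (r x)"] by (simp add: r_def)
  qed
  then have mem': "Complex (x $ 0) (- r x) \<in> D" if "x \<in> U" for x
    using cnj_slice_shadow[OF ax] that by (simp add: D_def complex_cnj flip: complex_cnj)
  have hol: "(\<lambda>z. Complex (\<Phi> z $ k) (- (qe 1 \<otimes> \<Phi> z) $ k)) holomorphic_on D" for k
  proof -
    have "\<exists>\<Phi>'. (\<Phi> has_derivative \<Phi>') (at z) \<and> \<Phi>' 1 + qe 1 \<otimes> \<Phi>' \<i> = 0" if "z \<in> D" for z
      using slice_restriction_has_derivative[OF f qe1_imag_sphere, of z] that
      unfolding \<Phi>_def D_def slice_shadow_def by blast
    then obtain \<Phi>' where "\<And>z. z \<in> D \<Longrightarrow> (\<Phi> has_derivative \<Phi>' z) (at z)" "\<And>z. z \<in> D \<Longrightarrow> \<Phi>' z 1 + qe 1 \<otimes> \<Phi>' z \<i> = 0"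
      by metis
    then show ?thesis by (rule slice_component_holomorphic[OF qe1_imag_sphere \<open>open D\<close>])
  qed
  have P: "C1_on U (\<lambda>x. \<Phi> (Complex (x $ 0) (r x)) $ k)" for k
    using C1_on_Re_holomorphic[OF hol \<open>open D\<close> C1_on_coord r mem] by simp
  have Q: "C1_on U (\<lambda>x. \<Phi> (Complex (x $ 0) (- r x)) $ k)" for k
    using C1_on_Re_holomorphic[OF hol \<open>open D\<close> C1_on_coord C1_on_minus[OF r] mem'] by simp
  have I: "C1_on U (\<lambda>x. ((1 / r x) *\<^sub>R qvec x) $ k)" for k
  proof -
    have "C1_on U (\<lambda>x. inverse (r x))"
    proof (rule C1_on_compose_real[OF r])
      show "(inverse has_field_derivative - (inverse (r x) ^ Suc (Suc 0))) (at (r x))" if "x \<in> U" for x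
        using that by (intro DERIV_inverse) (simp add: U_def r_def)
      show "continuous_on (r ` U) (\<lambda>t. - (inverse t ^ Suc (Suc 0)))"
        by (intro continuous_intros) (auto simp: U_def r_def)
    qed
    from C1_on_mult[OF this, of "\<lambda>x. qvec x $ k"] show ?thesis
      by (cases "k = 0") (auto simp: qvec_nth divide_inverse C1_on_const C1_on_coord)
  qed
  have "C1_on U (\<lambda>x. ((1/2) *\<^sub>R (\<Phi> (Complex (x $ 0) (r x)) + \<Phi> (Complex (x $ 0) (- r x)))
     + (1/2) *\<^sub>R (((1 / r x) *\<^sub>R qvec x) \<otimes> (qe 1 \<otimes> (\<Phi> (Complex (x $ 0) (- r x)) - \<Phi> (Complex (x $ 0) (r x)))))) $ k)"
  proof -
    have "C1_on U (\<lambda>x. (\<Phi> (Complex (x $ 0) (- r x)) - \<Phi> (Complex (x $ 0) (r x))) $ k)" for k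
      unfolding vector_minus_component by (intro C1_on_diff P Q)
    then have "C1_on U (\<lambda>x. (((1 / r x) *\<^sub>R qvec x) \<otimes> (qe 1 \<otimes> (\<Phi> (Complex (x $ 0) (- r x)) - \<Phi> (Complex (x $ 0) (r x))))) $ k)" for k
      by (intro C1_on_qmult I C1_on_const)
    then show ?thesis
      unfolding vector_add_component vector_scaleR_component[of "1/2"]
      unfolding real_scaleR_def
      by (intro C1_on_add C1_on_cmult P Q)
  qed
  then have "C1_on U (\<lambda>x. f x $ k)"
  proof (rule C1_on_cong_open[OF \<open>open U\<close>, rotated])
    fix x assume x: "x \<in> U"
    then have q: "qvec x \<noteq> 0" by (auto simp: U_def)
    note J = vec_part_eq_norm_direction[OF q, folded r_def]
    have "f x = f (slice_point ((1 / r x) *\<^sub>R qvec x) (Re (Complex (x $ 0) (r x))) (Im (Complex (x $ 0) (r x))))"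
      using arg_cong[OF J(2), of f] by simp
    also have "\<dots> = (1/2) *\<^sub>R (\<Phi> (Complex (x $ 0) (r x)) + \<Phi> (Complex (x $ 0) (- r x)))
     + (1/2) *\<^sub>R (((1 / r x) *\<^sub>R qvec x) \<otimes> (qe 1 \<otimes> (\<Phi> (Complex (x $ 0) (- r x)) - \<Phi> (Complex (x $ 0) (r x)))))"
      using representation_formula[OF s ax f J(1), of "Complex (x $ 0) (r x)"] mem[OF x]
      unfolding \<Phi>_def D_def complex_cnj by blast
    finally show "f x $ k = \<dots> $ k" by (rule arg_cong)
  qed
  then show ?thesis by (simp add: U_def)
qed

section \<open>Homogeneous kernels and their Taylor estimate\<close>

text \<open>
  A class of kernels homogeneous of degree \<open>-d\<close> and smooth away from the origin, generated by
  \<open>1/|z|\<^sup>2\<close> and the coordinates.  Generating it inductively makes both facts needed for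
  differentiation under the integral sign a matter of structural induction: the bound \<open>C/|z|\<^sup>d\<close> and
  the closure under partial derivatives with \<open>d\<close> raised by one.
\<close>

inductive decay_kernel :: "nat \<Rightarrow> (quat \<Rightarrow> real) \<Rightarrow> bool" where
  inv: "decay_kernel 2 (\<lambda>z. 1 / (norm z)\<^sup>2)"
| coord: "decay_kernel (Suc d) k \<Longrightarrow> decay_kernel d (\<lambda>z. z $ j * k z)"
| mult: "decay_kernel d k \<Longrightarrow> decay_kernel e l \<Longrightarrow> decay_kernel (d + e) (\<lambda>z. k z * l z)"
| add: "decay_kernel d k \<Longrightarrow> decay_kernel d l \<Longrightarrow> decay_kernel d (\<lambda>z. k z + l z)"
| scale: "decay_kernel d k \<Longrightarrow> decay_kernel d (\<lambda>z. c * k z)"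

lemma decay_kernel_measurable: "decay_kernel d k \<Longrightarrow> k \<in> borel_measurable borel"
proof (induction rule: decay_kernel.induct)
  case (coord d k j)
  have "(\<lambda>z::quat. z $ j) \<in> borel_measurable borel"
    by (intro borel_measurable_continuous_onI continuous_intros)
  with coord show ?case by simp
qed auto

lemma decay_kernel_bound:
  assumes "decay_kernel d k"
  shows "\<exists>C\<ge>0. \<forall>z. z \<noteq> 0 \<longrightarrow> \<bar>k z\<bar> \<le> C / norm z ^ d"
  using assms
proof induction
  case inv
  then show ?case by (intro exI[of _ 1]) auto
next
  case (coord d k j)
  then obtain C where C: "C \<ge> 0" "\<forall>z. z \<noteq> 0 \<longrightarrow> \<bar>k z\<bar> \<le> C / norm z ^ Suc d" by blast
  show ?case
  proof (intro exI[of _ C] conjI allI impI C(1))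
    fix z :: quat assume z: "z \<noteq> 0"
    have "\<bar>z $ j * k z\<bar> \<le> norm z * (C / norm z ^ Suc d)"
      unfolding abs_mult using C z component_le_norm_cart[of z j] by (intro mult_mono) auto
    also have "\<dots> = C / norm z ^ d" using z by simp
    finally show "\<bar>z $ j * k z\<bar> \<le> C / norm z ^ d" .
  qed
next
  case (mult d k e l)
  then obtain C C' where C: "C \<ge> 0" "\<forall>z. z \<noteq> 0 \<longrightarrow> \<bar>k z\<bar> \<le> C / norm z ^ d"
    and C': "C' \<ge> 0" "\<forall>z. z \<noteq> 0 \<longrightarrow> \<bar>l z\<bar> \<le> C' / norm z ^ e" by blast
  show ?case
  proof (intro exI[of _ "C * C'"] conjI allI impI)
    fix z :: quat assume z: "z \<noteq> 0"
    have "\<bar>k z * l z\<bar> \<le> (C / norm z ^ d) * (C' / norm z ^ e)"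
      unfolding abs_mult using C C' z by (intro mult_mono) auto
    then show "\<bar>k z * l z\<bar> \<le> C * C' / norm z ^ (d + e)" by (simp add: power_add)
  qed (use C C' in simp)
next
  case (add d k l)
  then obtain C C' where C: "C \<ge> 0" "\<forall>z. z \<noteq> 0 \<longrightarrow> \<bar>k z\<bar> \<le> C / norm z ^ d"
    and C': "C' \<ge> 0" "\<forall>z. z \<noteq> 0 \<longrightarrow> \<bar>l z\<bar> \<le> C' / norm z ^ d" by blast
  show ?case
  proof (intro exI[of _ "C + C'"] conjI allI impI)
    fix z :: quat assume z: "z \<noteq> 0"
    have "\<bar>k z\<bar> \<le> C / norm z ^ d" "\<bar>l z\<bar> \<le> C' / norm z ^ d" using C C' z by auto
    then show "\<bar>k z + l z\<bar> \<le> (C + C') / norm z ^ d" by (simp add: add_divide_distrib)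
  qed (use C C' in simp)
next
  case (scale d k c)
  then obtain C where C: "C \<ge> 0" "\<forall>z. z \<noteq> 0 \<longrightarrow> \<bar>k z\<bar> \<le> C / norm z ^ d" by blast
  show ?case
  proof (intro exI[of _ "\<bar>c\<bar> * C"] conjI allI impI)
    fix z :: quat assume z: "z \<noteq> 0"
    have "\<bar>c * k z\<bar> \<le> \<bar>c\<bar> * (C / norm z ^ d)"
      unfolding abs_mult using C z by (intro mult_left_mono) auto
    then show "\<bar>c * k z\<bar> \<le> \<bar>c\<bar> * C / norm z ^ d" by simp
  qed (use C in simp)
qed

lemma has_derivative_inverse_norm_square:
  assumes "z \<noteq> (0::quat)"
  shows "((\<lambda>z. 1 / (norm z)\<^sup>2) has_derivative (\<lambda>v. \<Sum>i\<in>UNIV. (- 2) * (z $ i * ((1 / (norm z)\<^sup>2) * (1 / (norm z)\<^sup>2))) * v $ i)) (at z)"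
proof -
  have "((\<lambda>z. z \<bullet> z) has_derivative (\<lambda>v. z \<bullet> v + v \<bullet> z)) (at z)"
    using has_derivative_inner[where x=z and s=UNIV and f="\<lambda>x. x" and g="\<lambda>x. x", OF has_derivative_ident has_derivative_ident]
    by simp
  from Deriv.has_derivative_inverse[OF _ this] assms
  have *: "((\<lambda>z. inverse (z \<bullet> z)) has_derivative (\<lambda>v. - (inverse (z \<bullet> z) * (z \<bullet> v + v \<bullet> z) * inverse (z \<bullet> z)))) (at z)"
    by simp
  have "- (inverse (z \<bullet> z) * (z \<bullet> v + v \<bullet> z) * inverse (z \<bullet> z)) = (\<Sum>i\<in>UNIV. (- 2) * (z $ i * ((1 / (norm z)\<^sup>2) * (1 / (norm z)\<^sup>2))) * v $ i)" for v
  proof -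
    have "- (inverse (z \<bullet> z) * (z \<bullet> v + v \<bullet> z) * inverse (z \<bullet> z)) = (-2 * (1 / (norm z)\<^sup>2) * (1 / (norm z)\<^sup>2)) * (z \<bullet> v)"
      by (simp add: power2_norm_eq_inner inner_commute field_simps)
    also have "\<dots> = (\<Sum>i\<in>UNIV. (- 2) * (z $ i * ((1 / (norm z)\<^sup>2) * (1 / (norm z)\<^sup>2))) * v $ i)"
      unfolding inner_vec_def sum_distrib_left by (rule sum.cong) (simp_all add: algebra_simps)
    finally show ?thesis .
  qed
  with * show ?thesis by (simp add: power2_norm_eq_inner inverse_eq_divide)
qed

lemma decay_kernel_derivative:
  assumes "decay_kernel d k"
  shows "\<exists>k'. (\<forall>i. decay_kernel (Suc d) (k' i)) \<and>
    (\<forall>z. z \<noteq> 0 \<longrightarrow> (k has_derivative (\<lambda>v. \<Sum>i\<in>UNIV. k' i z * v $ i)) (at z))"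
  using assms
proof induction
  case inv
  show ?case
  proof (intro exI conjI allI impI)
    fix i :: 4
    have "decay_kernel (Suc 3) (\<lambda>z. (1 / (norm z)\<^sup>2) * (1 / (norm z)\<^sup>2))"
      using decay_kernel.mult[OF decay_kernel.inv decay_kernel.inv] by (simp add: numeral_eq_Suc)
    from decay_kernel.scale[OF decay_kernel.coord[OF this], of "-2" i]
    show "decay_kernel (Suc 2) (\<lambda>z. (- 2) * (z $ i * ((1 / (norm z)\<^sup>2) * (1 / (norm z)\<^sup>2))))"
      by (simp add: numeral_eq_Suc)
  qed (rule has_derivative_inverse_norm_square)
next
  case (coord d k j)
  then obtain k' where k': "\<And>i. decay_kernel (Suc (Suc d)) (k' i)"
    "\<And>z. z \<noteq> 0 \<Longrightarrow> (k has_derivative (\<lambda>v. \<Sum>i\<in>UNIV. k' i z * v $ i)) (at z)" by blast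
  show ?case
  proof (intro exI conjI allI impI)
    fix i :: 4
    show "decay_kernel (Suc d) (\<lambda>z. z $ j * k' i z + (if i = j then 1 else 0) * k z)"
      by (intro decay_kernel.intros k' coord)
  next
    fix z :: quat assume "z \<noteq> 0"
    from has_derivative_mult[OF bounded_linear_imp_has_derivative[OF bounded_linear_vec_nth[of j]] k'(2)[OF this]]
    show "((\<lambda>z. z $ j * k z) has_derivative (\<lambda>v. \<Sum>i\<in>UNIV. (z $ j * k' i z + (if i = j then 1 else 0) * k z) * v $ i)) (at z)"
    proof (rule has_derivative_eq_rhs, intro ext)
      fix v :: quat
      have "(if i = j then 1 else 0) * k z * v $ i = (if i = j then k z * v $ j else 0)" for i
        by simp
      then show "z $ j * (\<Sum>i\<in>UNIV. k' i z * v $ i) + v $ j * k z =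
          (\<Sum>i\<in>UNIV. (z $ j * k' i z + (if i = j then 1 else 0) * k z) * v $ i)"
        by (simp add: distrib_right sum.distrib sum_distrib_left mult.assoc mult.commute[of "k z"])
    qed
  qed
next
  case (mult d k e l)
  then obtain k' l' where k': "\<And>i. decay_kernel (Suc d) (k' i)"
    "\<And>z. z \<noteq> 0 \<Longrightarrow> (k has_derivative (\<lambda>v. \<Sum>i\<in>UNIV. k' i z * v $ i)) (at z)"
    and l': "\<And>i. decay_kernel (Suc e) (l' i)"
    "\<And>z. z \<noteq> 0 \<Longrightarrow> (l has_derivative (\<lambda>v. \<Sum>i\<in>UNIV. l' i z * v $ i)) (at z)" by blast
  show ?case
  proof (intro exI conjI allI impI)
    fix i :: 4
    show "decay_kernel (Suc (d + e)) (\<lambda>z. k z * l' i z + k' i z * l z)"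
      using decay_kernel.add[OF decay_kernel.mult[OF mult(1) l'(1)] decay_kernel.mult[OF k'(1) mult(2), unfolded add_Suc add_Suc_right, folded add_Suc_right]]
      by simp
  next
    fix z :: quat assume "z \<noteq> 0"
    from has_derivative_mult[OF k'(2)[OF this] l'(2)[OF this]]
    show "((\<lambda>z. k z * l z) has_derivative (\<lambda>v. \<Sum>i\<in>UNIV. (k z * l' i z + k' i z * l z) * v $ i)) (at z)"
      by (rule has_derivative_eq_rhs) (rule ext, simp add: sum_distrib_left sum_distrib_right sum.distrib algebra_simps)
  qed
next
  case (add d k l)
  then obtain k' l' where k': "\<And>i. decay_kernel (Suc d) (k' i)"
    "\<And>z. z \<noteq> 0 \<Longrightarrow> (k has_derivative (\<lambda>v. \<Sum>i\<in>UNIV. k' i z * v $ i)) (at z)"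
    and l': "\<And>i. decay_kernel (Suc d) (l' i)"
    "\<And>z. z \<noteq> 0 \<Longrightarrow> (l has_derivative (\<lambda>v. \<Sum>i\<in>UNIV. l' i z * v $ i)) (at z)" by blast
  show ?case
  proof (intro exI conjI allI impI)
    fix i :: 4
    show "decay_kernel (Suc d) (\<lambda>z. k' i z + l' i z)" by (intro decay_kernel.intros k' l')
  next
    fix z :: quat assume "z \<noteq> 0"
    from has_derivative_add[OF k'(2)[OF this] l'(2)[OF this]]
    show "((\<lambda>z. k z + l z) has_derivative (\<lambda>v. \<Sum>i\<in>UNIV. (k' i z + l' i z) * v $ i)) (at z)"
      by (rule has_derivative_eq_rhs) (rule ext, simp add: sum.distrib algebra_simps)
  qed
next
  case (scale d k c)
  then obtain k' where k': "\<And>i. decay_kernel (Suc d) (k' i)"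
    "\<And>z. z \<noteq> 0 \<Longrightarrow> (k has_derivative (\<lambda>v. \<Sum>i\<in>UNIV. k' i z * v $ i)) (at z)" by blast
  show ?case
  proof (intro exI conjI allI impI)
    fix i :: 4
    show "decay_kernel (Suc d) (\<lambda>z. c * k' i z)" by (intro decay_kernel.intros k')
  next
    fix z :: quat assume "z \<noteq> 0"
    from has_derivative_mult_right[OF k'(2)[OF this], of c]
    show "((\<lambda>z. c * k z) has_derivative (\<lambda>v. \<Sum>i\<in>UNIV. (c * k' i z) * v $ i)) (at z)"
      by (rule has_derivative_eq_rhs) (rule ext, simp add: sum_distrib_left algebra_simps)
  qed
qed

lemma norm_ge_half:
  fixes z v :: quat
  assumes "norm v \<le> norm z / 2" shows "norm z / 2 \<le> norm (z + v)"
  using assms norm_triangle_ineq2[of z "- v"] by simp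

text \<open>
  Mean value theorem on the ball of radius \<open>|z|/2\<close> around \<open>z\<close>, which stays away from the origin.
\<close>

lemma decay_kernel_increment_bound:
  assumes "decay_kernel d k"
  shows "\<exists>C\<ge>0. \<forall>z v. z \<noteq> 0 \<longrightarrow> norm v \<le> norm z / 2 \<longrightarrow> \<bar>k (z + v) - k z\<bar> \<le> C * norm v / norm z ^ Suc d"
proof -
  obtain k' where k': "\<And>i. decay_kernel (Suc d) (k' i)"
    "\<And>z. z \<noteq> 0 \<Longrightarrow> (k has_derivative (\<lambda>v. \<Sum>i\<in>UNIV. k' i z * v $ i)) (at z)"
    using decay_kernel_derivative[OF assms] by blast
  have "\<forall>i. \<exists>C\<ge>0. \<forall>z. z \<noteq> 0 \<longrightarrow> \<bar>k' i z\<bar> \<le> C / norm z ^ Suc d"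
    using decay_kernel_bound[OF k'(1)] by blast
  then obtain C where C: "\<And>i. C i \<ge> 0" "\<And>i z. z \<noteq> 0 \<Longrightarrow> \<bar>k' i z\<bar> \<le> C i / norm z ^ Suc d"
    by metis
  define B where "B = (\<Sum>i\<in>UNIV. C i)"
  have "B \<ge> 0" unfolding B_def by (intro sum_nonneg C)
  show ?thesis
  proof (intro exI[of _ "B * 2 ^ Suc d"] conjI allI impI)
    show "0 \<le> B * 2 ^ Suc d" using \<open>B \<ge> 0\<close> by simp
    fix z v :: quat assume z: "z \<noteq> 0" and v: "norm v \<le> norm z / 2"
    have nz: "norm w \<ge> norm z / 2" if "w \<in> cball z (norm z / 2)" for w
      using norm_ge_half[of "w - z" z] that by (simp add: dist_norm norm_minus_commute)
    have "norm (k (z + v) - k z) \<le> (B * 2 ^ Suc d / norm z ^ Suc d) * norm ((z + v) - z)"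
    proof (rule differentiable_bound[of "cball z (norm z / 2)" k "\<lambda>w v. \<Sum>i\<in>UNIV. k' i w * v $ i"])
      fix w assume w: "w \<in> cball z (norm z / 2)"
      have w0: "w \<noteq> 0" using nz[OF w] z by auto
      then show "(k has_derivative (\<lambda>v. \<Sum>i\<in>UNIV. k' i w * v $ i)) (at w within cball z (norm z / 2))"
        using k'(2) has_derivative_at_withinI by blast
      show "onorm (\<lambda>v. \<Sum>i\<in>UNIV. k' i w * v $ i) \<le> B * 2 ^ Suc d / norm z ^ Suc d"
      proof (rule onorm_le)
        fix h :: quat
        have "norm (\<Sum>i\<in>UNIV. k' i w * h $ i) \<le> (\<Sum>i\<in>UNIV. (C i / norm w ^ Suc d) * norm h)"
          using C w0 component_le_norm_cart[of h]
          by (intro sum_norm_le) (simp only: real_norm_def abs_mult, intro mult_mono, auto simp del: power_Suc)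
        also have "\<dots> = B / norm w ^ Suc d * norm h"
          unfolding B_def by (simp add: sum_distrib_right sum_divide_distrib del: power_Suc)
        also have "\<dots> \<le> B / (norm z / 2) ^ Suc d * norm h"
          using nz[OF w] z \<open>B \<ge> 0\<close>
          by (intro mult_right_mono divide_left_mono power_mono mult_pos_pos zero_less_power) (auto simp: w0)
        also have "\<dots> = B * 2 ^ Suc d / norm z ^ Suc d * norm h"
          by (simp add: power_divide del: power_Suc)
        finally show "norm (\<Sum>i\<in>UNIV. k' i w * h $ i) \<le> B * 2 ^ Suc d / norm z ^ Suc d * norm h" .
      qed
    qed (use v in \<open>auto simp: dist_norm\<close>)
    then show "\<bar>k (z + v) - k z\<bar> \<le> B * 2 ^ Suc d * norm v / norm z ^ Suc d"
      by simp
  qed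
qed

text \<open>
  The remainder is the integrated increment of the partial derivatives, to which the previous bound
  applies with \<open>d\<close> replaced by \<open>d + 1\<close>.
\<close>

lemma decay_kernel_taylor:
  assumes k': "\<And>i. decay_kernel (Suc d) (k' i)"
    "\<And>z. z \<noteq> 0 \<Longrightarrow> (k has_derivative (\<lambda>v. \<Sum>i\<in>UNIV. k' i z * v $ i)) (at z)"
  shows "\<exists>C\<ge>0. \<forall>z v. z \<noteq> 0 \<longrightarrow> norm v \<le> norm z / 2 \<longrightarrow>
    \<bar>k (z + v) - k z - (\<Sum>i\<in>UNIV. k' i z * v $ i)\<bar> \<le> C * (norm v)\<^sup>2 / norm z ^ (d + 2)"
proof -
  have "\<forall>i. \<exists>C\<ge>0. \<forall>z v. z \<noteq> 0 \<longrightarrow> norm v \<le> norm z / 2 \<longrightarrow> \<bar>k' i (z + v) - k' i z\<bar> \<le> C * norm v / norm z ^ (d + 2)"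
    using decay_kernel_increment_bound[OF k'(1)] by simp
  then obtain C where C: "\<And>i. C i \<ge> 0"
    "\<And>i z v. z \<noteq> 0 \<Longrightarrow> norm v \<le> norm z / 2 \<Longrightarrow> \<bar>k' i (z + v) - k' i z\<bar> \<le> C i * norm v / norm z ^ (d + 2)"
    by metis
  define B where "B = (\<Sum>i\<in>UNIV. C i)"
  have "B \<ge> 0" unfolding B_def by (intro sum_nonneg C)
  show ?thesis
  proof (intro exI[of _ B] conjI allI impI)
    show "0 \<le> B" by fact
    fix z v :: quat assume z: "z \<noteq> 0" and v: "norm v \<le> norm z / 2"
    have S: "w \<noteq> 0 \<and> norm (w - z) \<le> norm v" if "w \<in> cball z (norm v)" for w
    proof -
      have 1: "norm (w - z) \<le> norm v" using that by (simp add: dist_norm norm_minus_commute)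
      with norm_ge_half[of "w - z" z] v z show ?thesis by auto
    qed
    have "norm (k (z + v) - k z - (\<Sum>i\<in>UNIV. k' i z * ((z + v) - z) $ i)) \<le> norm ((z + v) - z) * (B * norm v / norm z ^ (d + 2))"
    proof (rule differentiable_bound_linearization[of z "z + v" "cball z (norm v)" k "\<lambda>w v. \<Sum>i\<in>UNIV. k' i w * v $ i"])
      show "z + t *\<^sub>R (z + v - z) \<in> cball z (norm v)" if "t \<in> {0..1}" for t
        using that by (auto simp: dist_norm mult_left_le_one_le)
      fix w assume w: "w \<in> cball z (norm v)"
      show "(k has_derivative (\<lambda>v. \<Sum>i\<in>UNIV. k' i w * v $ i)) (at w within cball z (norm v))"
        using k'(2) S[OF w] has_derivative_at_withinI by blast
      show "onorm ((\<lambda>h. \<Sum>i\<in>UNIV. k' i w * h $ i) - (\<lambda>h. \<Sum>i\<in>UNIV. k' i z * h $ i)) \<le> B * norm v / norm z ^ (d + 2)"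
        unfolding fun_diff_def
      proof (rule onorm_le)
        fix h :: quat
        have 1: "\<bar>k' i w - k' i z\<bar> \<le> C i * norm v / norm z ^ (d + 2)" for i
        proof -
          have "\<bar>k' i (z + (w - z)) - k' i z\<bar> \<le> C i * norm (w - z) / norm z ^ (d + 2)"
            using S[OF w] v by (intro C z) auto
          also have "\<dots> \<le> C i * norm v / norm z ^ (d + 2)"
            using S[OF w] C(1)[of i] by (intro divide_right_mono mult_left_mono) auto
          finally show ?thesis by simp
        qed
        have "norm ((\<Sum>i\<in>UNIV. k' i w * h $ i) - (\<Sum>i\<in>UNIV. k' i z * h $ i)) = norm (\<Sum>i\<in>UNIV. (k' i w - k' i z) * h $ i)"
          by (simp only: sum_subtractf left_diff_distrib)
        also have "\<dots> \<le> (\<Sum>i\<in>UNIV. (C i * norm v / norm z ^ (d + 2)) * norm h)"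
          using C(1) 1 component_le_norm_cart[of h]
          by (intro sum_norm_le) (simp only: real_norm_def abs_mult, intro mult_mono, auto simp del: power_Suc)
        also have "\<dots> = B * norm v / norm z ^ (d + 2) * norm h"
          unfolding B_def by (simp only: sum_distrib_right sum_divide_distrib)
        finally show "norm ((\<Sum>i\<in>UNIV. k' i w * h $ i) - (\<Sum>i\<in>UNIV. k' i z * h $ i)) \<le> B * norm v / norm z ^ (d + 2) * norm h" .
      qed
    qed simp
    then show "\<bar>k (z + v) - k z - (\<Sum>i\<in>UNIV. k' i z * v $ i)\<bar> \<le> B * (norm v)\<^sup>2 / norm z ^ (d + 2)"
      by (simp add: power2_eq_square algebra_simps)
  qed
qed

section \<open>Potentials of square integrable densities\<close>

text \<open>
  Near the origin this is the singularity \<open>|z|\<^sup>-\<^sup>3\<close> of the Fueter kernel and far away the square of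
  its decay; integrability of this one function covers both.
\<close>

definition decay_profile :: "quat \<Rightarrow> real" where
  "decay_profile z = min (1 / norm z ^ 3) (1 / norm z ^ 6)"

lemma decay_profile_measurable [measurable]: "decay_profile \<in> borel_measurable borel"
  unfolding decay_profile_def[abs_def] by measurable

lemma integrable_lborel_of_integrable_on:
  fixes h :: "real \<Rightarrow> real"
  assumes "h integrable_on A" "\<And>t. t \<in> A \<Longrightarrow> 0 \<le> h t" "A \<in> sets borel" "h \<in> borel_measurable borel"
  shows "integrable lborel (\<lambda>t. indicator A t * h t)"
proof -
  have "integrable lebesgue (\<lambda>t. indicator A t *\<^sub>R h t)"
    using nonnegative_absolutely_integrable_1[OF assms(1,2)] by (simp add: set_integrable_def)
  moreover have "(\<lambda>t. indicator A t *\<^sub>R h t) \<in> borel_measurable lborel" using assms(3,4) by simp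
  ultimately show ?thesis by (subst (asm) integrable_completion) simp_all
qed

text \<open>
  The profile is dominated by the product of a function of one variable over the four coordinates:
  every coordinate is at most \<open>|z|\<close>, so a factor \<open>|t|\<close> to the power \<open>-3/4\<close> (for \<open>|t| \<le> 1\<close>) or
  \<open>-3/2\<close> (for \<open>|t| \<ge> 1\<close>) is at least the fourth root of the profile.  The one-dimensional function
  is integrable, and Tonelli finishes the proof.
\<close>

lemma decay_profile_integrable: "integrable lborel decay_profile"
proof -
  define p where "p t = indicator {0..1} t * t powr (-3/4) + indicator {1..} t * t powr (-3/2)" for t :: real
  have "integrable lborel p" unfolding p_def
  proof (intro Bochner_Integration.integrable_add integrable_lborel_of_integrable_on)
    show "(\<lambda>t. t powr (-3/4)) integrable_on {0..1::real}"
      by (rule integrable_on_powr_from_0) auto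
    show "(\<lambda>t. t powr (-3/2)) integrable_on {1::real..}"
      using has_integral_powr_to_inf[of "-3/2" 1] by (auto simp: integrable_on_def)
  qed auto
  then have pp: "integrable lborel (\<lambda>t. p t + p (0 + (-1) * t))"
    by (intro Bochner_Integration.integrable_add lborel_integrable_real_affine) auto
  \<comment> \<open>The value at zero is infinite because 0 powr a = 0 would break the domination on the
    coordinate hyperplanes.\<close>
  define q :: "real \<Rightarrow> ennreal" where "q t = (if t = 0 then top else ennreal (p t + p (0 + (-1) * t)))" for t
  have pm: "p \<in> borel_measurable borel" unfolding p_def by measurable
  then have qm: "q \<in> borel_measurable borel" unfolding q_def by measurable
  have "(\<integral>\<^sup>+t. q t \<partial>lborel) = (\<integral>\<^sup>+t. ennreal (p t + p (0 + (-1) * t)) \<partial>lborel)"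
    by (rule nn_integral_cong_AE) (use AE_lborel_singleton[of "0::real"] in eventually_elim, simp add: q_def)
  also have "\<dots> = ennreal (\<integral>t. p t + p (0 + (-1) * t) \<partial>lborel)"
    by (rule nn_integral_eq_integral[OF pp]) (auto simp: p_def)
  finally have q_fin: "(\<integral>\<^sup>+t. q t \<partial>lborel) < top" by simp
  have "(\<integral>\<^sup>+z. (\<Prod>b\<in>Basis. q (z \<bullet> b)) \<partial>(lborel :: quat measure)) = (\<Prod>b\<in>(Basis::quat set). (\<integral>\<^sup>+t. q t \<partial>lborel))"
    by (rule nn_integral_lborel_prod) (use qm in auto)
  also have "\<dots> = (\<integral>\<^sup>+t. q t \<partial>lborel) ^ 4" by simp
  also have "\<dots> < top" using q_fin by (simp add: power_less_top_ennreal)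
  finally have fin: "(\<integral>\<^sup>+z. (\<Prod>b\<in>Basis. q (z \<bullet> b)) \<partial>(lborel :: quat measure)) < top" .
  have le: "ennreal (decay_profile z) \<le> (\<Prod>b\<in>Basis. q (z \<bullet> b))" for z :: quat
  proof (cases "z = 0")
    case True
    then show ?thesis by (simp add: decay_profile_def)
  next
    case False
    define M where "M = (if norm z \<le> 1 then norm z powr (-3/4) else norm z powr (-3/2))"
    have q_ge: "ennreal M \<le> q (z \<bullet> b)" if "b \<in> Basis" for b
    proof (cases "z \<bullet> b = 0")
      case True then show ?thesis by (simp add: q_def)
    next
      case zb: False
      define t where "t = \<bar>z \<bullet> b\<bar>"
      have t: "0 < t" "t \<le> norm z" using zb Basis_le_norm[OF that, of z] by (auto simp: t_def)
      have "p t \<le> p (z \<bullet> b) + p (0 + (-1) * (z \<bullet> b))"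
        by (cases "z \<bullet> b \<ge> 0") (auto simp: t_def p_def)
      moreover have "M \<le> p t"
      proof (cases "t \<le> 1")
        case True
        have *: "t powr (-3/4) \<le> p t" using True t by (simp add: p_def)
        have "M \<le> t powr (-3/4)"
        proof (cases "norm z \<le> 1")
          case True then show ?thesis using t by (simp add: M_def powr_mono2')
        next
          case False
          have "M \<le> norm z powr 0" using False by (simp add: M_def powr_mono del: powr_zero_eq_one)
          also have "\<dots> = 1 powr (-3/4)" using False by auto
          also have "\<dots> \<le> t powr (-3/4)" using True t by (intro powr_mono2') auto
          finally show ?thesis .
        qed
        with * show ?thesis by simp
      next
        case False
        then have "p t = t powr (-3/2)" by (simp add: p_def)
        moreover have "M = norm z powr (-3/2)" using False t by (simp add: M_def)
        ultimately show ?thesis using t by (simp add: powr_mono2')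
      qed
      ultimately show ?thesis using zb by (simp add: q_def ennreal_leI)
    qed
    have "decay_profile z \<le> M ^ 4"
    proof (cases "norm z \<le> 1")
      case True
      have "M ^ 4 = norm z powr (- 3)" using True \<open>z \<noteq> 0\<close> by (simp add: M_def powr_powr flip: powr_realpow)
      also have "\<dots> = 1 / norm z ^ 3" using \<open>z \<noteq> 0\<close> by (simp add: powr_minus_divide powr_numeral)
      finally show ?thesis by (simp add: decay_profile_def)
    next
      case F: False
      have "M ^ 4 = norm z powr (- 6)" using F \<open>z \<noteq> 0\<close> by (simp add: M_def powr_powr flip: powr_realpow)
      also have "\<dots> = 1 / norm z ^ 6" using \<open>z \<noteq> 0\<close> by (simp add: powr_minus_divide powr_numeral)
      finally show ?thesis by (simp add: decay_profile_def)
    qed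
    then have "ennreal (decay_profile z) \<le> ennreal M ^ 4"
      by (simp add: ennreal_power M_def ennreal_leI)
    also have "\<dots> = (\<Prod>b\<in>(Basis::quat set). ennreal M)" by simp
    also have "\<dots> \<le> (\<Prod>b\<in>Basis. q (z \<bullet> b))"
    proof -
      have "(\<Prod>b\<in>A. ennreal M) \<le> (\<Prod>b\<in>A. q (z \<bullet> b))" if "finite A" "A \<subseteq> Basis" for A
        using that by (induction A rule: finite_induct) (auto intro!: mult_mono q_ge)
      from this[of Basis] show ?thesis by simp
    qed
    finally show ?thesis .
  qed
  show ?thesis
  proof (rule integrableI_bounded)
    have "(\<integral>\<^sup>+z. ennreal (norm (decay_profile z)) \<partial>lborel) \<le> (\<integral>\<^sup>+z. (\<Prod>b\<in>Basis. q (z \<bullet> b)) \<partial>(lborel :: quat measure))"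
      by (intro nn_integral_mono) (use le in \<open>auto simp: decay_profile_def\<close>)
    then show "(\<integral>\<^sup>+z. ennreal (norm (decay_profile z)) \<partial>lborel) < \<infinity>" using fin by (simp add: le_less_trans)
  qed simp
qed

lemma lborel_distr_reflect: "distr lborel borel (\<lambda>y. x - y) = lborel" for x :: quat
proof -
  show ?thesis using lborel_affine[of "-1" x] by (simp add: density_1)
qed

lemma integrable_lborel_reflect:
  fixes h :: "quat \<Rightarrow> 'b::{banach, second_countable_topology}"
  assumes "integrable lborel h"
  shows "integrable lborel (\<lambda>y. h (x - y))"
proof -
  have "h \<in> borel_measurable borel" using borel_measurable_integrable[OF assms] by simp
  then show ?thesis using assms
    by (subst integrable_distr_eq[of "\<lambda>y. x - y" lborel borel h, symmetric]) (simp_all add: lborel_distr_reflect)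
qed

lemma decay_profile_integrable_lebesgue: "integrable lebesgue (\<lambda>y. decay_profile (x - y))"
  by (subst integrable_completion) (use integrable_lborel_reflect[OF decay_profile_integrable] in auto)

text \<open>
  A square integrable density that vanishes on a ball; its potentials are smooth inside the ball.
\<close>

locale far_density =
  fixes \<phi> :: "quat \<Rightarrow> real" and x0 :: quat and \<delta> :: real
  assumes meas: "\<phi> \<in> borel_measurable lebesgue"
    and square: "integrable lebesgue (\<lambda>y. (\<phi> y)\<^sup>2)"
    and vanish: "\<And>y. y \<in> ball x0 \<delta> \<Longrightarrow> \<phi> y = 0"

definition potential :: "(quat \<Rightarrow> real) \<Rightarrow> (quat \<Rightarrow> real) \<Rightarrow> quat \<Rightarrow> real" where
  "potential k \<phi> x = (\<integral>y. k (x - y) * \<phi> y \<partial>lebesgue)"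

lemma kernel_reflect_measurable [measurable]:
  fixes k :: "quat \<Rightarrow> real"
  assumes "k \<in> borel_measurable borel" shows "(\<lambda>y. k (x - y)) \<in> borel_measurable lebesgue"
  using assms by (intro measurable_completion) simp

lemma inverse_power_le_decay_profile:
  fixes z :: quat
  assumes "0 < \<rho>" "\<rho> \<le> norm z"
  shows "1 / norm z ^ 6 \<le> (1 + 1 / \<rho> ^ 3) * decay_profile z"
proof (cases "norm z \<ge> 1")
  case True
  have "norm z ^ 3 \<le> norm z ^ 6" using True by (intro power_increasing) auto
  then have "1 / norm z ^ 6 \<le> 1 / norm z ^ 3" using True by (intro divide_left_mono) auto
  then have m: "decay_profile z = 1 / norm z ^ 6" by (simp add: decay_profile_def)
  show ?thesis unfolding m using mult_right_mono[of 1 "1 + 1 / \<rho> ^ 3" "1 / norm z ^ 6"] assms by simp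
next
  case False
  have z: "norm z > 0" using assms by linarith
  have "norm z ^ 6 \<le> norm z ^ 3" using False by (intro power_decreasing) auto
  then have "1 / norm z ^ 3 \<le> 1 / norm z ^ 6" using z by (intro divide_left_mono) auto
  then have m: "decay_profile z = 1 / norm z ^ 3" by (simp add: decay_profile_def)
  have "1 / norm z ^ 6 = (1 / norm z ^ 3) * (1 / norm z ^ 3)" by (simp add: power_add[symmetric])
  also have "\<dots> \<le> (1 + 1 / \<rho> ^ 3) * (1 / norm z ^ 3)"
  proof (rule mult_right_mono)
    have "1 / norm z ^ 3 \<le> 1 / \<rho> ^ 3" using assms z by (intro divide_left_mono power_mono) auto
    then show "1 / norm z ^ 3 \<le> 1 + 1 / \<rho> ^ 3" by simp
  qed simp
  finally show ?thesis by (simp add: m)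
qed

context far_density
begin

lemma far:
  assumes "\<phi> y \<noteq> 0" shows "\<delta> - dist x0 x \<le> norm (x - y)"
proof -
  have "dist x0 y \<ge> \<delta>" using vanish[of y] assms by force
  moreover have "dist x0 y \<le> dist x0 x + dist x y" by (rule dist_triangle)
  ultimately show ?thesis by (simp add: dist_norm)
qed

text \<open>
  By the arithmetic-geometric mean inequality \<open>|\<phi>| |x-y|\<^sup>-\<^sup>3 \<le> |x-y|\<^sup>-\<^sup>6 + \<phi>\<^sup>2\<close>, and both terms are
  integrable away from \<open>x\<close>; for \<open>d > 3\<close> the additional factors are bounded.
\<close>

lemma integrable_inverse_power:
  assumes x: "x \<in> ball x0 \<delta>" and d: "3 \<le> d"
  shows "integrable lebesgue (\<lambda>y. \<bar>\<phi> y\<bar> / norm (x - y) ^ d)"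
proof -
  define \<rho> where "\<rho> = \<delta> - dist x0 x"
  have \<rho>: "\<rho> > 0" using x by (simp add: \<rho>_def)
  define B where "B = 1 / \<rho> ^ (d - 3)"
  have "B \<ge> 0" using \<rho> by (simp add: B_def)
  have "integrable lebesgue (\<lambda>y. B * ((1 + 1 / \<rho> ^ 3) * decay_profile (x - y) + (\<phi> y)\<^sup>2))"
    by (intro integrable_mult_right Bochner_Integration.integrable_add decay_profile_integrable_lebesgue square)
  then show ?thesis
  proof (rule Bochner_Integration.integrable_bound)
    have "(\<lambda>y. norm (x - y) ^ d) \<in> borel_measurable lebesgue"
      using kernel_reflect_measurable[of "\<lambda>z. norm z ^ d"] by simp
    then show "(\<lambda>y. \<bar>\<phi> y\<bar> / norm (x - y) ^ d) \<in> borel_measurable lebesgue" using meas by simp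
    have "norm (\<bar>\<phi> y\<bar> / norm (x - y) ^ d) \<le> norm (B * ((1 + 1 / \<rho> ^ 3) * decay_profile (x - y) + (\<phi> y)\<^sup>2))" for y
    proof (cases "\<phi> y = 0")
      case True then show ?thesis by simp
    next
      case False
      define n where "n = norm (x - y)"
      have n: "n \<ge> \<rho>" "n > 0" using far[OF False, of x] \<rho> by (auto simp: n_def \<rho>_def)
      have "1 / n ^ d = (1 / n ^ (d - 3)) * (1 / n ^ 3)" using d by (simp add: power_add[symmetric])
      also have "\<dots> \<le> B * (1 / n ^ 3)" unfolding B_def
        using n \<rho> by (intro mult_right_mono divide_left_mono power_mono) auto
      finally have 1: "1 / n ^ d \<le> B * (1 / n ^ 3)" .
      have "2 * ((1 / n ^ 3) * \<bar>\<phi> y\<bar>) \<le> (1 / n ^ 3)\<^sup>2 + \<bar>\<phi> y\<bar>\<^sup>2"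
        using sum_squares_bound[of "1 / n^3" "\<bar>\<phi> y\<bar>"] by (simp add: mult.assoc)
      moreover have "(1 / n ^ 3) * \<bar>\<phi> y\<bar> \<ge> 0" using n by simp
      ultimately have 2: "(1 / n ^ 3) * \<bar>\<phi> y\<bar> \<le> 1 / n ^ 6 + (\<phi> y)\<^sup>2"
        by (simp add: power_one_over power_mult[symmetric])
      have 3: "1 / n ^ 6 \<le> (1 + 1 / \<rho> ^ 3) * decay_profile (x - y)"
        unfolding n_def using n \<rho> by (intro inverse_power_le_decay_profile) (auto simp: n_def)
      have "\<bar>\<phi> y\<bar> / n ^ d = 1 / n ^ d * \<bar>\<phi> y\<bar>" by simp
      also have "\<dots> \<le> B * (1 / n ^ 3) * \<bar>\<phi> y\<bar>" by (intro mult_right_mono 1) simp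
      also have "\<dots> = B * ((1 / n ^ 3) * \<bar>\<phi> y\<bar>)" by simp
      also have "\<dots> \<le> B * ((1 + 1 / \<rho> ^ 3) * decay_profile (x - y) + (\<phi> y)\<^sup>2)"
        using 2 3 \<open>B \<ge> 0\<close> by (intro mult_left_mono) auto
      finally show ?thesis using n by (simp add: n_def)
    qed
    then show "AE y in lebesgue. norm (\<bar>\<phi> y\<bar> / norm (x - y) ^ d) \<le> norm (B * ((1 + 1 / \<rho> ^ 3) * decay_profile (x - y) + (\<phi> y)\<^sup>2))"
      by simp
  qed
qed

lemma integrable_potential:
  assumes k: "decay_kernel d k" and x: "x \<in> ball x0 \<delta>" and d: "3 \<le> d"
  shows "integrable lebesgue (\<lambda>y. k (x - y) * \<phi> y)"
proof -
  obtain C where C: "C \<ge> 0" "\<And>z. z \<noteq> 0 \<Longrightarrow> \<bar>k z\<bar> \<le> C / norm z ^ d" using decay_kernel_bound[OF k] by blast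
  have "integrable lebesgue (\<lambda>y. C * (\<bar>\<phi> y\<bar> / norm (x - y) ^ d))"
    by (intro integrable_mult_right integrable_inverse_power x d)
  then show ?thesis
  proof (rule Bochner_Integration.integrable_bound)
    show "(\<lambda>y. k (x - y) * \<phi> y) \<in> borel_measurable lebesgue"
      using kernel_reflect_measurable[OF decay_kernel_measurable[OF k]] meas by simp
    have "norm (k (x - y) * \<phi> y) \<le> norm (C * (\<bar>\<phi> y\<bar> / norm (x - y) ^ d))" for y
    proof (cases "\<phi> y = 0")
      case False
      have "x - y \<noteq> 0" using far[OF False, of x] x by auto
      then have "\<bar>k (x - y)\<bar> * \<bar>\<phi> y\<bar> \<le> C / norm (x - y) ^ d * \<bar>\<phi> y\<bar>" by (intro mult_right_mono C) auto
      then show ?thesis using C by (simp add: abs_mult)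
    qed simp
    then show "AE y in lebesgue. norm (k (x - y) * \<phi> y) \<le> norm (C * (\<bar>\<phi> y\<bar> / norm (x - y) ^ d))" by simp
  qed
qed

text \<open>
  The second-order Taylor estimate of the kernel, integrated against \<open>|\<phi>|\<close>, bounds the remainder of
  the potential by a multiple of \<open>|w - x|\<^sup>2\<close>.
\<close>

lemma potential_has_derivative:
  assumes k: "decay_kernel d k" and k': "\<And>i. decay_kernel (Suc d) (k' i)"
    and D: "\<And>z. z \<noteq> 0 \<Longrightarrow> (k has_derivative (\<lambda>v. \<Sum>i\<in>UNIV. k' i z * v $ i)) (at z)"
    and x: "x \<in> ball x0 \<delta>" and d: "3 \<le> d"
  shows "(potential k \<phi> has_derivative (\<lambda>v. \<Sum>i\<in>UNIV. potential (k' i) \<phi> x * v $ i)) (at x)"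
proof -
  obtain C where C: "C \<ge> 0" "\<And>z v. z \<noteq> 0 \<Longrightarrow> norm v \<le> norm z / 2 \<Longrightarrow>
    \<bar>k (z + v) - k z - (\<Sum>i\<in>UNIV. k' i z * v $ i)\<bar> \<le> C * (norm v)\<^sup>2 / norm z ^ (d + 2)"
    using decay_kernel_taylor[OF k' D] by blast
  define M where "M = (\<integral>y. C * (\<bar>\<phi> y\<bar> / norm (x - y) ^ (d + 2)) \<partial>lebesgue)"
  have int_M: "integrable lebesgue (\<lambda>y. C * (\<bar>\<phi> y\<bar> / norm (x - y) ^ (d + 2)))"
    using d by (intro integrable_mult_right integrable_inverse_power x) auto
  define \<rho> where "\<rho> = (\<delta> - dist x0 x) / 2"
  have \<rho>: "\<rho> > 0" using x by (simp add: \<rho>_def)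
  define P where "P v = (\<Sum>i\<in>UNIV. potential (k' i) \<phi> x * v $ i)" for v :: quat
  have est: "norm (potential k \<phi> w - potential k \<phi> x - P (w - x)) \<le> M * (norm (w - x))\<^sup>2"
    if w: "dist w x < \<rho>" for w
  proof -
    define v where "v = w - x"
    have v: "norm v < \<rho>" using w by (simp add: v_def dist_norm)
    have "dist x0 w \<le> dist x0 x + dist w x" using dist_triangle[of x0 w x] by (simp add: dist_commute)
    then have wb: "w \<in> ball x0 \<delta>" using w \<rho> by (simp add: \<rho>_def)
    have i1: "integrable lebesgue (\<lambda>y. k (w - y) * \<phi> y)" by (rule integrable_potential[OF k wb d])
    have i2: "integrable lebesgue (\<lambda>y. k (x - y) * \<phi> y)" by (rule integrable_potential[OF k x d])
    have i3: "integrable lebesgue (\<lambda>y. k' i (x - y) * \<phi> y * v $ i)" for i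
      using d by (intro integrable_mult_left integrable_potential[OF k' x]) auto
    have i4: "integrable lebesgue (\<lambda>y. \<Sum>i\<in>UNIV. k' i (x - y) * \<phi> y * v $ i)"
      by (intro Bochner_Integration.integrable_sum i3)
    have "P v = (\<integral>y. (\<Sum>i\<in>UNIV. k' i (x - y) * \<phi> y * v $ i) \<partial>lebesgue)"
      unfolding P_def potential_def by (subst Bochner_Integration.integral_sum[OF i3]) simp
    then have "potential k \<phi> w - potential k \<phi> x - P v =
       (\<integral>y. k (w - y) * \<phi> y - k (x - y) * \<phi> y - (\<Sum>i\<in>UNIV. k' i (x - y) * \<phi> y * v $ i) \<partial>lebesgue)"
      unfolding potential_def
      by (simp only: Bochner_Integration.integral_diff[OF i1 i2] Bochner_Integration.integral_diff[OF Bochner_Integration.integrable_diff[OF i1 i2] i4])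
    also have "norm \<dots> \<le> (\<integral>y. C * (\<bar>\<phi> y\<bar> / norm (x - y) ^ (d + 2)) * (norm v)\<^sup>2 \<partial>lebesgue)"
    proof (rule Bochner_Integration.integral_norm_bound_integral)
      show "integrable lebesgue (\<lambda>y. k (w - y) * \<phi> y - k (x - y) * \<phi> y - (\<Sum>i\<in>UNIV. k' i (x - y) * \<phi> y * v $ i))"
        by (intro Bochner_Integration.integrable_diff i1 i2 i4)
      show "integrable lebesgue (\<lambda>y. C * (\<bar>\<phi> y\<bar> / norm (x - y) ^ (d + 2)) * (norm v)\<^sup>2)"
        by (intro integrable_mult_left int_M)
      fix y
      show "norm (k (w - y) * \<phi> y - k (x - y) * \<phi> y - (\<Sum>i\<in>UNIV. k' i (x - y) * \<phi> y * v $ i)) \<le> C * (\<bar>\<phi> y\<bar> / norm (x - y) ^ (d + 2)) * (norm v)\<^sup>2"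
      proof (cases "\<phi> y = 0")
        case False
        have n: "norm (x - y) \<ge> 2 * \<rho>" using far[OF False, of x] by (simp add: \<rho>_def)
        then have "x - y \<noteq> 0" "norm v \<le> norm (x - y) / 2" using v \<rho> by auto
        from C(2)[OF this]
        have "\<bar>k (w - y) - k (x - y) - (\<Sum>i\<in>UNIV. k' i (x - y) * v $ i)\<bar> \<le> C * (norm v)\<^sup>2 / norm (x - y) ^ (d + 2)"
          by (simp add: v_def add_diff_eq)
        then have "\<bar>k (w - y) - k (x - y) - (\<Sum>i\<in>UNIV. k' i (x - y) * v $ i)\<bar> * \<bar>\<phi> y\<bar> \<le> C * (norm v)\<^sup>2 / norm (x - y) ^ (d + 2) * \<bar>\<phi> y\<bar>"
          by (intro mult_right_mono) auto
        moreover have "k (w - y) * \<phi> y - k (x - y) * \<phi> y - (\<Sum>i\<in>UNIV. k' i (x - y) * \<phi> y * v $ i)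
          = (k (w - y) - k (x - y) - (\<Sum>i\<in>UNIV. k' i (x - y) * v $ i)) * \<phi> y"
          by (simp only: left_diff_distrib sum_distrib_right) (simp add: mult.assoc mult.left_commute mult.commute)
        ultimately show ?thesis by (simp add: abs_mult mult.commute mult.left_commute)
      qed simp
    qed
    also have "\<dots> = M * (norm v)\<^sup>2" unfolding M_def by (rule integral_mult_left_zero)
    finally show ?thesis by (simp add: v_def)
  qed
  show ?thesis unfolding P_def[symmetric]
  proof (rule has_derivativeI_sandwich[OF \<rho>])
    show "bounded_linear P" unfolding P_def
      by (intro bounded_linear_sum bounded_linear_const_mult bounded_linear_vec_nth)
    show "norm ((potential k \<phi> w - potential k \<phi> x) - P (w - x)) / norm (w - x) \<le> M * norm (w - x)"
      if "w \<noteq> x" "dist w x < \<rho>" for w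
      using est[OF that(2)] that(1) by (simp add: divide_le_eq power2_eq_square mult.assoc)
    have "((\<lambda>w. M * norm (w - x)) \<longlongrightarrow> M * norm (x - x)) (at x)" by (intro tendsto_intros)
    then show "((\<lambda>w. M * norm (w - x)) \<longlongrightarrow> 0) (at x)" by simp
  qed
qed

lemma potential_C1:
  assumes k: "decay_kernel d k" and k': "\<And>i. decay_kernel (Suc d) (k' i)"
    and D: "\<And>z. z \<noteq> 0 \<Longrightarrow> (k has_derivative (\<lambda>v. \<Sum>i\<in>UNIV. k' i z * v $ i)) (at z)"
    and d: "3 \<le> d"
  shows "C1_on (ball x0 \<delta>) (potential k \<phi>)"
    and "\<And>x i. x \<in> ball x0 \<delta> \<Longrightarrow> partial_deriv i (potential k \<phi>) x = potential (k' i) \<phi> x"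
proof -
  have der: "(potential k \<phi> has_derivative (\<lambda>v. \<Sum>i\<in>UNIV. potential (k' i) \<phi> x * v $ i)) (at x)" if "x \<in> ball x0 \<delta>" for x
    by (rule potential_has_derivative[OF k k' D that d])
  have cont: "continuous_on (ball x0 \<delta>) (potential (k' i) \<phi>)" for i
  proof -
    obtain k'' where k'': "\<And>j. decay_kernel (Suc (Suc d)) (k'' j)"
      "\<And>z. z \<noteq> 0 \<Longrightarrow> (k' i has_derivative (\<lambda>v. \<Sum>j\<in>UNIV. k'' j z * v $ j)) (at z)"
      using decay_kernel_derivative[OF k'] by blast
    have "(potential (k' i) \<phi> has_derivative (\<lambda>v. \<Sum>j\<in>UNIV. potential (k'' j) \<phi> x * v $ j)) (at x)" if "x \<in> ball x0 \<delta>" for x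
      using d by (intro potential_has_derivative[OF k' k''] that) auto
    then show ?thesis using has_derivative_continuous continuous_at_imp_continuous_on by blast
  qed
  show "C1_on (ball x0 \<delta>) (potential k \<phi>)"
    by (rule C1_onI, rule der) (auto intro!: continuous_intros cont)
  show "partial_deriv i (potential k \<phi>) x = potential (k' i) \<phi> x" if "x \<in> ball x0 \<delta>" for x i
    using partial_deriv_eq[OF der[OF that], of i] by (simp add: qe_nth if_distrib cong: if_cong)
qed

lemma potential_harmonic:
  assumes k: "decay_kernel d k" and k': "\<And>i. decay_kernel (Suc d) (k' i)"
    and k'': "\<And>i j. decay_kernel (Suc (Suc d)) (k'' i j)"
    and D: "\<And>z. z \<noteq> 0 \<Longrightarrow> (k has_derivative (\<lambda>v. \<Sum>i\<in>UNIV. k' i z * v $ i)) (at z)"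
    and D': "\<And>i z. z \<noteq> 0 \<Longrightarrow> (k' i has_derivative (\<lambda>v. \<Sum>j\<in>UNIV. k'' i j z * v $ j)) (at z)"
    and laplace: "\<And>z. z \<noteq> 0 \<Longrightarrow> (\<Sum>i\<in>UNIV. k'' i i z) = 0"
    and d: "3 \<le> d"
  shows "harmonic_on (ball x0 \<delta>) (potential k \<phi>)"
proof -
  have u: "C1_on (ball x0 \<delta>) (potential k \<phi>)"
      "x \<in> ball x0 \<delta> \<Longrightarrow> partial_deriv i (potential k \<phi>) x = potential (k' i) \<phi> x" for x i
    by (rule potential_C1[OF k k' D d]; assumption)+
  have d': "3 \<le> Suc d" "3 \<le> Suc (Suc d)" using d by auto
  have u': "C1_on (ball x0 \<delta>) (potential (k' i) \<phi>)"
      "x \<in> ball x0 \<delta> \<Longrightarrow> partial_deriv j (potential (k' i) \<phi>) x = potential (k'' i j) \<phi> x" for x i j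
    by (rule potential_C1[OF k' k'' D' d'(1)]; assumption)+
  have cong: "partial_deriv j (partial_deriv i (potential k \<phi>)) x = potential (k'' i j) \<phi> x" if "x \<in> ball x0 \<delta>" for i j x
    using partial_deriv_cong_open[OF open_ball that, of "partial_deriv i (potential k \<phi>)" "potential (k' i) \<phi>" j] u(2) u'(2)[OF that]
    by simp
  have "C1_on (ball x0 \<delta>) (partial_deriv i (potential k \<phi>))" for i
    by (rule C1_on_cong_open[OF open_ball _ u'(1)]) (use u(2) in auto)
  moreover have "(\<Sum>i\<in>UNIV. partial_deriv i (partial_deriv i (potential k \<phi>)) x) = 0" if x: "x \<in> ball x0 \<delta>" for x
  proof -
    have i: "integrable lebesgue (\<lambda>y. k'' i i (x - y) * \<phi> y)" for i
      by (rule integrable_potential[OF k'' x d'(2)])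
    have "(\<Sum>i\<in>UNIV. k'' i i (x - y) * \<phi> y) = 0" for y
    proof (cases "\<phi> y = 0")
      case False
      have "x - y \<noteq> 0" using far[OF False, of x] x by auto
      then show ?thesis using laplace by (simp flip: sum_distrib_right)
    qed simp
    then have "(\<integral>y. (\<Sum>i\<in>UNIV. k'' i i (x - y) * \<phi> y) \<partial>lebesgue) = 0" by simp
    then show ?thesis unfolding cong[OF x] potential_def by (simp add: Bochner_Integration.integral_sum[OF i])
  qed
  ultimately show ?thesis using u(1) by (simp add: harmonic_on_def C2_on_def)
qed

end

section \<open>Integrals of partial derivatives\<close>

lemma norm_qmult: "norm (p \<otimes> q) = norm p * norm q"
proof -
  have "(norm (p \<otimes> q))\<^sup>2 = (norm p * norm q)\<^sup>2"
    unfolding power_mult_distrib norm_quat_squared qmult_nth by algebra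
  then show ?thesis by (simp add: power2_eq_iff_nonneg)
qed

lemma qcnj_nth: "qcnj z $ k = (if k = 0 then z $ 0 else - z $ k)"
  by (simp add: qcnj_def qvec_nth qe_nth)

lemma norm_qcnj [simp]: "norm (qcnj z) = norm z"
proof -
  have "(norm (qcnj z))\<^sup>2 = (norm z)\<^sup>2" unfolding norm_quat_squared by (simp add: qcnj_nth)
  then show ?thesis by (simp add: power2_eq_iff_nonneg)
qed

lemma qcnj_qmult_self: "qcnj z \<otimes> z = (norm z)\<^sup>2 *\<^sub>R qe 0"
  unfolding norm_quat_squared by (simp add: quat_eq_iff qmult_nth qcnj_nth qe_nth power2_eq_square)

definition bounded_lipschitz :: "(quat \<Rightarrow> real) \<Rightarrow> bool" where
  "bounded_lipschitz u \<longleftrightarrow> (\<exists>B. \<forall>x. \<bar>u x\<bar> \<le> B) \<and> (\<exists>L. \<forall>x y. \<bar>u x - u y\<bar> \<le> L * norm (x - y))"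

lemma bounded_lipschitz_mult:
  assumes "bounded_lipschitz u" "bounded_lipschitz w"
  shows "bounded_lipschitz (\<lambda>x. u x * w x)"
proof -
  obtain B L B' L' where u: "\<And>x. \<bar>u x\<bar> \<le> B" "\<And>x y. \<bar>u x - u y\<bar> \<le> L * norm (x - y)"
    and w: "\<And>x. \<bar>w x\<bar> \<le> B'" "\<And>x y. \<bar>w x - w y\<bar> \<le> L' * norm (x - y)"
    using assms unfolding bounded_lipschitz_def by blast
  have B: "0 \<le> B" "0 \<le> B'" using u(1)[of 0] w(1)[of 0] by auto
  have "\<bar>u x * w x\<bar> \<le> B * B'" for x
    unfolding abs_mult using u(1)[of x] w(1)[of x] B by (intro mult_mono) auto
  moreover have "\<bar>u x * w x - u y * w y\<bar> \<le> (L * B' + B * L') * norm (x - y)" for x y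
  proof -
    have "\<bar>u x * w x - u y * w y\<bar> = \<bar>(u x - u y) * w x + u y * (w x - w y)\<bar>" by (simp add: algebra_simps)
    also have "\<dots> \<le> \<bar>u x - u y\<bar> * \<bar>w x\<bar> + \<bar>u y\<bar> * \<bar>w x - w y\<bar>"
      by (metis abs_mult abs_triangle_ineq)
    also have "\<dots> \<le> (L * norm (x - y)) * B' + B * (L' * norm (x - y))"
      using u w B abs_ge_zero order_trans by (intro add_mono mult_mono) blast+
    finally show ?thesis by (simp add: algebra_simps)
  qed
  ultimately show ?thesis unfolding bounded_lipschitz_def by blast
qed

text \<open>
  The partial derivatives are continuous with compact support, hence bounded.
\<close>

lemma bounded_lipschitz_C1_compact:
  assumes "C1_on UNIV u" and supp: "\<And>y. norm y > R \<Longrightarrow> u y = 0"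
  shows "bounded_lipschitz u"
proof -
  have zero: "partial_deriv k u y = 0" if "norm y > R" for k y
  proof -
    have "open {y::quat. R < norm y}" by (intro open_Collect_less continuous_intros)
    then have "partial_deriv k u y = partial_deriv k (\<lambda>y. 0) y"
      by (rule partial_deriv_cong_open) (use that supp in auto)
    then show ?thesis by (simp add: partial_deriv_def)
  qed
  have bdd: "\<exists>B. \<forall>y. \<bar>h y\<bar> \<le> B" if c: "continuous_on UNIV h" and z: "\<And>y. norm y > R \<Longrightarrow> h y = 0" for h :: "quat \<Rightarrow> real"
  proof -
    have "compact (h ` cball 0 R)"
      by (intro compact_continuous_image continuous_on_subset[OF c]) auto
    then obtain B where "\<And>t. t \<in> h ` cball 0 R \<Longrightarrow> \<bar>t\<bar> \<le> B"
      using compact_imp_bounded bounded_real by metis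
    then have "\<bar>h y\<bar> \<le> max B 0" for y
      using z[of y] by (cases "norm y > R") (auto simp: le_max_iff_disj)
    then show ?thesis by blast
  qed
  have "\<forall>k. \<exists>B. \<forall>y. \<bar>partial_deriv k u y\<bar> \<le> B"
    using bdd zero assms(1) by (simp add: C1_on_def)
  then obtain B where B: "\<And>k y. \<bar>partial_deriv k u y\<bar> \<le> B k" by metis
  have "norm (u x - u y) \<le> (\<Sum>k\<in>UNIV. B k) * norm (x - y)" for x y
  proof (rule differentiable_bound[of UNIV u "\<lambda>w v. \<Sum>k\<in>UNIV. partial_deriv k u w * v $ k"])
    fix w
    show "(u has_derivative (\<lambda>v. \<Sum>k\<in>UNIV. partial_deriv k u w * v $ k)) (at w within UNIV)"
      using C1_on_has_derivative[OF assms(1)] by simp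
    show "onorm (\<lambda>v. \<Sum>k\<in>UNIV. partial_deriv k u w * v $ k) \<le> (\<Sum>k\<in>UNIV. B k)"
    proof (rule onorm_le)
      fix v :: quat
      have "norm (\<Sum>k\<in>UNIV. partial_deriv k u w * v $ k) \<le> (\<Sum>k\<in>UNIV. B k * norm v)"
        using B component_le_norm_cart[of v] order_trans[OF abs_ge_zero B]
        by (intro sum_norm_le) (simp only: real_norm_def abs_mult, intro mult_mono, auto)
      then show "norm (\<Sum>k\<in>UNIV. partial_deriv k u w * v $ k) \<le> (\<Sum>k\<in>UNIV. B k) * norm v"
        by (simp add: sum_distrib_right)
    qed
  qed auto
  then show ?thesis
    unfolding bounded_lipschitz_def using bdd[OF C1_on_continuous[OF assms(1)] supp] by auto
qed

lemma integral_lborel_translate: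
  fixes h :: "quat \<Rightarrow> real"
  assumes "h \<in> borel_measurable borel"
  shows "(\<integral>y. h (c + y) \<partial>lborel) = (\<integral>y. h y \<partial>lborel)"
  using assms by (subst (2) lborel_distr_plus[of c, symmetric]) (simp add: integral_distr)

lemma integrable_lborel_translate:
  fixes h :: "quat \<Rightarrow> real"
  assumes "integrable lborel h"
  shows "integrable lborel (\<lambda>y. h (c + y))"
proof -
  have "h \<in> borel_measurable borel" using borel_measurable_integrable[OF assms] by simp
  then show ?thesis using assms
    by (subst integrable_distr_eq[of "(+) c" lborel borel h, symmetric]) (simp_all add: lborel_distr_plus)
qed

lemma integrable_bounded_support:
  fixes h :: "quat \<Rightarrow> real"
  assumes "h \<in> borel_measurable borel" "\<And>y. \<bar>h y\<bar> \<le> B" "\<And>y. norm y > R \<Longrightarrow> h y = 0"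
  shows "integrable lborel h"
proof (rule Bochner_Integration.integrable_bound)
  show "integrable lborel (\<lambda>y. B * indicator (cball 0 R) y :: real)"
    by (intro integrable_mult_right integrable_real_indicator) (use emeasure_bounded_finite[OF bounded_cball] in \<open>auto simp: infinity_ennreal_def\<close>)
  show "AE y in lborel. norm (h y) \<le> norm (B * indicator (cball 0 R) y)"
  proof (rule AE_I2)
    fix y show "norm (h y) \<le> norm (B * indicator (cball 0 R) y)"
      using assms(2)[of y] assms(3)[of y] by (cases "norm y > R") (auto simp: indicator_def)
  qed
qed (use assms in simp)

text \<open>
  By translation invariance every difference quotient of \<open>w\<close> in direction \<open>e\<^sub>k\<close> has integral zero.
  The Lipschitz bound dominates these quotients on a fixed ball, so their limit has integral zero as
  well.  This form of partial integration needs differentiability only almost everywhere, as is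
  required for the truncated kernel, which has a crease along a sphere.
\<close>

lemma integral_partial_deriv_zero:
  assumes lip: "bounded_lipschitz w" and supp: "\<And>y. norm y > R \<Longrightarrow> w y = 0"
    and meas: "w' \<in> borel_measurable borel"
    and der: "AE y in lborel. \<exists>W. (w has_derivative W) (at y) \<and> W (qe k) = w' y"
  shows "integrable lborel w'" and "(\<integral>y. w' y \<partial>lborel) = 0"
proof -
  obtain B L where B: "\<And>y. \<bar>w y\<bar> \<le> B" and L: "\<And>x y. \<bar>w x - w y\<bar> \<le> L * norm (x - y)"
    using lip unfolding bounded_lipschitz_def by blast
  have L0: "L \<ge> 0" using order_trans[OF abs_ge_zero L[of "qe k" 0]] by simp
  have "continuous_on UNIV w"
  proof (rule lipschitz_on_continuous_on)
    show "L-lipschitz_on UNIV w" by (rule lipschitz_onI) (use L L0 in \<open>auto simp: dist_norm\<close>)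
  qed
  then have wm: "w \<in> borel_measurable borel" by (rule borel_measurable_continuous_onI)
  have wi: "integrable lborel w" by (rule integrable_bounded_support[OF wm B supp])
  define t where "t n = 1 / real (Suc n)" for n
  have t: "t n > 0" "t n \<le> 1" for n by (simp_all add: t_def)
  define g where "g n y = (w (t n *\<^sub>R qe k + y) - w y) / t n" for n y
  have gi: "integrable lborel (g n)" for n
    unfolding g_def by (intro Bochner_Integration.integrable_divide Bochner_Integration.integrable_diff integrable_lborel_translate wi)
  have g0: "(\<integral>y. g n y \<partial>lborel) = 0" for n
    unfolding g_def
    by (simp add: Bochner_Integration.integral_diff[OF integrable_lborel_translate[OF wi] wi] integral_lborel_translate[OF wm])
  define b where "b y = L * indicator (cball 0 (\<bar>R\<bar> + 1)) y" for y :: quat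
  have bi: "integrable lborel b" unfolding b_def
    by (intro integrable_mult_right integrable_real_indicator) (use emeasure_bounded_finite[OF bounded_cball] in \<open>auto simp: infinity_ennreal_def\<close>)
  have gb: "norm (g n y) \<le> b y" for n y
  proof (cases "norm y \<le> \<bar>R\<bar> + 1")
    case True
    have "\<bar>w (t n *\<^sub>R qe k + y) - w y\<bar> \<le> L * t n" using L[of "t n *\<^sub>R qe k + y" y] t(1)[of n] by simp
    then have "\<bar>w (t n *\<^sub>R qe k + y) - w y\<bar> / t n \<le> L" using t(1)[of n] by (simp add: pos_divide_le_eq)
    then show ?thesis using True t(1)[of n] by (simp add: g_def b_def)
  next
    case False
    have "norm y \<le> norm (t n *\<^sub>R qe k + y) + norm (t n *\<^sub>R qe k)"
      using norm_triangle_ineq4[of "t n *\<^sub>R qe k + y" "t n *\<^sub>R qe k"] by simp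
    then have "norm (t n *\<^sub>R qe k + y) > R" "norm y > R" using False t[of n] by auto
    then show ?thesis using False by (simp add: g_def b_def supp)
  qed
  have t_lim: "t \<longlonglongrightarrow> 0" unfolding t_def using LIMSEQ_inverse_real_of_nat by (simp add: inverse_eq_divide)
  have lim: "AE y in lborel. (\<lambda>n. g n y) \<longlonglongrightarrow> w' y"
    using der
  proof eventually_elim
    case (elim y)
    then obtain W where W: "(w has_derivative W) (at y)" "W (qe k) = w' y" by blast
    have "((\<lambda>s. w (s *\<^sub>R qe k + y)) has_derivative (\<lambda>s. W (s *\<^sub>R qe k))) (at 0)"
    proof (rule has_derivative_compose[where g=w])
      show "((\<lambda>s. s *\<^sub>R qe k + y) has_derivative (\<lambda>s. s *\<^sub>R qe k)) (at 0)"
        using has_derivative_add[OF has_derivative_scaleR_left[OF has_derivative_ident, of "qe k"] has_derivative_const[of y]] by simp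
      show "(w has_derivative W) (at (0 *\<^sub>R qe k + y))" using W(1) by simp
    qed
    moreover have "(\<lambda>s. W (s *\<^sub>R qe k)) = (*) (w' y)"
      using linear_scale[OF has_derivative_linear[OF W(1)]] W(2) by auto
    ultimately have "((\<lambda>s. w (s *\<^sub>R qe k + y)) has_field_derivative w' y) (at 0)"
      by (simp add: has_field_derivative_def)
    then have "((\<lambda>h. (w ((0 + h) *\<^sub>R qe k + y) - w (0 *\<^sub>R qe k + y)) / h) \<longlongrightarrow> w' y) (at 0)"
      by (simp only: DERIV_def)
    moreover have "filterlim t (at 0) sequentially"
      using t_lim t(1) by (auto simp: filterlim_at intro!: always_eventually less_imp_neq[symmetric])
    ultimately have "(\<lambda>n. (w ((0 + t n) *\<^sub>R qe k + y) - w (0 *\<^sub>R qe k + y)) / t n) \<longlonglongrightarrow> w' y"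
      by (rule filterlim_compose)
    then show ?case by (simp add: g_def)
  qed
  have ms: "w' \<in> borel_measurable lborel" "\<And>n. g n \<in> borel_measurable lborel"
    using meas borel_measurable_integrable[OF gi] by auto
  show "integrable lborel w'"
    by (rule integrable_dominated_convergence[OF ms bi lim]) (use gb in auto)
  have "(\<lambda>n. \<integral>y. g n y \<partial>lborel) \<longlonglongrightarrow> (\<integral>y. w' y \<partial>lborel)"
    by (rule integral_dominated_convergence[OF ms bi lim]) (use gb in auto)
  then show "(\<integral>y. w' y \<partial>lborel) = 0" by (simp add: g0 LIMSEQ_const_iff)
qed

section \<open>The truncated kernel\<close>

text \<open>
  The scalar factor of the Fueter kernel, up to \<open>1/(2\<pi>\<^sup>2)\<close>, frozen inside the ball of radius \<open>\<epsilon>\<close>.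
\<close>

definition cut_kernel :: "real \<Rightarrow> quat \<Rightarrow> real" where
  "cut_kernel \<epsilon> z = 1 / max \<epsilon> (norm z) ^ 4"

text \<open>
  The radial factor in the gradient: \<open>\<nabla> (cut_kernel \<epsilon>) z = cut_slope \<epsilon> z *\<^sub>R z\<close> off the sphere of
  radius \<open>\<epsilon>\<close>.
\<close>

definition cut_slope :: "real \<Rightarrow> quat \<Rightarrow> real" where
  "cut_slope \<epsilon> z = (if norm z < \<epsilon> then 0 else - 4 / norm z ^ 6)"

lemma cut_kernel_bounded_lipschitz:
  assumes "\<epsilon> > 0"
  shows "bounded_lipschitz (\<lambda>y. cut_kernel \<epsilon> (x - y))"
proof -
  define u where "u y = 1 / max \<epsilon> (norm (x - y))" for y
  have "bounded_lipschitz u"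
    unfolding bounded_lipschitz_def
  proof (intro conjI exI allI)
    fix y
    show "\<bar>u y\<bar> \<le> 1 / \<epsilon>" using assms by (auto simp: u_def intro!: divide_left_mono)
  next
    fix y y'
    define a b where "a = max \<epsilon> (norm (x - y))" and "b = max \<epsilon> (norm (x - y'))"
    have ab: "a \<ge> \<epsilon>" "b \<ge> \<epsilon>" "a > 0" "b > 0" using assms by (auto simp: a_def b_def)
    have "\<bar>b - a\<bar> \<le> \<bar>norm (x - y') - norm (x - y)\<bar>" by (auto simp: a_def b_def max_def)
    also have "\<dots> \<le> norm (y - y')" using norm_triangle_ineq3[of "x - y'" "x - y"] by simp
    finally have 1: "\<bar>b - a\<bar> \<le> norm (y - y')" .
    have "u y - u y' = (b - a) / (a * b)" using ab by (simp add: u_def field_simps flip: a_def b_def)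
    then have "\<bar>u y - u y'\<bar> = \<bar>b - a\<bar> / (a * b)" using ab by simp
    also have "\<dots> \<le> norm (y - y') / (\<epsilon> * \<epsilon>)"
      using 1 ab assms by (intro frac_le mult_mono) auto
    finally show "\<bar>u y - u y'\<bar> \<le> 1 / (\<epsilon> * \<epsilon>) * norm (y - y')" by simp
  qed
  then have "bounded_lipschitz (\<lambda>y. (u y * u y) * (u y * u y))"
    by (intro bounded_lipschitz_mult)
  then show ?thesis by (simp add: u_def cut_kernel_def power4_eq_xxxx mult.assoc)
qed

lemma cut_kernel_has_derivative:
  assumes "\<epsilon> > 0" "norm z \<noteq> \<epsilon>"
  shows "(cut_kernel \<epsilon> has_derivative (\<lambda>v. cut_slope \<epsilon> z * (z \<bullet> v))) (at z)"
proof (cases "norm z < \<epsilon>")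
  case True
  have "((\<lambda>z. 1 / \<epsilon> ^ 4) has_derivative (\<lambda>v. cut_slope \<epsilon> z * (z \<bullet> v))) (at z)"
    using True by (simp add: cut_slope_def)
  then show ?thesis
    by (rule has_derivative_transform_within_open[of _ _ _ _ "ball 0 \<epsilon>"]) (use True in \<open>auto simp: cut_kernel_def max_def\<close>)
next
  case False
  then have z: "norm z > \<epsilon>" "z \<noteq> 0" using assms by auto
  note D = has_derivative_inverse_norm_square[OF z(2)]
  have "((\<lambda>z. 1 / (norm z)\<^sup>2 * (1 / (norm z)\<^sup>2)) has_derivative (\<lambda>v. cut_slope \<epsilon> z * (z \<bullet> v))) (at z)"
  proof (rule has_derivative_eq_rhs[OF has_derivative_mult[OF D D]], intro ext)
    fix v
    have "(\<Sum>i\<in>UNIV. - 2 * (z $ i * (1 / (norm z)\<^sup>2 * (1 / (norm z)\<^sup>2))) * v $ i) = (- 2 / norm z ^ 4) * (z \<bullet> v)"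
      unfolding inner_vec_def sum_distrib_left by (rule sum.cong) (simp_all add: power_add[symmetric])
    then show "1 / (norm z)\<^sup>2 * (\<Sum>i\<in>UNIV. - 2 * (z $ i * (1 / (norm z)\<^sup>2 * (1 / (norm z)\<^sup>2))) * v $ i) +
         (\<Sum>i\<in>UNIV. - 2 * (z $ i * (1 / (norm z)\<^sup>2 * (1 / (norm z)\<^sup>2))) * v $ i) * (1 / (norm z)\<^sup>2) = cut_slope \<epsilon> z * (z \<bullet> v)"
      using False by (simp add: cut_slope_def power_add[symmetric])
  qed
  then show ?thesis
  proof (rule has_derivative_transform_within_open[of _ _ _ _ "- cball 0 \<epsilon>"])
    show "open (- cball 0 \<epsilon> :: quat set)" by (simp add: open_Compl)
  qed (use z in \<open>auto simp: cut_kernel_def max_def power_add[symmetric]\<close>)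
qed

lemma AE_off_sphere: "AE y in lborel. norm (x - y) \<noteq> \<epsilon>" for x :: quat
proof (rule AE_I')
  have "emeasure lebesgue (sphere x \<epsilon>) = 0"
    using negligible_sphere[of x \<epsilon>] by (simp add: negligible_iff_emeasure0)
  then show "sphere x \<epsilon> \<in> null_sets lborel" by (simp add: null_sets_def)
qed (auto simp: dist_norm)

text \<open>
  Summing the vanishing integrals of \<open>\<partial>\<^sub>k (m qcnj z e\<^sub>k F)\<close> over \<open>k\<close>, with \<open>m\<close> the truncated scalar
  factor and \<open>z = x - y\<close>, gives \<open>m qcnj z (D F)\<close> minus a multiple \<open>4 m + \<mu> |z|\<^sup>2\<close> of \<open>F\<close>, where \<open>\<mu>\<close> is
  the slope.  The coefficient arises from \<open>qcnj e\<^sub>k e\<^sub>k = 1\<close> and \<open>qcnj z z = |z|\<^sup>2\<close>; it vanishes outside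
  the ball of radius \<open>\<epsilon>\<close> and is \<open>4/\<epsilon>\<^sup>4\<close> inside.
\<close>

lemma cut_kernel_integral_identity:
  fixes F :: "quat \<Rightarrow> quat"
  assumes eps: "\<epsilon> > 0" and C1: "\<And>j. C1_on UNIV (\<lambda>y. F y $ j)" and supp: "\<And>y. norm y > R \<Longrightarrow> F y = 0"
  shows "(\<integral>y. cut_kernel \<epsilon> (x - y) * (qcnj (x - y) \<otimes> fueter F y) $ a \<partial>lborel)
     = 4 / \<epsilon> ^ 4 * (\<integral>y. indicator (ball x \<epsilon>) y * F y $ a \<partial>lborel)"
proof -
  define dF where "dF k y = (\<chi> j. partial_deriv k (\<lambda>y. F y $ j) y)" for k y
  have fD: "fueter F y = (\<Sum>k\<in>UNIV. qe k \<otimes> dF k y)" for y by (simp add: fueter_def dF_def)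
  have dFc: "continuous_on UNIV (dF k)" for k
    unfolding dF_def using C1 by (intro continuous_on_vec_lambda) (simp add: C1_on_def)
  have Fc: "continuous_on UNIV F"
    using continuous_on_vec_lambda[of UNIV "\<lambda>j y. F y $ j"] C1_on_continuous[OF C1] by simp
  have cF: "C1_on UNIV (\<lambda>y. (qcnj (x - y) \<otimes> (qe k \<otimes> F y)) $ a)" for k a
  proof (intro C1_on_qmult C1_on_const C1)
    fix j
    have "C1_on UNIV (\<lambda>y. x $ j - y $ j)" by (intro C1_on_diff C1_on_const C1_on_coord)
    then show "C1_on UNIV (\<lambda>y. qcnj (x - y) $ j)"
      using C1_on_minus by (cases "j = 0") (auto simp: qcnj_nth simp del: minus_diff_eq)
  qed
  define G where "G k y = (qcnj (x - y) \<otimes> (qe k \<otimes> F y)) $ a" for k y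
  define w where "w k y = cut_kernel \<epsilon> (x - y) * G k y" for k y
  define w' where "w' k y = cut_kernel \<epsilon> (x - y) * (qcnj (x - y) \<otimes> (qe k \<otimes> dF k y) - F y) $ a
     - cut_slope \<epsilon> (x - y) * (x - y) $ k * G k y" for k y
  have Fd: "(F has_derivative (\<lambda>v. \<Sum>k\<in>UNIV. (v $ k) *\<^sub>R dF k y)) (at y)" for y
  proof -
    have "((\<lambda>y. F y $ j) has_derivative (\<lambda>v. (\<Sum>k\<in>UNIV. (v $ k) *\<^sub>R dF k y) $ j)) (at y)" for j
      using C1_on_has_derivative[OF C1, of y j] by (simp add: dF_def mult.commute)
    then show ?thesis
      by (subst has_derivative_componentwise_within) (auto simp: Basis_vec_def inner_axis)
  qed
  have wd: "\<exists>W. (w k has_derivative W) (at y) \<and> W (qe k) = w' k y" if y: "norm (x - y) \<noteq> \<epsilon>" for k y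
  proof -
    have 1: "((\<lambda>y. cut_kernel \<epsilon> (x - y)) has_derivative (\<lambda>v. cut_slope \<epsilon> (x - y) * ((x - y) \<bullet> (- v)))) (at y)"
    proof -
      have "((\<lambda>y. x - y) has_derivative uminus) (at y)"
        using has_derivative_diff[OF has_derivative_const[of x] has_derivative_ident] by simp
      from has_derivative_compose[where f="\<lambda>y. x - y", OF this cut_kernel_has_derivative[OF eps y]]
      show ?thesis .
    qed
    have lc: "bounded_linear qcnj"
    proof -
      have "linear qcnj" by (rule linearI) (simp_all add: quat_eq_iff qcnj_nth)
      then show ?thesis by (simp add: linear_conv_bounded_linear)
    qed
    have 2: "((\<lambda>y. qcnj (x - y)) has_derivative (\<lambda>v. - qcnj v)) (at y)"
      using bounded_linear.has_derivative[OF lc has_derivative_diff[OF has_derivative_const[of x] has_derivative_ident]]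
        linear_neg[OF bounded_linear.linear[OF lc]] by simp
    have 3: "((\<lambda>y. qe k \<otimes> F y) has_derivative (\<lambda>v. qe k \<otimes> (\<Sum>k\<in>UNIV. (v $ k) *\<^sub>R dF k y))) (at y)"
      by (rule bounded_linear.has_derivative[OF bounded_bilinear.bounded_linear_right[OF bounded_bilinear_qmult] Fd])
    have "(G k has_derivative (\<lambda>v. (qcnj (x - y) \<otimes> (qe k \<otimes> (\<Sum>k\<in>UNIV. (v $ k) *\<^sub>R dF k y)) + (- qcnj v) \<otimes> (qe k \<otimes> F y)) $ a)) (at y)"
      unfolding G_def
      by (rule bounded_linear.has_derivative[OF bounded_linear_vec_nth bounded_bilinear.FDERIV[OF bounded_bilinear_qmult 2 3]])
    from has_derivative_mult[OF 1 this]
    have W: "(w k has_derivative (\<lambda>v. cut_kernel \<epsilon> (x - y) * (qcnj (x - y) \<otimes> (qe k \<otimes> (\<Sum>k\<in>UNIV. (v $ k) *\<^sub>R dF k y)) + (- qcnj v) \<otimes> (qe k \<otimes> F y)) $ a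
        + cut_slope \<epsilon> (x - y) * ((x - y) \<bullet> (- v)) * G k y)) (at y)"
      unfolding w_def .
    have "(\<Sum>m\<in>UNIV. (qe k $ m) *\<^sub>R dF m y) = (\<Sum>m\<in>UNIV. if m = k then dF m y else 0)"
      by (rule sum.cong) (auto simp: qe_nth)
    then have s: "(\<Sum>m\<in>UNIV. (qe k $ m) *\<^sub>R dF m y) = dF k y" by simp
    have "qcnj (qe k) \<otimes> (qe k \<otimes> F y) = F y"
      by (simp add: qcnj_qmult_self qmult_one flip: qmult_assoc)
    moreover have "(x - y) \<bullet> (- qe k) = - (x - y) $ k"
      by (simp add: qe_def inner_axis)
    ultimately show ?thesis
      by - (rule exI, rule conjI, rule W, simp add: w'_def s qmult_minus del: minus_diff_eq)
  qed
  have meas_slope: "(\<lambda>y. cut_slope \<epsilon> (x - y)) \<in> borel_measurable borel"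
    unfolding cut_slope_def by measurable
  have meas_kernel: "(\<lambda>y. cut_kernel \<epsilon> (x - y)) \<in> borel_measurable borel"
    unfolding cut_kernel_def by measurable
  have w'm: "w' k \<in> borel_measurable borel" for k
  proof -
    have "G k \<in> borel_measurable borel" unfolding G_def
      by (intro borel_measurable_continuous_onI C1_on_continuous cF)
    moreover have "(\<lambda>y. (qcnj (x - y) \<otimes> (qe k \<otimes> dF k y) - F y) $ a) \<in> borel_measurable borel"
      unfolding qcnj_def qvec_def
      by (intro borel_measurable_continuous_onI continuous_intros bounded_bilinear.continuous_on[OF bounded_bilinear_qmult] dFc Fc)
    moreover have "(\<lambda>y. (x - y) $ k) \<in> borel_measurable borel"
      by (intro borel_measurable_continuous_onI continuous_intros)
    ultimately show ?thesis unfolding w'_def using meas_slope meas_kernel by simp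
  qed
  have wl: "bounded_lipschitz (w k)" for k
    unfolding w_def G_def
    by (intro bounded_lipschitz_mult cut_kernel_bounded_lipschitz eps bounded_lipschitz_C1_compact[OF cF, of R]) (simp add: supp)
  have ws: "w k y = 0" if "norm y > R" for k y using supp[OF that] by (simp add: w_def G_def)
  have wAE: "AE y in lborel. \<exists>W. (w k has_derivative W) (at y) \<and> W (qe k) = w' k y" for k
    using AE_off_sphere[of x \<epsilon>] by eventually_elim (rule wd)
  have w'i: "integrable lborel (w' k)" and w'0: "(\<integral>y. w' k y \<partial>lborel) = 0" for k
    using integral_partial_deriv_zero[OF wl ws w'm wAE] by auto
  have sum: "(\<Sum>k\<in>UNIV. w' k y) = cut_kernel \<epsilon> (x - y) * (qcnj (x - y) \<otimes> fueter F y) $ a - 4 / \<epsilon> ^ 4 * (indicator (ball x \<epsilon>) y * F y $ a)" for y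
  proof -
    define z where "z = x - y"
    define m where "m = cut_kernel \<epsilon> z"
    define s where "s = cut_slope \<epsilon> z"
    have a1: "(\<Sum>k\<in>UNIV. z $ k * G k y) = (norm z)\<^sup>2 * F y $ a"
    proof -
      have "(\<Sum>k\<in>UNIV. z $ k * G k y) = (\<Sum>k\<in>UNIV. (qcnj z \<otimes> ((z $ k *\<^sub>R qe k) \<otimes> F y)) $ a)"
        by (simp add: G_def z_def qmult_scaleR)
      also have "\<dots> = (qcnj z \<otimes> ((\<Sum>k\<in>UNIV. z $ k *\<^sub>R qe k) \<otimes> F y)) $ a"
        by (simp add: bounded_bilinear.sum_left[OF bounded_bilinear_qmult] bounded_bilinear.sum_right[OF bounded_bilinear_qmult])
      also have "\<dots> = (norm z)\<^sup>2 * F y $ a"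
        by (simp add: qcnj_qmult_self qmult_scaleR qmult_one flip: quat_expand qmult_assoc)
      finally show ?thesis .
    qed
    have a2: "(\<Sum>k\<in>UNIV. (qcnj z \<otimes> (qe k \<otimes> dF k y) - F y) $ a) = (qcnj z \<otimes> fueter F y) $ a - 4 * F y $ a"
      by (simp add: fD sum_subtractf bounded_bilinear.sum_right[OF bounded_bilinear_qmult])
    have "(\<Sum>k\<in>UNIV. w' k y) = m * (\<Sum>k\<in>UNIV. (qcnj z \<otimes> (qe k \<otimes> dF k y) - F y) $ a) - s * (\<Sum>k\<in>UNIV. z $ k * G k y)"
      unfolding w'_def m_def s_def z_def sum_distrib_left by (simp only: sum_subtractf mult.assoc)
    also have "\<dots> = m * (qcnj z \<otimes> fueter F y) $ a - (4 * m + s * (norm z)\<^sup>2) * F y $ a"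
      unfolding a1 a2 by (simp add: algebra_simps)
    also have "4 * m + s * (norm z)\<^sup>2 = 4 / \<epsilon> ^ 4 * indicator (ball x \<epsilon>) y"
    proof (cases "norm z < \<epsilon>")
      case True
      then show ?thesis by (simp add: m_def s_def cut_kernel_def cut_slope_def z_def dist_norm max_def)
    next
      case False
      then have "norm z > 0" using eps by linarith
      have p: "norm z ^ 6 = norm z ^ 4 * (norm z)\<^sup>2" by (simp add: power_add[symmetric])
      have "4 / norm z ^ 4 = 4 * (norm z)\<^sup>2 / norm z ^ 6"
        unfolding p using \<open>norm z > 0\<close> by (intro nonzero_mult_divide_mult_cancel_right[symmetric]) auto
      then show ?thesis using False unfolding z_def
        by (simp add: m_def s_def cut_kernel_def cut_slope_def z_def dist_norm max_def)
    qed
    finally show ?thesis by (simp add: m_def z_def)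
  qed
  have bi: "integrable lborel (\<lambda>y. indicator (ball x \<epsilon>) y * F y $ a)"
  proof -
    obtain B where "\<And>y. \<bar>F y $ a\<bar> \<le> B"
      using bounded_lipschitz_C1_compact[OF C1, of R a] supp unfolding bounded_lipschitz_def by auto
    moreover have "(\<lambda>y. F y $ a) \<in> borel_measurable borel"
      by (intro borel_measurable_continuous_onI C1_on_continuous C1)
    moreover have "B \<ge> 0" using order_trans[OF abs_ge_zero calculation(1)[of 0]] .
    ultimately show ?thesis
      by (intro integrable_bounded_support[of _ B R]) (auto simp: supp indicator_def)
  qed
  have "(\<integral>y. (\<Sum>k\<in>UNIV. w' k y) \<partial>lborel) = 0"
    by (subst Bochner_Integration.integral_sum[OF w'i]) (simp add: w'0)
  moreover have "integrable lborel (\<lambda>y. cut_kernel \<epsilon> (x - y) * (qcnj (x - y) \<otimes> fueter F y) $ a)"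
  proof -
    have "integrable lborel (\<lambda>y. (\<Sum>k\<in>UNIV. w' k y) + 4 / \<epsilon> ^ 4 * (indicator (ball x \<epsilon>) y * F y $ a))"
      by (intro Bochner_Integration.integrable_add Bochner_Integration.integrable_sum w'i integrable_mult_right bi)
    then show ?thesis unfolding sum by simp
  qed
  ultimately show ?thesis
    unfolding sum by (simp only: Bochner_Integration.integral_diff integrable_mult_right bi integral_mult_right_zero)
qed

section \<open>The Cauchy--Pompeiu formula\<close>

lemma content_ball_quat: "r \<ge> 0 \<Longrightarrow> measure lborel (ball (c::quat) r) = pi\<^sup>2 / 2 * r ^ 4"
  using content_ball[of r c] by (simp add: eval_unit_ball_vol)

text \<open>
  The factor \<open>2\<pi>\<^sup>2\<close> is four times the volume of the unit ball.
\<close>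

lemma ball_average_tendsto:
  fixes h :: "quat \<Rightarrow> real"
  assumes c: "continuous_on UNIV h" and t: "\<And>n. t n > 0" "t \<longlonglongrightarrow> 0"
  shows "(\<lambda>n. 4 / t n ^ 4 * (\<integral>y. indicator (ball x (t n)) y * h y \<partial>lborel)) \<longlonglongrightarrow> 2 * pi\<^sup>2 * h x"
proof (rule LIMSEQ_I)
  fix e :: real assume e: "e > 0"
  define \<eta> where "\<eta> = e / (4 * pi\<^sup>2)"
  have \<eta>: "\<eta> > 0" using e by (simp add: \<eta>_def)
  have "isCont h x" using c by (simp add: continuous_on_eq_continuous_at)
  then obtain d where d: "d > 0" "\<And>y. dist y x < d \<Longrightarrow> dist (h y) (h x) < \<eta>"
    using \<eta> unfolding continuous_at_eps_delta by blast
  obtain N where N: "\<And>n. n \<ge> N \<Longrightarrow> \<bar>t n\<bar> < d" using LIMSEQ_D[OF t(2) d(1)] by auto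
  show "\<exists>N. \<forall>n\<ge>N. norm (4 / t n ^ 4 * (\<integral>y. indicator (ball x (t n)) y * h y \<partial>lborel) - 2 * pi\<^sup>2 * h x) < e"
  proof (intro exI allI impI)
    fix n assume n: "n \<ge> N"
    define r where "r = t n"
    have r: "r > 0" "r < d" using t(1)[of n] N[OF n] by (auto simp: r_def)
    have fin: "emeasure lborel (ball x r) < \<infinity>" using emeasure_bounded_finite[OF bounded_ball] .
    have i1: "integrable lborel (\<lambda>y. indicator (ball x r) y * K)" for K :: real
      by (intro integrable_mult_left integrable_real_indicator) (use fin in auto)
    have bd: "\<bar>h y - h x\<bar> \<le> \<eta>" if "y \<in> ball x r" for y
      using d(2)[of y] that r by (auto simp: dist_commute dist_real_def less_imp_le)
    have i2: "integrable lborel (\<lambda>y. indicator (ball x r) y * (h y - h x))"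
    proof (rule Bochner_Integration.integrable_bound[OF i1[of \<eta>]])
      show "(\<lambda>y. indicator (ball x r) y * (h y - h x)) \<in> borel_measurable lborel"
        using borel_measurable_continuous_onI[OF c]
        by (intro borel_measurable_times borel_measurable_indicator borel_measurable_diff borel_measurable_const) auto
      show "AE y in lborel. norm (indicator (ball x r) y * (h y - h x)) \<le> norm (indicator (ball x r) y * \<eta>)"
        using bd \<eta> by (intro AE_I2) (auto simp: indicator_def)
    qed
    have ic: "(\<integral>y. indicator (ball x r) y * K \<partial>lborel) = pi\<^sup>2 / 2 * r ^ 4 * K" for K
      using r by (simp add: content_ball_quat)
    have "(\<integral>y. indicator (ball x r) y * h y \<partial>lborel) = (\<integral>y. indicator (ball x r) y * (h y - h x) + indicator (ball x r) y * h x \<partial>lborel)"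
      by (rule Bochner_Integration.integral_cong) (auto simp: algebra_simps)
    also have "\<dots> = (\<integral>y. indicator (ball x r) y * (h y - h x) \<partial>lborel) + pi\<^sup>2 / 2 * r ^ 4 * h x"
      by (simp only: Bochner_Integration.integral_add[OF i2 i1] ic)
    finally have "4 / r ^ 4 * (\<integral>y. indicator (ball x r) y * h y \<partial>lborel) - 2 * pi\<^sup>2 * h x
       = 4 / r ^ 4 * (\<integral>y. indicator (ball x r) y * (h y - h x) \<partial>lborel)"
      using r by (simp add: distrib_left)
    moreover have "\<bar>\<integral>y. indicator (ball x r) y * (h y - h x) \<partial>lborel\<bar> \<le> pi\<^sup>2 / 2 * r ^ 4 * \<eta>"
      unfolding ic[symmetric] real_norm_def[symmetric]
      by (rule Bochner_Integration.integral_norm_bound_integral[OF i2 i1]) (use bd \<eta> in \<open>auto simp: indicator_def\<close>)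
    ultimately have "norm (4 / r ^ 4 * (\<integral>y. indicator (ball x r) y * h y \<partial>lborel) - 2 * pi\<^sup>2 * h x) \<le> 4 / r ^ 4 * (pi\<^sup>2 / 2 * r ^ 4 * \<eta>)"
      using r by (simp only: real_norm_def abs_mult) (intro mult_mono, auto)
    also have "\<dots> = 2 * pi\<^sup>2 * \<eta>" using r by simp
    also have "\<dots> < e" using e by (simp add: \<eta>_def)
    finally show "norm (4 / t n ^ 4 * (\<integral>y. indicator (ball x (t n)) y * h y \<partial>lborel) - 2 * pi\<^sup>2 * h x) < e" by (simp add: r_def)
  qed
qed

text \<open>
  Within distance one of \<open>x\<close> the singularity is the profile; farther out it is at most one.
\<close>

lemma kernel_times_bounded_integrable:
  fixes h :: "quat \<Rightarrow> real"
  assumes "h \<in> borel_measurable borel" "\<And>y. \<bar>h y\<bar> \<le> B" "\<And>y. norm y > R \<Longrightarrow> h y = 0"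
  shows "integrable lborel (\<lambda>y. \<bar>h y\<bar> / norm (x - y) ^ 3)"
proof (rule Bochner_Integration.integrable_bound)
  show "integrable lborel (\<lambda>y. B * decay_profile (x - y) + \<bar>h y\<bar>)"
    by (intro Bochner_Integration.integrable_add integrable_mult_right integrable_lborel_reflect decay_profile_integrable
        integrable_abs integrable_bounded_support[OF assms])
  show "(\<lambda>y. \<bar>h y\<bar> / norm (x - y) ^ 3) \<in> borel_measurable lborel" using assms(1) by simp
  have B: "B \<ge> 0" using order_trans[OF abs_ge_zero assms(2)] by blast
  show "AE y in lborel. norm (\<bar>h y\<bar> / norm (x - y) ^ 3) \<le> norm (B * decay_profile (x - y) + \<bar>h y\<bar>)"
  proof (rule AE_I2)
    fix y
    define n where "n = norm (x - y)"
    have m0: "decay_profile (x - y) \<ge> 0" by (simp add: decay_profile_def)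
    have "\<bar>h y\<bar> / n ^ 3 \<le> B * decay_profile (x - y) + \<bar>h y\<bar>"
    proof (cases "n \<ge> 1")
      case True
      then have "\<bar>h y\<bar> / n ^ 3 \<le> \<bar>h y\<bar> / 1" by (intro divide_left_mono) auto
      then show ?thesis using B m0 by (smt (verit) div_by_1 mult_nonneg_nonneg)
    next
      case False
      show ?thesis
      proof (cases "n = 0")
        case True then show ?thesis using B m0 by simp
      next
        case n0: False
        have n: "n > 0" using n0 by (simp add: n_def)
        have "n ^ 6 \<le> n ^ 3" using False n by (intro power_decreasing) auto
        then have "1 / n ^ 3 \<le> 1 / n ^ 6" using n by (intro divide_left_mono) auto
        then have m: "decay_profile (x - y) = 1 / n ^ 3" by (simp add: decay_profile_def n_def)
        have "\<bar>h y\<bar> / n ^ 3 \<le> B / n ^ 3" using assms(2)[of y] n by (intro divide_right_mono) auto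
        then show ?thesis by (simp add: m)
      qed
    qed
    then show "norm (\<bar>h y\<bar> / norm (x - y) ^ 3) \<le> norm (B * decay_profile (x - y) + \<bar>h y\<bar>)"
      using B m0 by (simp add: n_def)
  qed
qed

lemma fueter_C1_compact:
  fixes F :: "quat \<Rightarrow> quat"
  assumes C1: "\<And>j. C1_on UNIV (\<lambda>y. F y $ j)" and supp: "\<And>y. norm y > R \<Longrightarrow> F y = 0"
  shows "continuous_on UNIV (fueter F)"
    and "\<And>y. norm y > R \<Longrightarrow> fueter F y = 0"
    and "\<exists>B. \<forall>y. norm (fueter F y) \<le> B"
proof -
  have "continuous_on UNIV (\<lambda>y. \<chi> j. partial_deriv k (\<lambda>y. F y $ j) y)" for k
    using C1 by (intro continuous_on_vec_lambda) (simp add: C1_on_def)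
  then show c: "continuous_on UNIV (fueter F)" unfolding fueter_def
    by (intro continuous_on_sum bounded_bilinear.continuous_on[OF bounded_bilinear_qmult] continuous_on_const)
  have Qs: "fueter F y = 0" if "norm y > R" for y
  proof -
    have "open {y::quat. R < norm y}" by (intro open_Collect_less continuous_intros)
    then have "partial_deriv k (\<lambda>y. F y $ j) y = partial_deriv k (\<lambda>y. 0) y" for j k
      by (rule partial_deriv_cong_open) (use that supp in auto)
    moreover have "(\<chi> j. 0) = (0::quat)" by (simp add: vec_eq_iff)
    ultimately show ?thesis by (simp add: fueter_def partial_deriv_def)
  qed
  then show "norm y > R \<Longrightarrow> fueter F y = 0" for y .
  have "compact (fueter F ` cball 0 R)" by (intro compact_continuous_image continuous_on_subset[OF c]) auto
  then obtain B where "\<And>q. q \<in> fueter F ` cball 0 R \<Longrightarrow> norm q \<le> B" using compact_imp_bounded bounded_iff by metis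
  then have "norm (fueter F y) \<le> max B 0" for y
    using Qs[of y] by (cases "norm y > R") (auto simp: le_max_iff_disj)
  then show "\<exists>B. \<forall>y. norm (fueter F y) \<le> B" by blast
qed

text \<open>
  Let the truncation radius tend to zero: the truncated kernels are dominated by \<open>|x-y|\<^sup>-\<^sup>3\<close>, which is
  integrable against the bounded compactly supported \<open>fueter F\<close>, and the mean values over the
  shrinking balls converge to \<open>F x\<close>.
\<close>

lemma cauchy_pompeiu:
  fixes F :: "quat \<Rightarrow> quat"
  assumes C1: "\<And>j. C1_on UNIV (\<lambda>y. F y $ j)" and supp: "\<And>y. norm y > R \<Longrightarrow> F y = 0"
  shows "integrable lborel (\<lambda>y. fueter_kernel (x - y) \<otimes> fueter F y)"
    and "(\<integral>y. fueter_kernel (x - y) \<otimes> fueter F y \<partial>lborel) = F x"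
proof -
  define Q where "Q = fueter F"
  have Qc: "continuous_on UNIV Q" and Qs: "\<And>y. norm y > R \<Longrightarrow> Q y = 0"
    unfolding Q_def using fueter_C1_compact[OF C1 supp] by auto
  obtain B where B: "norm (Q y) \<le> B" for y
    unfolding Q_def using fueter_C1_compact(3)[OF C1 supp] by blast
  have dom: "integrable lborel (\<lambda>y. norm (Q y) / norm (x - y) ^ 3)"
    using kernel_times_bounded_integrable[of "\<lambda>y. norm (Q y)" B R x] B Qs borel_measurable_continuous_onI[OF Qc] by simp
  have qc: "continuous_on UNIV (\<lambda>y. qcnj (x - y) \<otimes> Q y)"
    unfolding qcnj_def qvec_def by (intro continuous_intros bounded_bilinear.continuous_on[OF bounded_bilinear_qmult] Qc)
  have qm: "(\<lambda>y. qcnj (x - y) \<otimes> Q y) \<in> borel_measurable borel" by (rule borel_measurable_continuous_onI[OF qc])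
  have K: "fueter_kernel (x - y) \<otimes> Q y = (1 / (2 * pi\<^sup>2)) *\<^sub>R ((1 / norm (x - y) ^ 4) *\<^sub>R (qcnj (x - y) \<otimes> Q y))" for y
    by (simp add: fueter_kernel_def qmult_scaleR)
  have qb: "norm ((1 / norm (x - y) ^ 4) *\<^sub>R (qcnj (x - y) \<otimes> Q y)) \<le> norm (Q y) / norm (x - y) ^ 3" for y
    by (cases "x = y") (simp_all add: norm_qmult field_simps eval_nat_numeral)
  have "integrable lborel (\<lambda>y. (1 / norm (x - y) ^ 4) *\<^sub>R (qcnj (x - y) \<otimes> Q y))"
    by (rule Bochner_Integration.integrable_bound[OF dom]) (use qm qb in auto)
  then show int: "integrable lborel (\<lambda>y. fueter_kernel (x - y) \<otimes> fueter F y)"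
    unfolding Q_def[symmetric] K by (intro integrable_scaleR_right)
  define t where "t n = 1 / real (Suc n)" for n
  have t: "t n > 0" for n by (simp add: t_def)
  have t_lim: "t \<longlonglongrightarrow> 0" unfolding t_def using LIMSEQ_inverse_real_of_nat by (simp add: inverse_eq_divide)
  have "(\<integral>y. fueter_kernel (x - y) \<otimes> Q y \<partial>lborel) $ a = F x $ a" for a
  proof -
    define g where "g n y = cut_kernel (t n) (x - y) * (qcnj (x - y) \<otimes> Q y) $ a" for n y
    define g' where "g' y = 1 / norm (x - y) ^ 4 * (qcnj (x - y) \<otimes> Q y) $ a" for y
    have qam: "(\<lambda>y. (qcnj (x - y) \<otimes> Q y) $ a) \<in> borel_measurable borel"
      by (intro borel_measurable_continuous_onI continuous_intros qc)
    have gm: "g n \<in> borel_measurable lborel" for n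
      unfolding g_def cut_kernel_def using qam by simp
    have g'm: "g' \<in> borel_measurable lborel" unfolding g'_def using qam by simp
    have lim: "AE y in lborel. (\<lambda>n. g n y) \<longlonglongrightarrow> g' y"
      using AE_lborel_singleton[of x]
    proof eventually_elim
      case (elim y)
      have "(\<lambda>n. cut_kernel (t n) (x - y)) \<longlonglongrightarrow> 1 / max 0 (norm (x - y)) ^ 4"
        unfolding cut_kernel_def using elim by (intro tendsto_intros t_lim) auto
      then show ?case unfolding g_def g'_def by (intro tendsto_intros) simp
    qed
    have gb: "norm (g n y) \<le> norm (Q y) / norm (x - y) ^ 3" if "y \<noteq> x" for n y
    proof -
      have "norm (g n y) \<le> cut_kernel (t n) (x - y) * norm (qcnj (x - y) \<otimes> Q y)"
        unfolding g_def using component_le_norm_cart[of "qcnj (x - y) \<otimes> Q y" a] t[of n]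
        by (simp add: abs_mult cut_kernel_def divide_right_mono)
      also have "\<dots> \<le> 1 / norm (x - y) ^ 4 * norm (qcnj (x - y) \<otimes> Q y)"
        unfolding cut_kernel_def using that t[of n]
        by (intro mult_right_mono divide_left_mono power_mono) auto
      also have "\<dots> \<le> norm (Q y) / norm (x - y) ^ 3" using qb[of y] by simp
      finally show ?thesis .
    qed
    have "AE y in lborel. norm (g n y) \<le> norm (Q y) / norm (x - y) ^ 3" for n
      using AE_lborel_singleton[of x] by eventually_elim (rule gb)
    then have "(\<lambda>n. \<integral>y. g n y \<partial>lborel) \<longlonglongrightarrow> (\<integral>y. g' y \<partial>lborel)"
      by (intro integral_dominated_convergence[OF g'm gm dom lim])
    moreover have "(\<integral>y. g n y \<partial>lborel) = 4 / t n ^ 4 * (\<integral>y. indicator (ball x (t n)) y * F y $ a \<partial>lborel)" for n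
      unfolding g_def Q_def by (rule cut_kernel_integral_identity[OF t C1 supp])
    then have "(\<lambda>n. \<integral>y. g n y \<partial>lborel) \<longlonglongrightarrow> 2 * pi\<^sup>2 * F x $ a"
      by (simp only:) (rule ball_average_tendsto[OF C1_on_continuous[OF C1] t t_lim])
    ultimately have "(\<integral>y. g' y \<partial>lborel) = 2 * pi\<^sup>2 * F x $ a" by (rule LIMSEQ_unique)
    moreover have "(\<integral>y. fueter_kernel (x - y) \<otimes> Q y \<partial>lborel) $ a = (\<integral>y. (fueter_kernel (x - y) \<otimes> Q y) $ a \<partial>lborel)"
      using integral_bounded_linear[OF bounded_linear_vec_nth int, of a] by (simp add: Q_def)
    moreover have "(fueter_kernel (x - y) \<otimes> Q y) $ a = 1 / (2 * pi\<^sup>2) * g' y" for y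
      by (simp add: K g'_def)
    ultimately show ?thesis by simp
  qed
  then show "(\<integral>y. fueter_kernel (x - y) \<otimes> fueter F y \<partial>lborel) = F x"
    by (simp add: vec_eq_iff Q_def)
qed

section \<open>Harmonic potentials of the Fueter kernel\<close>

lemma partial_deriv_add:
  assumes "u differentiable (at x)" "w differentiable (at x)"
  shows "partial_deriv k (\<lambda>y. u y + w y) x = partial_deriv k u x + partial_deriv k w x"
  using has_derivative_add[OF differentiable_has_derivative_partials[OF assms(1)] differentiable_has_derivative_partials[OF assms(2)], THEN partial_deriv_eq, of k]
  by (simp add: qe_nth if_distrib cong: if_cong)

lemma partial_deriv_cmult:
  assumes "u differentiable (at x)"
  shows "partial_deriv k (\<lambda>y. c * u y) x = c * partial_deriv k u x"
  using has_derivative_mult_right[OF differentiable_has_derivative_partials[OF assms], of c, THEN partial_deriv_eq, of k]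
  by (simp add: qe_nth if_distrib cong: if_cong)

lemma harmonic_on_add:
  assumes "harmonic_on U u" "harmonic_on U w"
  shows "harmonic_on U (\<lambda>x. u x + w x)"
proof -
  have op: "open U" using assms(1) by (simp add: harmonic_on_def)
  have u: "C1_on U u" "\<And>k. C1_on U (partial_deriv k u)" "C1_on U w" "\<And>k. C1_on U (partial_deriv k w)"
    using assms by (auto simp: harmonic_on_def C2_on_def)
  have 1: "partial_deriv k (\<lambda>x. u x + w x) x = partial_deriv k u x + partial_deriv k w x" if "x \<in> U" for k x
    using u that by (intro partial_deriv_add) (auto simp: C1_on_def)
  have 2: "partial_deriv k (partial_deriv k (\<lambda>x. u x + w x)) x = partial_deriv k (partial_deriv k u) x + partial_deriv k (partial_deriv k w) x" if "x \<in> U" for k x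
    using partial_deriv_cong_open[OF op that 1] partial_deriv_add[of "partial_deriv k u" x "partial_deriv k w" k] u that
    by (auto simp: C1_on_def)
  have "C1_on U (partial_deriv k (\<lambda>x. u x + w x))" for k
    by (rule C1_on_cong_open[OF op 1 C1_on_add[OF u(2,4)]])
  then show ?thesis using assms C1_on_add[OF u(1,3)] by (simp add: harmonic_on_def C2_on_def 2 sum.distrib)
qed

lemma harmonic_on_cmult:
  assumes "harmonic_on U u"
  shows "harmonic_on U (\<lambda>x. c * u x)"
proof -
  have op: "open U" using assms(1) by (simp add: harmonic_on_def)
  have u: "C1_on U u" "\<And>k. C1_on U (partial_deriv k u)"
    using assms by (auto simp: harmonic_on_def C2_on_def)
  have 1: "partial_deriv k (\<lambda>x. c * u x) x = c * partial_deriv k u x" if "x \<in> U" for k x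
    using u that by (intro partial_deriv_cmult) (auto simp: C1_on_def)
  have 2: "partial_deriv k (partial_deriv k (\<lambda>x. c * u x)) x = c * partial_deriv k (partial_deriv k u) x" if "x \<in> U" for k x
    using partial_deriv_cong_open[OF op that 1] partial_deriv_cmult[of "partial_deriv k u" x k c] u that
    by (auto simp: C1_on_def)
  have "C1_on U (partial_deriv k (\<lambda>x. c * u x))" for k
    by (rule C1_on_cong_open[OF op 1 C1_on_cmult[OF u(2)]])
  then show ?thesis using assms C1_on_cmult[OF u(1)] by (simp add: harmonic_on_def C2_on_def 2 flip: sum_distrib_left)
qed

lemma harmonic_on_cong:
  assumes "\<And>x. x \<in> U \<Longrightarrow> u x = w x" "harmonic_on U w"
  shows "harmonic_on U u"
proof -
  have op: "open U" using assms(2) by (simp add: harmonic_on_def)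
  have 1: "partial_deriv k u x = partial_deriv k w x" if "x \<in> U" for k x
    using partial_deriv_cong_open[OF op that assms(1)] .
  have 2: "partial_deriv k (partial_deriv k u) x = partial_deriv k (partial_deriv k w) x" if "x \<in> U" for k x
    using partial_deriv_cong_open[OF op that 1] .
  show ?thesis using assms(2) C1_on_cong_open[OF op assms(1)] C1_on_cong_open[OF op 1]
    by (simp add: harmonic_on_def C2_on_def 2)
qed

text \<open>
  Harmonicity, including the required differentiability, only involves germs.
\<close>

lemma harmonic_on_local:
  assumes "\<And>x. x \<in> U \<Longrightarrow> \<exists>V\<subseteq>U. x \<in> V \<and> harmonic_on V u"
  shows "harmonic_on U u"
proof -
  have "\<exists>V. open V \<and> x \<in> V \<and> V \<subseteq> U" if "x \<in> U" for x using assms[OF that] by (auto simp: harmonic_on_def)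
  then have "open U" by (subst open_subopen) blast
  have V: "\<exists>V. open V \<and> x \<in> V \<and> C1_on V u \<and> (\<forall>k. C1_on V (partial_deriv k u)) \<and>
      (\<Sum>k\<in>UNIV. partial_deriv k (partial_deriv k u) x) = 0" if x: "x \<in> U" for x
  proof -
    obtain V where "x \<in> V" "harmonic_on V u" using assms[OF x] by blast
    then show ?thesis unfolding harmonic_on_def C2_on_def by (intro exI[of _ V]) simp
  qed
  have "C1_on U u"
    by (rule C1_on_local) (meson V)
  moreover have "C1_on U (partial_deriv k u)" for k
    by (rule C1_on_local) (meson V)
  ultimately show ?thesis using \<open>open U\<close> V by (auto simp: harmonic_on_def C2_on_def)
qed

text \<open>
  The function \<open>z\<^sub>j/|z|\<^sup>4\<close>, written so that it is visibly a decay kernel.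
\<close>

definition riesz_kernel :: "4 \<Rightarrow> quat \<Rightarrow> real" where
  "riesz_kernel j z = z $ j * (1 / (norm z)\<^sup>2 * (1 / (norm z)\<^sup>2))"

lemma decay_kernel_riesz: "decay_kernel 3 (riesz_kernel j)"
proof -
  have "decay_kernel (Suc 3) (\<lambda>z. 1 / (norm z)\<^sup>2 * (1 / (norm z)\<^sup>2))"
    using decay_kernel.mult[OF decay_kernel.inv decay_kernel.inv] by simp
  then show ?thesis unfolding riesz_kernel_def[abs_def] by (rule decay_kernel.coord)
qed

lemma fueter_kernel_riesz:
  "fueter_kernel z \<otimes> q = (\<Sum>j\<in>UNIV. ((if j = 0 then 1 else -1) / (2 * pi\<^sup>2) * riesz_kernel j z) *\<^sub>R (qe j \<otimes> q))"
proof -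
  have r: "riesz_kernel j z = z $ j / norm z ^ 4" for j
    by (simp add: riesz_kernel_def power_add[symmetric])
  have "fueter_kernel z = (\<Sum>j\<in>UNIV. ((if j = 0 then 1 else -1) / (2 * pi\<^sup>2) * riesz_kernel j z) *\<^sub>R qe j)"
    unfolding quat_eq_iff
    by (simp add: fueter_kernel_def r sum_UNIV_quat qe_nth qcnj_nth)
  then show ?thesis
    by (simp add: bounded_bilinear.sum_left[OF bounded_bilinear_qmult] qmult_scaleR)
qed

text \<open>
  Up to a constant, \<open>z\<^sub>j/|z|\<^sup>4\<close> is a partial derivative of the Newton kernel \<open>1/|z|\<^sup>2\<close> of \<open>\<real>\<^sup>4\<close>, hence
  harmonic off the origin.  The first and second partial derivatives are written out with
  \<open>E = 1/|z|\<^sup>2\<close> and the Kronecker symbol \<open>D\<close>; the trace of the second ones is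
  \<open>-24 z\<^sub>j E\<^sup>3 + 24 z\<^sub>j E\<^sup>4 |z|\<^sup>2 = 0\<close>.
\<close>

lemma riesz_kernel_harmonic:
  assumes "far_density \<phi> x0 \<delta>"
  shows "harmonic_on (ball x0 \<delta>) (potential (riesz_kernel j) \<phi>)"
proof -
  define E :: "quat \<Rightarrow> real" where "E z = 1 / (norm z)\<^sup>2" for z
  define D :: "4 \<Rightarrow> 4 \<Rightarrow> real" where "D i l = (if i = l then 1 else 0)" for i l
  define k' where "k' i z = D i j * (E z * E z) + (-4) * (z $ i * (z $ j * (E z * (E z * E z))))" for i z
  define k'' where "k'' i l z = (-4 * D i j) * (z $ l * (E z * (E z * E z))) + ((-4 * D i l) * (z $ j * (E z * (E z * E z)))
     + ((-4 * D j l) * (z $ i * (E z * (E z * E z))) + 24 * (z $ i * (z $ j * (z $ l * ((E z * E z) * (E z * E z)))))))" for i l z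
  have E2: "decay_kernel 4 (\<lambda>z. E z * E z)" using decay_kernel.mult[OF decay_kernel.inv decay_kernel.inv] by (simp add: E_def)
  have E3: "decay_kernel 6 (\<lambda>z. E z * (E z * E z))" using decay_kernel.mult[OF decay_kernel.inv E2] by (simp add: E_def)
  have E4: "decay_kernel 8 (\<lambda>z. (E z * E z) * (E z * E z))" using decay_kernel.mult[OF E2 E2] by simp
  have up: "decay_kernel d (\<lambda>z. z $ i * k z)" if "decay_kernel e k" "e = Suc d" for d e k i
    using decay_kernel.coord that by simp
  have k': "decay_kernel (Suc 3) (k' i)" for i
    unfolding k'_def using E2 by (intro decay_kernel.add decay_kernel.scale up[OF up[OF E3]]) auto
  have k'': "decay_kernel (Suc (Suc 3)) (k'' i l)" for i l
    unfolding k''_def by (intro decay_kernel.add decay_kernel.scale up[OF E3] up[OF up[OF up[OF E4]]]) auto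
  have dE: "(E has_derivative (\<lambda>v. -2 * (z \<bullet> v) * (E z * E z))) (at z)" if "z \<noteq> 0" for z
  proof (rule has_derivative_eq_rhs[OF has_derivative_inverse_norm_square[OF that, folded E_def]], intro ext)
    show "(\<Sum>i\<in>UNIV. - 2 * (z $ i * (E z * E z)) * v $ i) = -2 * (z \<bullet> v) * (E z * E z)" for v
      unfolding inner_vec_def sum_distrib_left sum_distrib_right by (rule sum.cong) simp_all
  qed
  have dc: "((\<lambda>z::quat. z $ i) has_derivative (\<lambda>v. v $ i)) (at z)" for i z
    by (rule bounded_linear_imp_has_derivative[OF bounded_linear_vec_nth])
  have Dsum: "(\<Sum>l\<in>UNIV. D i l * v l) = v i" "(\<Sum>l\<in>UNIV. D l i * v l) = v i" for i v
    by (simp_all add: D_def if_distrib if_distribR cong: if_cong)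
  have inner: "(\<Sum>l\<in>UNIV. z $ l * v $ l) = z \<bullet> v" for z v :: quat by (simp add: inner_vec_def)
  have der: "(riesz_kernel j has_derivative (\<lambda>v. \<Sum>i\<in>UNIV. k' i z * v $ i)) (at z)" if "z \<noteq> 0" for z
    unfolding riesz_kernel_def[abs_def] E_def[symmetric]
  proof (rule has_derivative_eq_rhs[OF has_derivative_mult[OF dc has_derivative_mult[OF dE[OF that] dE[OF that]]]], intro ext)
    fix v
    have "(\<Sum>i\<in>UNIV. k' i z * v $ i) = (E z * E z) * (\<Sum>i\<in>UNIV. D i j * v $ i) + (-4 * z $ j * (E z * (E z * E z))) * (\<Sum>i\<in>UNIV. z $ i * v $ i)"
      unfolding k'_def sum_distrib_left by (simp only: sum.distrib[symmetric]) (rule sum.cong, simp_all add: algebra_simps)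
    then show "z $ j * (E z * (- 2 * (z \<bullet> v) * (E z * E z)) + - 2 * (z \<bullet> v) * (E z * E z) * E z) + v $ j * (E z * E z) = (\<Sum>i\<in>UNIV. k' i z * v $ i)"
      unfolding Dsum inner by (simp add: algebra_simps)
  qed
  have der': "(k' i has_derivative (\<lambda>v. \<Sum>l\<in>UNIV. k'' i l z * v $ l)) (at z)" if z: "z \<noteq> 0" for i z
  proof -
    note d2 = has_derivative_mult[OF dE[OF z] dE[OF z]]
    note d3 = has_derivative_mult[OF dE[OF z] d2]
    note d = has_derivative_add[OF has_derivative_mult_right[OF d2, of "D i j"]
        has_derivative_mult_right[OF has_derivative_mult[OF dc has_derivative_mult[OF dc d3]], of "-4" i j]]
    show ?thesis unfolding k'_def
    proof (rule has_derivative_eq_rhs[OF d], intro ext)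
      fix v
      have "(\<Sum>l\<in>UNIV. k'' i l z * v $ l) = (-4 * D i j * (E z * (E z * E z))) * (\<Sum>l\<in>UNIV. z $ l * v $ l)
         + (-4 * z $ j * (E z * (E z * E z))) * (\<Sum>l\<in>UNIV. D i l * v $ l)
         + (-4 * z $ i * (E z * (E z * E z))) * (\<Sum>l\<in>UNIV. D j l * v $ l)
         + (24 * z $ i * z $ j * ((E z * E z) * (E z * E z))) * (\<Sum>l\<in>UNIV. z $ l * v $ l)"
        unfolding k''_def sum_distrib_left by (simp only: sum.distrib[symmetric]) (rule sum.cong, simp_all add: algebra_simps)
      then show "D i j * (E z * (- 2 * (z \<bullet> v) * (E z * E z)) + - 2 * (z \<bullet> v) * (E z * E z) * E z) +
         - 4 * (z $ i * (z $ j * (E z * (E z * (- 2 * (z \<bullet> v) * (E z * E z)) + - 2 * (z \<bullet> v) * (E z * E z) * E z) +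
               - 2 * (z \<bullet> v) * (E z * E z) * (E z * E z)) + v $ j * (E z * (E z * E z))) +
          v $ i * (z $ j * (E z * (E z * E z)))) = (\<Sum>l\<in>UNIV. k'' i l z * v $ l)"
        unfolding Dsum inner by (simp add: algebra_simps)
    qed
  qed
  have "(\<Sum>i\<in>UNIV. k'' i i z) = 0" if "z \<noteq> 0" for z
  proof -
    have e: "(\<Sum>i\<in>UNIV. z $ i * z $ i) * E z = 1"
      using that unfolding inner by (simp add: E_def power2_norm_eq_inner)
    have "(\<Sum>i\<in>UNIV. k'' i i z) = (-8 * (E z * (E z * E z))) * (\<Sum>i\<in>UNIV. D j i * z $ i)
       + (-4 * z $ j * (E z * (E z * E z))) * (\<Sum>i\<in>(UNIV::4 set). 1)
       + (24 * z $ j * ((E z * E z) * (E z * E z))) * (\<Sum>i\<in>UNIV. z $ i * z $ i)"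
      unfolding k''_def sum_distrib_left
      by (simp only: sum.distrib[symmetric]) (rule sum.cong, auto simp add: algebra_simps D_def)
    also have "\<dots> = -24 * z $ j * (E z * (E z * E z)) + 24 * z $ j * (E z * (E z * E z)) * ((\<Sum>i\<in>UNIV. z $ i * z $ i) * E z)"
      unfolding Dsum by (simp add: algebra_simps)
    also have "\<dots> = 0" unfolding e by simp
    finally show ?thesis .
  qed
  then show ?thesis
    by (intro far_density.potential_harmonic[OF assms decay_kernel_riesz k' k'' der der']) auto
qed

lemma DERIV_max_0_square: "((\<lambda>t. (max 0 t)\<^sup>2) has_field_derivative 2 * max 0 t) (at (t::real))"
  unfolding has_field_derivative_def
proof (rule has_derivativeI_sandwich[of 1])
  show "norm (((max 0 s)\<^sup>2 - (max 0 t)\<^sup>2) - 2 * max 0 t * (s - t)) / norm (s - t) \<le> norm (s - t)" if "s \<noteq> t" for s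
  proof -
    have "\<bar>((max 0 s)\<^sup>2 - (max 0 t)\<^sup>2) - 2 * max 0 t * (s - t)\<bar> \<le> (s - t)\<^sup>2"
    proof (cases "s \<ge> 0"; cases "t \<ge> 0")
      assume "\<not> s \<ge> 0" "t \<ge> 0"
      then have "s * t \<le> 0" by (simp add: mult_nonpos_nonneg)
      have m: "max 0 s = 0" "max 0 t = t" using \<open>\<not> s \<ge> 0\<close> \<open>t \<ge> 0\<close> by auto
      have "0\<^sup>2 - t\<^sup>2 - 2 * t * (s - t) = (s - t)\<^sup>2 - s\<^sup>2"
           "0\<^sup>2 - t\<^sup>2 - 2 * t * (s - t) = t\<^sup>2 - 2 * (s * t)"
        by (simp_all add: power2_eq_square algebra_simps)
      then show ?thesis unfolding m using \<open>s * t \<le> 0\<close> zero_le_power2[of s] zero_le_power2[of t] by linarith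
    next
      assume "s \<ge> 0" "\<not> t \<ge> 0"
      then have m: "max 0 s = s" "max 0 t = 0" and "s\<^sup>2 \<le> (s - t)\<^sup>2" by (auto intro!: power_mono)
      then show ?thesis unfolding m by simp
    next
      assume "s \<ge> 0" "t \<ge> 0"
      then have m: "max 0 s = s" "max 0 t = t" by auto
      have "s\<^sup>2 - t\<^sup>2 - 2 * t * (s - t) = (s - t)\<^sup>2" by (simp add: power2_eq_square algebra_simps)
      then show ?thesis unfolding m by simp
    qed (simp add: max_def)
    then show ?thesis using that by (simp add: divide_le_eq power2_eq_square abs_mult_self)
  qed
  have "((\<lambda>s. norm (s - t)) \<longlongrightarrow> norm (t - t)) (at t)" by (intro tendsto_intros)
  then show "((\<lambda>s. norm (s - t)) \<longlongrightarrow> 0) (at t)" by simp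
qed (auto simp: bounded_linear_mult_right)

lemma C1_on_max_0_square: "C1_on U u \<Longrightarrow> C1_on U (\<lambda>x. (max 0 (u x))\<^sup>2)"
  by (rule C1_on_compose_real[where h="\<lambda>t. (max 0 t)\<^sup>2" and h'="\<lambda>t. 2 * max 0 t"])
     (auto intro!: DERIV_max_0_square continuous_intros)

text \<open>
  Multiply by a cutoff that is one on the small ball and zero outside a slightly larger one.
\<close>

lemma C1_compact_extension:
  fixes f :: "quat \<Rightarrow> quat"
  assumes "open U" and f: "\<And>j. C1_on U (\<lambda>y. f y $ j)" and \<delta>: "\<delta> > 0" "cball x0 (2 * \<delta>) \<subseteq> U"
  obtains F R where "\<And>j. C1_on UNIV (\<lambda>y. F y $ j)" "\<And>y. norm y > R \<Longrightarrow> F y = 0" "\<And>y. y \<in> ball x0 \<delta> \<Longrightarrow> F y = f y"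
proof -
  define s where "s y = (norm (y - x0))\<^sup>2 / \<delta>\<^sup>2" for y
  \<comment> \<open>Composing two truncated squares keeps the cutoff continuously differentiable: it is 1 for
    s at most 1 and 0 for s at least 2.\<close>
  define \<zeta> where "\<zeta> y = 1 - (max 0 (1 - (max 0 (2 - s y))\<^sup>2))\<^sup>2" for y
  define F where "F y = (if y \<in> U then \<zeta> y *\<^sub>R f y else 0)" for y
  have "s = (\<lambda>y. (1 / \<delta>\<^sup>2) * (((y $ 0 - x0 $ 0) * (y $ 0 - x0 $ 0) + (y $ 1 - x0 $ 1) * (y $ 1 - x0 $ 1))
     + ((y $ 2 - x0 $ 2) * (y $ 2 - x0 $ 2) + (y $ 3 - x0 $ 3) * (y $ 3 - x0 $ 3))))"
    unfolding s_def norm_quat_squared by (simp add: power2_eq_square add.assoc)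
  then have "C1_on UNIV s"
    by (simp only:) (intro C1_on_cmult C1_on_add C1_on_mult C1_on_diff C1_on_coord C1_on_const)
  then have \<zeta>C: "C1_on UNIV \<zeta>" unfolding \<zeta>_def
    by (intro C1_on_diff C1_on_const C1_on_max_0_square)
  have \<zeta>1: "\<zeta> y = 1" if "y \<in> ball x0 \<delta>" for y
  proof -
    have "(norm (y - x0))\<^sup>2 \<le> \<delta>\<^sup>2" using that by (intro power_mono) (auto simp: dist_norm norm_minus_commute)
    then have "s y \<le> 1" using \<delta> by (simp add: s_def)
    then have "1 \<le> (2 - s y)\<^sup>2" using power_mono[of 1 "2 - s y" 2] by simp
    then have "max 0 (2 - s y) = 2 - s y" "max 0 (1 - (2 - s y)\<^sup>2) = 0" using \<open>s y \<le> 1\<close> by linarith+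
    then show ?thesis by (simp add: \<zeta>_def)
  qed
  have \<zeta>0: "\<zeta> y = 0" if "dist x0 y \<ge> 3 / 2 * \<delta>" for y
  proof -
    have "(3 / 2 * \<delta>)\<^sup>2 \<le> (norm (y - x0))\<^sup>2" using that \<delta> by (intro power_mono) (auto simp: dist_norm norm_minus_commute)
    moreover have "(3 / 2 * \<delta>)\<^sup>2 = 9 / 4 * \<delta>\<^sup>2" by (simp add: power2_eq_square)
    ultimately have "2 * \<delta>\<^sup>2 \<le> (norm (y - x0))\<^sup>2" using zero_le_power2[of \<delta>] by linarith
    then have "s y \<ge> 2" using \<delta> by (simp add: s_def le_divide_eq)
    then show ?thesis by (simp add: \<zeta>_def)
  qed
  have F0: "F y = 0" if "dist x0 y \<ge> 3 / 2 * \<delta>" for y using \<zeta>0[OF that] by (simp add: F_def)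
  have "C1_on UNIV (\<lambda>y. F y $ j)" for j
  proof (rule C1_on_local)
    fix y
    show "\<exists>V. open V \<and> y \<in> V \<and> C1_on V (\<lambda>y. F y $ j)"
    proof (cases "y \<in> U")
      case True
      have "C1_on U (\<lambda>y. F y $ j)"
        by (rule C1_on_cong_open[OF \<open>open U\<close> _ C1_on_mult[OF C1_on_subset[OF \<zeta>C] f[of j]]]) (auto simp: F_def)
      then show ?thesis using \<open>open U\<close> True by blast
    next
      case False
      have "open (- cball x0 (3 / 2 * \<delta>))" by (simp add: open_Compl)
      moreover from this have "C1_on (- cball x0 (3 / 2 * \<delta>)) (\<lambda>y. F y $ j)"
        by (rule C1_on_cong_open[OF _ _ C1_on_const[of _ 0]]) (use F0 in auto)
      moreover have "y \<in> - cball x0 (3 / 2 * \<delta>)" using False \<delta> by force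
      ultimately show ?thesis by blast
    qed
  qed
  moreover have "F y = 0" if "norm y > norm x0 + 2 * \<delta>" for y
  proof (rule F0)
    have "norm y \<le> norm x0 + dist x0 y" using norm_triangle_ineq[of x0 "y - x0"] by (simp add: dist_norm norm_minus_commute)
    then show "3 / 2 * \<delta> \<le> dist x0 y" using that \<delta> by simp
  qed
  moreover have "F y = f y" if "y \<in> ball x0 \<delta>" for y
  proof -
    have "y \<in> cball x0 (2 * \<delta>)" using that \<delta>(1) by simp
    then show ?thesis using \<zeta>1[OF that] \<delta>(2) by (auto simp: F_def)
  qed
  ultimately show ?thesis using that by blast
qed

section \<open>Removing the Teodorescu transform\<close>

lemma fueter_cong_open:
  assumes "open V" "y \<in> V" "\<And>y. y \<in> V \<Longrightarrow> F y = f y"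
  shows "fueter F y = fueter f y"
proof -
  have "partial_deriv k (\<lambda>y. F y $ j) y = partial_deriv k (\<lambda>y. f y $ j) y" for j k
    by (rule partial_deriv_cong_open[OF assms(1,2)]) (simp add: assms(3))
  then show ?thesis by (simp add: fueter_def)
qed

lemma fueter_kernel_measurable: "fueter_kernel \<in> borel_measurable borel"
proof -
  have "continuous_on UNIV qcnj" unfolding qcnj_def qvec_def by (intro continuous_intros)
  then have [measurable]: "qcnj \<in> borel_measurable borel" by (rule borel_measurable_continuous_onI)
  show ?thesis unfolding fueter_kernel_def[abs_def] by measurable
qed

lemma qmult_measurable:
  assumes "P \<in> borel_measurable M" "Q \<in> borel_measurable M"
  shows "(\<lambda>y. P y \<otimes> Q y) \<in> borel_measurable M"
  by (rule borel_measurable_continuous_Pair[OF assms])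
     (intro bounded_bilinear.continuous_on[OF bounded_bilinear_qmult] continuous_intros)

text \<open>
  Expanding the quaternion product reduces every component to four scalar potentials of harmonic
  kernels.
\<close>

lemma kernel_potential_harmonic:
  fixes \<phi> :: "quat \<Rightarrow> quat"
  assumes meas: "\<phi> \<in> borel_measurable lebesgue" and sq: "integrable lebesgue (\<lambda>y. (norm (\<phi> y))\<^sup>2)"
    and vanish: "\<And>y. y \<in> ball x0 \<delta> \<Longrightarrow> \<phi> y = 0"
  shows "\<And>x. x \<in> ball x0 \<delta> \<Longrightarrow> integrable lebesgue (\<lambda>y. fueter_kernel (x - y) \<otimes> \<phi> y)"
    and "harmonic_on (ball x0 \<delta>) (\<lambda>x. (\<integral>y. fueter_kernel (x - y) \<otimes> \<phi> y \<partial>lebesgue) $ k)"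
proof -
  have int: "integrable lebesgue (\<lambda>y. fueter_kernel (x - y) \<otimes> \<phi> y)" if x: "x \<in> ball x0 \<delta>" for x
  proof -
    interpret n: far_density "\<lambda>y. norm (\<phi> y)" x0 \<delta>
      by unfold_locales (use meas sq vanish in auto)
    have "integrable lebesgue (\<lambda>y. 1 / (2 * pi\<^sup>2) * (\<bar>norm (\<phi> y)\<bar> / norm (x - y) ^ 3))"
      by (intro integrable_mult_right n.integrable_inverse_power[OF x]) simp
    then show ?thesis
    proof (rule Bochner_Integration.integrable_bound)
      have "(\<lambda>y. fueter_kernel (x - y)) \<in> borel_measurable borel" using fueter_kernel_measurable by measurable
      then have "(\<lambda>y. fueter_kernel (x - y)) \<in> borel_measurable lebesgue"
        by (intro measurable_completion) simp
      then show "(\<lambda>y. fueter_kernel (x - y) \<otimes> \<phi> y) \<in> borel_measurable lebesgue"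
        by (rule qmult_measurable[OF _ meas])
      have "norm (fueter_kernel (x - y) \<otimes> \<phi> y) \<le> norm (1 / (2 * pi\<^sup>2) * (\<bar>norm (\<phi> y)\<bar> / norm (x - y) ^ 3))" for y
        by (cases "x = y") (simp_all add: norm_qmult fueter_kernel_def eval_nat_numeral)
      then show "AE y in lebesgue. norm (fueter_kernel (x - y) \<otimes> \<phi> y) \<le> norm (1 / (2 * pi\<^sup>2) * (\<bar>norm (\<phi> y)\<bar> / norm (x - y) ^ 3))"
        by simp
    qed
  qed
  then show "integrable lebesgue (\<lambda>y. fueter_kernel (x - y) \<otimes> \<phi> y)" if "x \<in> ball x0 \<delta>" for x using that .
  define c :: "4 \<Rightarrow> real" where "c j = (if j = 0 then 1 else -1) / (2 * pi\<^sup>2)" for j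
  define \<psi> where "\<psi> j y = (qe j \<otimes> \<phi> y) $ k" for j y
  have far: "far_density (\<psi> j) x0 \<delta>" for j
  proof
    have "(\<lambda>y. qe j \<otimes> \<phi> y) \<in> borel_measurable lebesgue" by (rule qmult_measurable[OF _ meas]) simp
    moreover have "(\<lambda>q::quat. q $ k) \<in> borel_measurable borel"
      by (intro borel_measurable_continuous_onI continuous_intros)
    ultimately show m: "\<psi> j \<in> borel_measurable lebesgue" unfolding \<psi>_def
      by (rule measurable_compose)
    show "integrable lebesgue (\<lambda>y. (\<psi> j y)\<^sup>2)"
    proof (rule Bochner_Integration.integrable_bound[OF sq])
      have "norm ((\<psi> j y)\<^sup>2) \<le> norm ((norm (\<phi> y))\<^sup>2)" for y
        using power_mono[OF component_le_norm_cart[of "qe j \<otimes> \<phi> y" k], of 2] by (simp add: \<psi>_def norm_qmult)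
      then show "AE y in lebesgue. norm ((\<psi> j y)\<^sup>2) \<le> norm ((norm (\<phi> y))\<^sup>2)" by simp
    qed (use m in simp)
    show "\<psi> j y = 0" if "y \<in> ball x0 \<delta>" for y using vanish[OF that] by (simp add: \<psi>_def)
  qed
  have "harmonic_on (ball x0 \<delta>) (\<lambda>x. c 0 * potential (riesz_kernel 0) (\<psi> 0) x + c 1 * potential (riesz_kernel 1) (\<psi> 1) x
    + c 2 * potential (riesz_kernel 2) (\<psi> 2) x + c 3 * potential (riesz_kernel 3) (\<psi> 3) x)"
    by (intro harmonic_on_add harmonic_on_cmult riesz_kernel_harmonic far)
  then show "harmonic_on (ball x0 \<delta>) (\<lambda>x. (\<integral>y. fueter_kernel (x - y) \<otimes> \<phi> y \<partial>lebesgue) $ k)"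
  proof (rule harmonic_on_cong[rotated])
    fix x assume x: "x \<in> ball x0 \<delta>"
    have i: "integrable lebesgue (\<lambda>y. riesz_kernel j (x - y) * \<psi> j y)" for j
    proof -
      have "decay_kernel 3 (riesz_kernel j)" by (rule decay_kernel_riesz)
      then show ?thesis by (rule far_density.integrable_potential[OF far _ x]) simp
    qed
    have "(\<integral>y. fueter_kernel (x - y) \<otimes> \<phi> y \<partial>lebesgue) $ k = (\<integral>y. (fueter_kernel (x - y) \<otimes> \<phi> y) $ k \<partial>lebesgue)"
      using integral_bounded_linear[OF bounded_linear_vec_nth int[OF x], of k] by simp
    also have "\<dots> = (\<integral>y. (\<Sum>j\<in>UNIV. c j * (riesz_kernel j (x - y) * \<psi> j y)) \<partial>lebesgue)"
      by (simp add: fueter_kernel_riesz c_def \<psi>_def mult.assoc)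
    also have "\<dots> = (\<Sum>j\<in>UNIV. c j * potential (riesz_kernel j) (\<psi> j) x)"
      unfolding potential_def
      by (subst Bochner_Integration.integral_sum) (auto intro!: integrable_mult_right i)
    finally show "(\<integral>y. fueter_kernel (x - y) \<otimes> \<phi> y \<partial>lebesgue) $ k = c 0 * potential (riesz_kernel 0) (\<psi> 0) x + c 1 * potential (riesz_kernel 1) (\<psi> 1) x
    + c 2 * potential (riesz_kernel 2) (\<psi> 2) x + c 3 * potential (riesz_kernel 3) (\<psi> 3) x"
      by (simp only: sum_UNIV_quat)
  qed
qed

lemma norm_diff_square_le: "(norm (a - b))\<^sup>2 \<le> 2 * (norm a)\<^sup>2 + 2 * (norm b)\<^sup>2" for a b :: quat
proof -
  have "(norm (a - b))\<^sup>2 \<le> (norm a + norm b)\<^sup>2" by (intro power_mono norm_triangle_ineq4) simp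
  also have "\<dots> \<le> 2 * (norm a)\<^sup>2 + 2 * (norm b)\<^sup>2"
    using sum_squares_bound[of "norm a" "norm b"] by (simp add: power2_sum)
  finally show ?thesis .
qed

text \<open>
  On a small ball,
  \<open>f = F = \<T>[D F]\<close> for a compactly supported extension \<open>F\<close>, so that \<open>f - \<T>[g]\<close> is the potential of
  \<open>D F - g\<close>, which vanishes on the ball.
\<close>

theorem C1_minus_teodorescu_harmonic:
  fixes f g :: "quat \<Rightarrow> quat"
  assumes "open U" "U \<subseteq> \<Omega>" and f: "\<And>j. C1_on U (\<lambda>x. f x $ j)"
    and Df: "\<And>x. x \<in> U \<Longrightarrow> fueter f x = g x" and L2: "L2_on \<Omega> g"
  shows "harmonic_on U (\<lambda>x. (f x - teodorescu \<Omega> g x) $ k)"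
proof (rule harmonic_on_local)
  fix x0 assume "x0 \<in> U"
  then obtain e where e: "e > 0" "cball x0 e \<subseteq> U" using \<open>open U\<close> open_contains_cball by blast
  define \<delta> where "\<delta> = e / 2"
  have \<delta>: "\<delta> > 0" "cball x0 (2 * \<delta>) \<subseteq> U" using e by (auto simp: \<delta>_def)
  have bU: "ball x0 \<delta> \<subseteq> U" using \<delta> by (auto simp: subset_iff)
  obtain F R where FC: "\<And>j. C1_on UNIV (\<lambda>y. F y $ j)" and F0: "\<And>y. norm y > R \<Longrightarrow> F y = 0"
    and Ff: "\<And>y. y \<in> ball x0 \<delta> \<Longrightarrow> F y = f y"
    using C1_compact_extension[OF \<open>open U\<close> f \<delta>] by blast
  define G where "G y = indicator \<Omega> y *\<^sub>R g y" for y
  have Gm: "G \<in> borel_measurable lebesgue" using L2 by (simp add: L2_on_def set_borel_measurable_def G_def[abs_def])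
  have "integrable lebesgue (\<lambda>y. indicator \<Omega> y *\<^sub>R (norm (g y))\<^sup>2)"
    using L2 by (simp add: L2_on_def set_integrable_def)
  moreover have "indicator \<Omega> y *\<^sub>R (norm (g y))\<^sup>2 = (norm (G y))\<^sup>2" for y
    by (simp add: G_def indicator_def)
  ultimately have G2: "integrable lebesgue (\<lambda>y. (norm (G y))\<^sup>2)" by simp
  have Qc: "continuous_on UNIV (fueter F)" and Q0: "\<And>y. norm y > R \<Longrightarrow> fueter F y = 0"
    using fueter_C1_compact[OF FC F0] by auto
  obtain B where B: "\<And>y. norm (fueter F y) \<le> B" using fueter_C1_compact(3)[OF FC F0] by blast
  have Qm: "fueter F \<in> borel_measurable borel" by (rule borel_measurable_continuous_onI[OF Qc])
  have "integrable lborel (\<lambda>y. (norm (fueter F y))\<^sup>2)"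
  proof (rule integrable_bounded_support[of _ "B\<^sup>2" R])
    show "\<bar>(norm (fueter F y))\<^sup>2\<bar> \<le> B\<^sup>2" for y using B[of y] by (simp add: power_mono)
  qed (use Qm Q0 in auto)
  then have Q2: "integrable lebesgue (\<lambda>y. (norm (fueter F y))\<^sup>2)"
    by (subst integrable_completion) (use Qm in auto)
  define \<phi> where "\<phi> y = fueter F y - G y" for y
  have \<phi>m: "\<phi> \<in> borel_measurable lebesgue"
    unfolding \<phi>_def using Gm measurable_completion[of "fueter F" lborel borel] Qm by simp
  have \<phi>2: "integrable lebesgue (\<lambda>y. (norm (\<phi> y))\<^sup>2)"
  proof (rule Bochner_Integration.integrable_bound)
    show "integrable lebesgue (\<lambda>y. 2 * (norm (fueter F y))\<^sup>2 + 2 * (norm (G y))\<^sup>2)"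
      by (intro Bochner_Integration.integrable_add integrable_mult_right Q2 G2)
    show "(\<lambda>y. (norm (\<phi> y))\<^sup>2) \<in> borel_measurable lebesgue" using \<phi>m by simp
  qed (use norm_diff_square_le in \<open>auto simp: \<phi>_def\<close>)
  have \<phi>0: "\<phi> y = 0" if y: "y \<in> ball x0 \<delta>" for y
  proof -
    have "fueter F y = fueter f y" by (rule fueter_cong_open[OF open_ball y Ff])
    also have "\<dots> = g y" using Df bU y by blast
    also have "\<dots> = G y"
    proof -
      have "y \<in> \<Omega>" using bU y \<open>U \<subseteq> \<Omega>\<close> by blast
      then show ?thesis by (simp add: G_def)
    qed
    finally show ?thesis by (simp add: \<phi>_def)
  qed
  have "harmonic_on (ball x0 \<delta>) (\<lambda>x. (f x - teodorescu \<Omega> g x) $ k)"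
  proof (rule harmonic_on_cong)
    show "harmonic_on (ball x0 \<delta>) (\<lambda>x. (\<integral>y. fueter_kernel (x - y) \<otimes> \<phi> y \<partial>lebesgue) $ k)"
      by (rule kernel_potential_harmonic(2)[OF \<phi>m \<phi>2 \<phi>0])
    fix x assume x: "x \<in> ball x0 \<delta>"
    have i1: "integrable lebesgue (\<lambda>y. fueter_kernel (x - y) \<otimes> \<phi> y)"
      by (rule kernel_potential_harmonic(1)[OF \<phi>m \<phi>2 \<phi>0 x])
    have KF: "(\<lambda>y. fueter_kernel (x - y) \<otimes> fueter F y) \<in> borel_measurable lborel"
      using borel_measurable_integrable[OF cauchy_pompeiu(1)[OF FC F0]] .
    have i2: "integrable lebesgue (\<lambda>y. fueter_kernel (x - y) \<otimes> fueter F y)"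
      using cauchy_pompeiu(1)[OF FC F0] integrable_completion[OF KF] by simp
    have F: "F x = (\<integral>y. fueter_kernel (x - y) \<otimes> fueter F y \<partial>lebesgue)"
      using cauchy_pompeiu(2)[OF FC F0, where x=x] integral_completion[OF KF] by simp
    have "teodorescu \<Omega> g x = (\<integral>y. fueter_kernel (x - y) \<otimes> fueter F y - fueter_kernel (x - y) \<otimes> \<phi> y \<partial>lebesgue)"
      unfolding teodorescu_def set_lebesgue_integral_def
      by (rule Bochner_Integration.integral_cong) (auto simp: \<phi>_def G_def qmult_scaleR simp flip: qmult_diff)
    also have "\<dots> = f x - (\<integral>y. fueter_kernel (x - y) \<otimes> \<phi> y \<partial>lebesgue)"
      using F Ff[OF x] by (simp add: Bochner_Integration.integral_diff[OF i2 i1])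
    finally show "(f x - teodorescu \<Omega> g x) $ k = (\<integral>y. fueter_kernel (x - y) \<otimes> \<phi> y \<partial>lebesgue) $ k" by simp
  qed
  then show "\<exists>V\<subseteq>U. x0 \<in> V \<and> harmonic_on V (\<lambda>x. (f x - teodorescu \<Omega> g x) $ k)"
    using bU \<delta>(1) by (intro exI[of _ "ball x0 \<delta>"]) auto
qed

theorem proposition3p15:
  fixes \<Omega> :: "quat set" and f :: "quat \<Rightarrow> quat"
  assumes "s_domain \<Omega>"
    and "axially_symmetric \<Omega>"
    and "slice_regular \<Omega> f"
    and "L2_on \<Omega> (bracket_sum f)"
  shows "\<forall>k. harmonic_on {x \<in> \<Omega>. qvec x \<noteq> 0}
           (\<lambda>x. (f x - teodorescu \<Omega> (bracket_sum f) x) $ k)"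
proof
  fix k
  show "harmonic_on {x \<in> \<Omega>. qvec x \<noteq> 0} (\<lambda>x. (f x - teodorescu \<Omega> (bracket_sum f) x) $ k)"
  proof (rule C1_minus_teodorescu_harmonic[OF _ _ _ _ assms(4)])
    have "open \<Omega>" using assms(1) by (simp add: s_domain_def domain_in_def)
    then show "open {x \<in> \<Omega>. qvec x \<noteq> 0}" by (rule open_off_real_axis)
    show "C1_on {x \<in> \<Omega>. qvec x \<noteq> 0} (\<lambda>x. f x $ j)" for j
      by (rule slice_regular_C1[OF assms(1-3)])
    show "fueter f x = bracket_sum f x" if "x \<in> {x \<in> \<Omega>. qvec x \<noteq> 0}" for x
      using fueter_slice_regular[OF assms(3)] that by simp
  qed auto
qed

end
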